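(* Let $b>0$ and let $\varphi=(\varphi_1,\varphi_2)$ be a pair of real-valued functions in $C^1[0,b]$ such that $\varphi_1,\varphi_2$ are increasing, $\varphi_1+\varphi_2$ is strictly increasing, $\varphi_1'(x)+\varphi_2'(x)>0$ for all $x\in(0,b]$, and $\varphi_1(0)=\varphi_2(0)=0$. Assume that for some $\varepsilon>0$ and for $k=1,2$ the function $x\mapsto\varphi_k(\sqrt{x})$ on $[0,b^2]$ extends to a function $\psi_k\in C(R_{b^2,\varepsilon})$ that is holomorphic on the interior of $R_{b^2,\varepsilon}$. Assume furthermore that one of the following two conditions holds: (1) for $k=1,2$, $\displaystyle\int_{-\varepsilon}^{\varepsilon}\frac{|\psi_k(\mathrm{i}t)|}{t^2}\,dt<\infty$; (2) $\varphi_2=0$, the function $\varphi_1'(x)/x$ is bounded on $(0,b]$, and $\displaystyle\int_{-\varepsilon}^{\varepsilon}\frac{|\psi_1(\mathrm{i}t)|}{|t|}\,dt<\infty$. Then for any $T\in\mathbb{M}_n[0,b]$ the flow $\{F^\varphi_t(T)\}_{t\ge0}$ converges to a normal matrix as $t\to\infty$. (Here $\mathrm{i}=\sqrt{-1}$.)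
   Context: For $r>0$ and $\varepsilon>0$, $R_{r,\varepsilon}=\{z\in\mathbb{C}: 0\le\operatorname{Re}z\le r+\varepsilon,\ -\varepsilon\le\operatorname{Im}z\le\varepsilon\}$. $\mathbb{M}_n$ is the algebra of $n\times n$ complex matrices, $|X|=(X^*X)^{1/2}$, $\sigma(\cdot)$ is the spectrum, $[A,B]=AB-BA$. $\mathbb{M}_n[0,b]=\{X\in\mathbb{M}_n: \sigma(|X|)\subset[0,b]\}$. For $X\in\mathbb{M}_n[0,b]$, $\varphi(X):=\varphi_1(|X|)-\varphi_2(|X^*|)$. "Increasing" means non-decreasing. $F^\varphi_t(T):=X(t)$, where $X:[0,\infty)\to\mathbb{M}_n[0,b]$ is the unique global solution of $\frac{dX(t)}{dt}=[\varphi(X(t)),X(t)]$, $X(0)=T$ (it exists and is unique whenever $\varphi_1,\varphi_2$ are increasing Lipschitz functions with $\varphi_1+\varphi_2$ strictly increasing). *)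

theory Defs
  imports "HOL-Complex_Analysis.Complex_Analysis"
begin

definition cadjoint :: "complex ^ 'n ^ 'm \<Rightarrow> complex ^ 'm ^ 'n" where
  "cadjoint A = (\<chi> i j. cnj (A $ j $ i))"

definition unitary_matrix :: "complex ^ 'n ^ 'n \<Rightarrow> bool" where
  "unitary_matrix U \<longleftrightarrow> cadjoint U ** U = mat 1 \<and> U ** cadjoint U = mat 1"

definition normal_matrix :: "complex ^ 'n ^ 'n \<Rightarrow> bool" where
  "normal_matrix A \<longleftrightarrow> cadjoint A ** A = A ** cadjoint A"

definition matrix_spectrum :: "complex ^ 'n ^ 'n \<Rightarrow> complex set" where
  "matrix_spectrum A = {z. \<not> invertible (A - mat z)}"

definition commutator :: "complex ^ 'n ^ 'n \<Rightarrow> complex ^ 'n ^ 'n \<Rightarrow> complex ^ 'n ^ 'n" where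
  "commutator A B = A ** B - B ** A"

definition real_diag :: "real ^ 'n \<Rightarrow> complex ^ 'n ^ 'n" where
  "real_diag d = (\<chi> i j. if i = j then complex_of_real (d $ i) else 0)"

text \<open>Functional calculus $f(A)$ for a Hermitian matrix $A = U \,\mathrm{diag}(d)\, U^*$;
  it only depends on the values of $f$ on the spectrum of $A$.  It is meaningful only for
  Hermitian $A$; \<open>hermitian_fun_diag\<close> below shows that the choice of the unitary
  diagonalisation is irrelevant.\<close>

definition hermitian_fun :: "(real \<Rightarrow> real) \<Rightarrow> complex ^ 'n ^ 'n \<Rightarrow> complex ^ 'n ^ 'n" where
  "hermitian_fun f A = (THE B. \<exists>U d. unitary_matrix U \<and>
      A = U ** real_diag d ** cadjoint U \<and>
      B = U ** real_diag (\<chi> i. f (d $ i)) ** cadjoint U)"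

lemma real_diag_mult_component:
  "(W ** real_diag d) $ i $ j = W $ i $ j * complex_of_real (d $ j)"
  "(real_diag d ** W) $ i $ j = complex_of_real (d $ i) * W $ i $ j"
  by (simp_all add: real_diag_def matrix_matrix_mult_def if_distrib if_distribR
      cong: if_cong)

lemma hermitian_fun_diag_unique:
  assumes U: "unitary_matrix U" and V: "unitary_matrix V"
    and eq: "U ** real_diag d ** cadjoint U = V ** real_diag e ** cadjoint V"
  shows "U ** real_diag (\<chi> i. f (d $ i)) ** cadjoint U =
         V ** real_diag (\<chi> i. f (e $ i)) ** cadjoint V"
proof -
  define W where "W = cadjoint V ** U"
  have UU: "cadjoint U ** U = mat 1" "U ** cadjoint U = mat 1"
    and VV: "cadjoint V ** V = mat 1" "V ** cadjoint V = mat 1"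
    using U V by (auto simp: unitary_matrix_def)
  have "W ** real_diag d = cadjoint V ** (U ** real_diag d ** cadjoint U) ** U"
    using UU by (simp add: W_def matrix_mul_assoc[symmetric])
  also have "\<dots> = (cadjoint V ** V) ** real_diag e ** W"
    unfolding eq by (simp add: W_def matrix_mul_assoc)
  finally have WD: "W ** real_diag d = real_diag e ** W"
    using VV by simp
  have "W $ i $ j * complex_of_real (f (d $ j)) = complex_of_real (f (e $ i)) * W $ i $ j" for i j
  proof -
    have "W $ i $ j * complex_of_real (d $ j) = complex_of_real (e $ i) * W $ i $ j"
      using WD by (metis real_diag_mult_component)
    then have "W $ i $ j = 0 \<or> d $ j = e $ i" by auto
    then show ?thesis by auto
  qed
  then have Wf: "W ** real_diag (\<chi> i. f (d $ i)) = real_diag (\<chi> i. f (e $ i)) ** W"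
    by (simp add: vec_eq_iff real_diag_mult_component)
  have VW: "V ** W = U"
    using VV by (simp add: W_def matrix_mul_assoc)
  have WU: "W ** cadjoint U = cadjoint V"
    using UU by (simp add: W_def matrix_mul_assoc[symmetric])
  have "U ** real_diag (\<chi> i. f (d $ i)) ** cadjoint U =
        V ** (W ** real_diag (\<chi> i. f (d $ i))) ** cadjoint U"
    by (simp add: VW matrix_mul_assoc)
  also have "\<dots> = V ** real_diag (\<chi> i. f (e $ i)) ** (W ** cadjoint U)"
    unfolding Wf by (simp add: matrix_mul_assoc)
  finally show ?thesis by (simp add: WU)
qed

lemma hermitian_fun_diag:
  assumes "unitary_matrix U"
  shows "hermitian_fun f (U ** real_diag d ** cadjoint U) =
         U ** real_diag (\<chi> i. f (d $ i)) ** cadjoint U"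
  unfolding hermitian_fun_def
proof (rule the_equality)
  show "\<exists>V e. unitary_matrix V \<and>
      U ** real_diag d ** cadjoint U = V ** real_diag e ** cadjoint V \<and>
      U ** real_diag (\<chi> i. f (d $ i)) ** cadjoint U =
      V ** real_diag (\<chi> i. f (e $ i)) ** cadjoint V"
    using assms by blast
qed (use hermitian_fun_diag_unique[OF assms] in metis)

definition matrix_abs :: "complex ^ 'n ^ 'n \<Rightarrow> complex ^ 'n ^ 'n" where
  "matrix_abs X = hermitian_fun sqrt (cadjoint X ** X)"

definition matrices_upto :: "real \<Rightarrow> (complex ^ 'n ^ 'n) set" where
  "matrices_upto b = {X. matrix_spectrum (matrix_abs X) \<subseteq> complex_of_real ` {0..b}}"

definition phi_matrix ::
  "(real \<Rightarrow> real) \<Rightarrow> (real \<Rightarrow> real) \<Rightarrow> complex ^ 'n ^ 'n \<Rightarrow> complex ^ 'n ^ 'n" where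
  "phi_matrix \<phi>1 \<phi>2 X =
     hermitian_fun \<phi>1 (matrix_abs X) - hermitian_fun \<phi>2 (matrix_abs (cadjoint X))"

definition flow_solution ::
  "(real \<Rightarrow> real) \<Rightarrow> (real \<Rightarrow> real) \<Rightarrow> real \<Rightarrow> complex ^ 'n ^ 'n \<Rightarrow>
   (real \<Rightarrow> complex ^ 'n ^ 'n) \<Rightarrow> bool" where
  "flow_solution \<phi>1 \<phi>2 b T X \<longleftrightarrow> X 0 = T \<and>
     (\<forall>t\<ge>0. X t \<in> matrices_upto b \<and>
       (X has_vector_derivative commutator (phi_matrix \<phi>1 \<phi>2 (X t)) (X t)) (at t within {0..}))"

text \<open>Solutions are functions on all of \<open>real\<close> whose values at negative times are irrelevant, so
  uniqueness can only hold for the values \<open>X t\<close> with \<open>t \<ge> 0\<close>; the description is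
  therefore over the value at time \<open>t\<close> and not over \<open>X\<close>.\<close>

definition phi_flow ::
  "(real \<Rightarrow> real) \<Rightarrow> (real \<Rightarrow> real) \<Rightarrow> real \<Rightarrow> real \<Rightarrow> complex ^ 'n ^ 'n \<Rightarrow> complex ^ 'n ^ 'n" where
  "phi_flow \<phi>1 \<phi>2 b t T = (THE Y. \<exists>X. flow_solution \<phi>1 \<phi>2 b T X \<and> Y = X t)"

definition rectangle :: "real \<Rightarrow> real \<Rightarrow> complex set" where
  "rectangle r \<epsilon> = {z. 0 \<le> Re z \<and> Re z \<le> r + \<epsilon> \<and> - \<epsilon> \<le> Im z \<and> Im z \<le> \<epsilon>}"

end

theory Submission
  imports Defs
    "HOL-Computational_Algebra.Polynomial_Factorial"
    "HOL-Computational_Algebra.Field_as_Ring"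
    "HOL-Computational_Algebra.Fundamental_Theorem_Algebra"
begin

text \<open>
Write $P = X^*X$, $Q = XX^*$, $\psi_k(x) = \varphi_k(\sqrt{x})$ and $H = \varphi(X) = \psi_1(P) - \psi_2(Q)$,
so that the flow is $X' = [H, X]$. For every polynomial $p$ also $p(X)' = [H, p(X)]$; in particular
a polynomial $q$ with $q(T) = 0$ annihilates $X(t)$ for all $t$.

The field is Lipschitz in the Hilbert-Schmidt norm, because $X \mapsto |X|$ is
(\<open>matrix_abs_lipschitz\<close>) and a scalar Lipschitz bound passes to the functional calculus
(\<open>intertwining_estimate\<close>). The operator norm of a solution does not increase, since both terms of $H$
take their largest values at the top singular vectors (\<open>top_singular_value_decreases\<close>). Hence solutions
exist for all times, stay in the domain and are unique, and the flow is the solution.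

The derivative of $\|X\|^2$ is $-2 \langle H, P - Q \rangle$, and a Klein type inequality shows that
this dissipation is positive unless $X$ is normal (\<open>dissipation_nonneg\<close>). So all limit points of a trajectory are
normal (\<open>limit_point_normal\<close>).

It remains to exclude a drift along the set of normal matrices. For a nonzero root $\mu$ of $q$ the Riesz projection
$E(t)$ of $X(t)$ for $\mu$ is a fixed polynomial in $X(t)$. Let $F$ be the orthogonal projection onto the range of
$E$ and $W = E - F$. If $W = 0$, then $X$, and with it $H$, commutes with $E$; quantitatively $\|E'\| = O(\|W\|)$
(\<open>commutator_phi_idempotent_le\<close>). On the other hand $\|W\|^2 = \|E\|^2 - \mathrm{tr}\,E$ has the derivative
$2\langle H, EE^* - E^*E\rangle$. The defects of commutation of $P$ and $Q$ with $F$ are exactly linear in $W$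
(\<open>block_triangular\<close>), and they are transferred to $\psi_1(P)$ and $\psi_2(Q)$ by divided differences of
$\psi_k$ at $|\mu|^2$ (\<open>intertwined_linearisation\<close>). Near a normal limit with eigenvalues $\nu$ the derivative
is therefore a quadratic form in $W$ with the coefficients
\[ -2\,\frac{\psi(|\nu|^2) - \psi(|\mu|^2)}{|\nu|^2 - |\mu|^2}\,|\nu - \mu|^2, \qquad \psi = \psi_1 + \psi_2, \]
which are negative for $\nu \neq \mu$: by strict monotonicity if $|\nu| \neq |\mu|$, and by
$\varphi_1' + \varphi_2' > 0$ at $|\mu| > 0$ otherwise (\<open>obliqueness_rate_limit\<close>). By compactness
$\|W\|$ decays exponentially, $\int \|E'\|\,dt$ is finite and $E(t)$ converges
(\<open>riesz_projection_cauchy\<close>). This concerns only the semisimple part of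
$X(t)$; the nilpotent part tends to $0$ because limit points are normal, possibly at a slow rate.

A normal limit point is determined by the limits of these projections: it acts as $\mu$ on the range of the one
for $\mu$ and vanishes on the rest (\<open>limit_point_unique\<close>). So there is only one limit point.
\<close>

no_notation fps_nth (infixl "$" 75)


section \<open>The Hilbert-Schmidt inner product\<close>

lemma cadjoint_nth [simp]: "cadjoint A $ i $ j = cnj (A $ j $ i)"
  by (simp add: cadjoint_def)

lemma cadjoint_cadjoint [simp]: "cadjoint (cadjoint A) = A"
  by (simp add: vec_eq_iff)

lemma cadjoint_mult: "cadjoint (A ** B) = cadjoint B ** cadjoint A"
  by (simp add: vec_eq_iff matrix_matrix_mult_def mult.commute)

lemma cadjoint_add: "cadjoint (A + B) = cadjoint A + cadjoint B"
  and cadjoint_diff: "cadjoint (A - B) = cadjoint A - cadjoint B"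
  and cadjoint_minus: "cadjoint (- A) = - cadjoint A"
  and cadjoint_scaleR: "cadjoint (r *\<^sub>R A) = r *\<^sub>R cadjoint A"
  and cadjoint_zero [simp]: "cadjoint 0 = 0"
  and cadjoint_mat: "cadjoint (mat c) = mat (cnj c)"
  by (auto simp: vec_eq_iff mat_def)

lemma cadjoint_one [simp]: "cadjoint (mat 1) = mat 1"
  by (simp add: cadjoint_mat)

lemma cadjoint_real_diag [simp]: "cadjoint (real_diag d) = real_diag d"
  by (auto simp: vec_eq_iff real_diag_def)

lemma inner_matrix: "inner A B = (\<Sum>i\<in>UNIV. \<Sum>j\<in>UNIV. Re (cnj (A $ i $ j) * B $ i $ j))"
  for A B :: "complex ^ 'n ^ 'm"
  by (simp add: inner_vec_def inner_complex_def)

lemma norm_matrix_sq: "(norm A)\<^sup>2 = (\<Sum>i\<in>UNIV. \<Sum>j\<in>UNIV. (cmod (A $ i $ j))\<^sup>2)"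
  for A :: "complex ^ 'n ^ 'm"
  by (simp add: power2_norm_eq_inner inner_vec_def)

lemma inner_cadjoint [simp]: "inner (cadjoint A) (cadjoint B) = inner A B"
  for A B :: "complex ^ 'n ^ 'm"
proof -
  have "Re (cnj (cadjoint A $ i $ j) * cadjoint B $ i $ j) = Re (cnj (A $ j $ i) * B $ j $ i)" for i j
    by simp
  then show ?thesis unfolding inner_matrix by (simp only:) (rule sum.swap)
qed

lemma norm_cadjoint [simp]: "norm (cadjoint A) = norm A"
  for A :: "complex ^ 'n ^ 'm"
  by (simp add: norm_eq_sqrt_inner)

text \<open>Left and right multiplications have the multiplications by the adjoint as their adjoints.
  These two rules replace every use of the cyclicity of the trace.\<close>

lemma inner_mult_left: "inner (A ** B) C = inner B (cadjoint A ** C)"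
  for A B C :: "complex ^ 'n ^ 'n"
proof -
  have l: "cnj ((A ** B) $ i $ j) * C $ i $ j = (\<Sum>k\<in>UNIV. cnj (B $ k $ j) * (cnj (A $ i $ k) * C $ i $ j))" for i j
    by (simp add: matrix_matrix_mult_def sum_distrib_right mult_ac)
      (simp add: sum_distrib_left)
  have r: "cnj (B $ k $ j) * (cadjoint A ** C) $ k $ j = (\<Sum>i\<in>UNIV. cnj (B $ k $ j) * (cnj (A $ i $ k) * C $ i $ j))" for k j
    by (simp add: matrix_matrix_mult_def sum_distrib_left)
  have swap: "(\<Sum>i\<in>UNIV. \<Sum>j\<in>UNIV. \<Sum>k\<in>UNIV. f i j k) = (\<Sum>k\<in>UNIV. \<Sum>j\<in>UNIV. \<Sum>i\<in>UNIV. f i j k)"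
    for f :: "'n \<Rightarrow> 'n \<Rightarrow> 'n \<Rightarrow> complex"
  proof -
    have "(\<Sum>i\<in>UNIV. \<Sum>j\<in>UNIV. \<Sum>k\<in>UNIV. f i j k) = (\<Sum>j\<in>UNIV. \<Sum>i\<in>UNIV. \<Sum>k\<in>UNIV. f i j k)"
      by (rule sum.swap)
    also have "\<dots> = (\<Sum>j\<in>UNIV. \<Sum>k\<in>UNIV. \<Sum>i\<in>UNIV. f i j k)"
      by (rule sum.cong[OF refl]) (rule sum.swap)
    also have "\<dots> = (\<Sum>k\<in>UNIV. \<Sum>j\<in>UNIV. \<Sum>i\<in>UNIV. f i j k)"
      by (rule sum.swap)
    finally show ?thesis .
  qed
  have "Re (\<Sum>i\<in>UNIV. \<Sum>j\<in>UNIV. cnj ((A ** B) $ i $ j) * C $ i $ j) =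
      Re (\<Sum>k\<in>UNIV. \<Sum>j\<in>UNIV. cnj (B $ k $ j) * (cadjoint A ** C) $ k $ j)"
    unfolding l r swap[of "\<lambda>i j k. cnj (B $ k $ j) * (cnj (A $ i $ k) * C $ i $ j)"] ..
  then show ?thesis unfolding inner_matrix Re_sum .
qed

lemma inner_mult_right: "inner (A ** B) C = inner A (C ** cadjoint B)"
  for A B C :: "complex ^ 'n ^ 'n"
proof -
  have "inner (A ** B) C = inner (cadjoint B ** cadjoint A) (cadjoint C)"
    unfolding cadjoint_mult[symmetric] by simp
  also have "\<dots> = inner (cadjoint A) (cadjoint (C ** cadjoint B))"
    unfolding inner_mult_left by (simp add: cadjoint_mult)
  finally show ?thesis by simp
qed

lemma norm_matrix_mult: "norm (A ** B) \<le> norm A * norm B"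
  for A B :: "complex ^ 'n ^ 'n"
proof -
  have entry: "(cmod ((A ** B) $ i $ j))\<^sup>2 \<le>
      (\<Sum>k\<in>UNIV. (cmod (A $ i $ k))\<^sup>2) * (\<Sum>k\<in>UNIV. (cmod (B $ k $ j))\<^sup>2)" for i j
  proof -
    have "cmod ((A ** B) $ i $ j) \<le> (\<Sum>k\<in>UNIV. cmod (A $ i $ k) * cmod (B $ k $ j))"
      unfolding matrix_matrix_mult_def by (simp, rule order_trans[OF norm_sum]) (simp add: norm_mult)
    then have "(cmod ((A ** B) $ i $ j))\<^sup>2 \<le> (\<Sum>k\<in>UNIV. cmod (A $ i $ k) * cmod (B $ k $ j))\<^sup>2"
      by (simp add: power_mono)
    also have "\<dots> \<le> (\<Sum>k\<in>UNIV. (cmod (A $ i $ k))\<^sup>2) * (\<Sum>k\<in>UNIV. (cmod (B $ k $ j))\<^sup>2)"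
      by (rule Cauchy_Schwarz_ineq_sum)
    finally show ?thesis .
  qed
  have "(norm (A ** B))\<^sup>2 \<le> (\<Sum>i\<in>UNIV. \<Sum>j\<in>UNIV.
      (\<Sum>k\<in>UNIV. (cmod (A $ i $ k))\<^sup>2) * (\<Sum>k\<in>UNIV. (cmod (B $ k $ j))\<^sup>2))"
    unfolding norm_matrix_sq by (intro sum_mono entry)
  also have "\<dots> = (\<Sum>i\<in>UNIV. \<Sum>k\<in>UNIV. (cmod (A $ i $ k))\<^sup>2) * (\<Sum>j\<in>UNIV. \<Sum>k\<in>UNIV. (cmod (B $ k $ j))\<^sup>2)"
    by (simp add: sum_product)
  also have "(\<Sum>j\<in>UNIV. \<Sum>k\<in>UNIV. (cmod (B $ k $ j))\<^sup>2) = (norm B)\<^sup>2"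
    unfolding norm_matrix_sq by (rule sum.swap)
  finally have "(norm (A ** B))\<^sup>2 \<le> (norm A * norm B)\<^sup>2"
    by (simp add: norm_matrix_sq power_mult_distrib)
  then show ?thesis by (rule power2_le_imp_le) simp
qed

lemma bounded_bilinear_matrix_mult:
  "bounded_bilinear ((**) :: complex ^ 'n ^ 'n \<Rightarrow> complex ^ 'n ^ 'n \<Rightarrow> complex ^ 'n ^ 'n)"
proof (unfold_locales, goal_cases)
  case (1 a a' b) then show ?case
    by (simp add: vec_eq_iff matrix_matrix_mult_def sum.distrib algebra_simps)
next
  case (2 a b b') then show ?case by (rule matrix_add_ldistrib)
next
  case (3 r a b) then show ?case
    by (simp add: vec_eq_iff matrix_matrix_mult_def scaleR_sum_right)
next
  case (4 a r b) then show ?case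
    by (simp add: vec_eq_iff matrix_matrix_mult_def scaleR_sum_right)
next
  case 5 then show ?case by (intro exI[of _ 1]) (simp add: norm_matrix_mult)
qed

interpretation mmult: bounded_bilinear
  "(**) :: complex ^ 'n ^ 'n \<Rightarrow> complex ^ 'n ^ 'n \<Rightarrow> complex ^ 'n ^ 'n"
  by (rule bounded_bilinear_matrix_mult)

lemma bounded_linear_cadjoint: "bounded_linear (cadjoint :: complex ^ 'n ^ 'n \<Rightarrow> complex ^ 'n ^ 'n)"
  by (rule bounded_linear_intro[where K = 1]) (simp_all add: cadjoint_add cadjoint_scaleR)

lemma continuous_on_cadjoint [continuous_intros]:
  fixes f :: "'a::topological_space \<Rightarrow> complex ^ 'n ^ 'n"
  shows "continuous_on S f \<Longrightarrow> continuous_on S (\<lambda>x. cadjoint (f x))"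
  by (rule bounded_linear.continuous_on[OF bounded_linear_cadjoint])

lemma continuous_on_matrix_mult [continuous_intros]:
  fixes f g :: "'a::topological_space \<Rightarrow> complex ^ 'n ^ 'n"
  shows "continuous_on S f \<Longrightarrow> continuous_on S g \<Longrightarrow> continuous_on S (\<lambda>x. f x ** g x)"
  by (rule mmult.continuous_on)

lemma tendsto_cadjoint [tendsto_intros]:
  fixes f :: "'a \<Rightarrow> complex ^ 'n ^ 'n"
  shows "(f \<longlongrightarrow> A) F \<Longrightarrow> ((\<lambda>x. cadjoint (f x)) \<longlongrightarrow> cadjoint A) F"
  by (rule bounded_linear.tendsto[OF bounded_linear_cadjoint])

lemma tendsto_matrix_mult [tendsto_intros]:
  fixes f g :: "'a \<Rightarrow> complex ^ 'n ^ 'n"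
  shows "(f \<longlongrightarrow> A) F \<Longrightarrow> (g \<longlongrightarrow> B) F \<Longrightarrow> ((\<lambda>x. f x ** g x) \<longlongrightarrow> A ** B) F"
  by (rule mmult.tendsto)

lemmas mm_distribs = mmult.add_left mmult.add_right mmult.diff_left mmult.diff_right
  mmult.minus_left mmult.minus_right mmult.zero_left mmult.zero_right
  mmult.scaleR_left mmult.scaleR_right matrix_mul_assoc matrix_mul_lid matrix_mul_rid

lemma mat_add: "mat (a + b) = mat a + (mat b :: complex ^ 'n ^ 'n)"
  and mat_diff: "mat (a - b) = mat a - (mat b :: complex ^ 'n ^ 'n)"
  and mat_zero [simp]: "mat 0 = (0 :: complex ^ 'n ^ 'n)"
  by (auto simp: vec_eq_iff mat_def)

lemma mat_mult_component:
  "(mat c ** A) $ i $ j = c * A $ i $ j" "(A ** mat c) $ i $ j = c * A $ i $ j"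
  for A :: "complex ^ 'n ^ 'n"
  by (simp_all add: matrix_matrix_mult_def mat_def if_distrib if_distribR cong: if_cong)

lemma mat_commute: "A ** mat c = mat c ** A"
  for A :: "complex ^ 'n ^ 'n"
  by (simp add: vec_eq_iff mat_mult_component)

lemma mat_mult_mat: "mat a ** mat b = (mat (a * b) :: complex ^ 'n ^ 'n)"
  by (auto simp: vec_eq_iff mat_mult_component) (auto simp: mat_def)

lemma mat_of_real: "mat (complex_of_real r) ** A = r *\<^sub>R A"
  for A :: "complex ^ 'n ^ 'n"
  by (simp add: vec_eq_iff mat_mult_component) (simp add: scaleR_conv_of_real)

lemma inner_hermitian_mult_self:
  fixes A B :: "complex ^ 'n ^ 'n"
  assumes "cadjoint H = H"
  shows "inner (H ** A) B = inner A (H ** B)"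
  using inner_mult_left[of H A B] assms by simp

section \<open>Singular value decomposition\<close>

lemma unitaryD: "unitary_matrix U \<Longrightarrow> cadjoint U ** U = mat 1"
  "unitary_matrix U \<Longrightarrow> U ** cadjoint U = mat 1"
  by (simp_all add: unitary_matrix_def)

lemma unitary_cadjoint: "unitary_matrix U \<Longrightarrow> unitary_matrix (cadjoint U)"
  by (simp add: unitary_matrix_def)

lemma unitary_mult: "unitary_matrix U \<Longrightarrow> unitary_matrix V \<Longrightarrow> unitary_matrix (U ** V)"
  by (simp add: unitary_matrix_def cadjoint_mult)
    (metis matrix_mul_assoc matrix_mul_rid)

lemma unitary_cancel:
  fixes A :: "complex ^ 'n ^ 'n"
  assumes "unitary_matrix U"
  shows "cadjoint U ** (U ** A) = A" "U ** (cadjoint U ** A) = A"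
    "A ** cadjoint U ** U = A" "A ** U ** cadjoint U = A"
  using assms by (simp_all add: matrix_mul_assoc unitaryD)
    (simp_all add: matrix_mul_assoc[symmetric] unitaryD)

lemma norm_unitary_mult:
  fixes A :: "complex ^ 'n ^ 'n"
  assumes "unitary_matrix U"
  shows "norm (U ** A) = norm A" "norm (A ** U) = norm A"
proof -
  have left: "norm (V ** A) = norm A" if "unitary_matrix V" for V and A :: "complex ^ 'n ^ 'n"
    using that by (simp add: norm_eq_sqrt_inner inner_mult_left unitary_cancel)
  from left[OF assms] show "norm (U ** A) = norm A" .
  have "norm (A ** U) = norm (cadjoint U ** cadjoint A)"
    by (metis cadjoint_mult norm_cadjoint)
  then show "norm (A ** U) = norm A"
    using left[OF unitary_cadjoint[OF assms]] by simp
qed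

lemma compact_unitary: "compact {U :: complex ^ 'n ^ 'n. unitary_matrix U}"
proof -
  have "bounded {U :: complex ^ 'n ^ 'n. unitary_matrix U}"
    unfolding bounded_iff
  proof (intro exI ballI)
    fix U :: "complex ^ 'n ^ 'n" assume "U \<in> {U. unitary_matrix U}"
    then show "norm U \<le> norm (mat 1 :: complex ^ 'n ^ 'n)"
      using norm_unitary_mult(1)[of U "mat 1"] by simp
  qed
  moreover have "closed {U :: complex ^ 'n ^ 'n. unitary_matrix U}"
    unfolding unitary_matrix_def
  proof (rule closed_Collect_conj)
    have adj: "continuous_on UNIV (cadjoint :: complex ^ 'n ^ 'n \<Rightarrow> _)"
      by (rule linear_continuous_on[OF bounded_linear_cadjoint])
    show "closed {U :: complex ^ 'n ^ 'n. cadjoint U ** U = mat 1}"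
      "closed {U :: complex ^ 'n ^ 'n. U ** cadjoint U = mat 1}"
      by (rule closed_Collect_eq[OF mmult.continuous_on continuous_on_const];
          rule adj continuous_on_id)+
  qed
  ultimately show ?thesis by (simp add: compact_eq_bounded_closed)
qed

text \<open>The test unitaries are the rotations $1 - (1 - e^{i\theta})\Pi$ for a projection $\Pi$.
  Their first-order condition at $\theta = 0$ says that $B$ has real quadratic form, and
  $\theta = \pi$ gives the sign.\<close>

lemma hermitian_if_unitary_max:
  fixes B :: "complex ^ 'n ^ 'n"
  assumes max: "\<And>R. unitary_matrix R \<Longrightarrow> inner R B \<le> inner (mat 1) B"
  shows "B $ i $ j = cnj (B $ j $ i)" and "Re (B $ i $ i) \<ge> 0"
proof -
  have rot: "inner (mat \<i> ** J) B = 0 \<and> inner J B \<ge> 0"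
    if J: "J ** J = J" "cadjoint J = J" for J :: "complex ^ 'n ^ 'n"
  proof -
    define R where "R \<theta> = mat 1 - mat (1 - cis \<theta>) ** J" for \<theta>
    have uni: "unitary_matrix (R \<theta>)" for \<theta>
    proof -
      let ?z = "1 - cis \<theta>"
      have "sin \<theta> * sin \<theta> = 1 - cos \<theta> * cos \<theta>"
        using sin_cos_squared_add[of \<theta>] by (simp add: power2_eq_square)
      then have z: "cnj ?z * ?z = ?z + cnj ?z"
        by (simp add: complex_eq_iff algebra_simps)
      have PP: "(mat a ** J) ** (mat b ** J) = mat (a * b) ** J" for a b
        by (metis (no_types, lifting) J(1) mat_commute mat_mult_mat matrix_mul_assoc)
      have adj: "cadjoint (mat a ** J) = mat (cnj a) ** J" for a
        by (simp add: cadjoint_mult J(2) cadjoint_mat mat_commute)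
      have "cadjoint (R \<theta>) ** R \<theta> = mat 1 - mat ?z ** J - mat (cnj ?z) ** J + mat (cnj ?z * ?z) ** J"
        unfolding R_def cadjoint_diff adj cadjoint_one mmult.diff_left mmult.diff_right PP
        by simp
      moreover have "R \<theta> ** cadjoint (R \<theta>) = mat 1 - mat ?z ** J - mat (cnj ?z) ** J + mat (cnj ?z * ?z) ** J"
        unfolding R_def cadjoint_diff adj cadjoint_one mmult.diff_left mmult.diff_right PP
        by (simp add: mult.commute)
      ultimately show ?thesis unfolding unitary_matrix_def z mat_add mmult.add_left by simp
    qed
    have decomp: "R \<theta> = mat 1 - (1 - cos \<theta>) *\<^sub>R J + sin \<theta> *\<^sub>R (mat \<i> ** J)" for \<theta>
      unfolding R_def
      by (simp add: vec_eq_iff mat_mult_component cis.code complex_eq_iff algebra_simps)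
    have val: "inner (R \<theta>) B = inner (mat 1) B - (1 - cos \<theta>) * inner J B + sin \<theta> * inner (mat \<i> ** J) B" for \<theta>
      unfolding decomp by (simp add: inner_diff_left inner_add_left)
    define h where "h \<theta> = - (1 - cos \<theta>) * inner J B + sin \<theta> * inner (mat \<i> ** J) B" for \<theta>
    have h: "h \<theta> \<le> 0" for \<theta>
      using max[OF uni[of \<theta>]] unfolding val h_def by (simp add: algebra_simps)
    have "(h has_real_derivative inner (mat \<i> ** J) B) (at 0)"
      unfolding h_def by (auto intro!: derivative_eq_intros)
    then have "inner (mat \<i> ** J) B = 0"
      by (rule DERIV_local_max[where d = 1]) (use h in \<open>auto simp: h_def\<close>)
    moreover have "inner J B \<ge> 0" using h[of pi] by (simp add: h_def)
    ultimately show ?thesis by simp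
  qed
  define K where "K v = (\<chi> k l. v k * cnj (v l))" for v :: "'n \<Rightarrow> complex"
  define q where "q v = (\<Sum>k\<in>UNIV. cnj (v k) * (\<Sum>l\<in>UNIV. B $ k $ l * v l))" for v :: "'n \<Rightarrow> complex"
  have q_real: "Im (q v) = 0 \<and> Re (q v) \<ge> 0" if "(\<Sum>k\<in>UNIV. cnj (v k) * v k) = 1" for v
  proof -
    have "K v ** K v = K v"
    proof -
      have "(\<Sum>k\<in>UNIV. v i * cnj (v k) * (v k * cnj (v j))) = v i * (\<Sum>k\<in>UNIV. cnj (v k) * v k) * cnj (v j)" for i j
        by (simp add: sum_distrib_left sum_distrib_right mult_ac)
      then show ?thesis by (simp add: vec_eq_iff K_def matrix_matrix_mult_def that)
    qed
    moreover have "cadjoint (K v) = K v" by (simp add: vec_eq_iff K_def)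
    ultimately have "inner (mat \<i> ** K v) B = 0 \<and> inner (K v) B \<ge> 0" by (rule rot)
    moreover have "inner (K v) B = Re (q v)"
      unfolding inner_matrix q_def Re_sum[symmetric]
      by (simp add: K_def sum_distrib_left mult_ac del: Re_sum)
    moreover have "inner (mat \<i> ** K v) B = Re (- \<i> * q v)"
      unfolding inner_matrix q_def Re_sum[symmetric] mat_mult_component
      by (simp add: K_def sum_distrib_left mult_ac sum_negf del: Re_sum)
    ultimately show ?thesis by simp
  qed
  define e where "e i k = (if k = i then 1 else 0 :: complex)" for i k :: 'n
  have e_sum: "(\<Sum>k\<in>UNIV. a k * e i k) = a i" "(\<Sum>k\<in>UNIV. cnj (e i k) * a k) = a i" for a i
    by (simp_all add: e_def if_distrib if_distribR cong: if_cong)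
  have diag: "Im (B $ i $ i) = 0 \<and> Re (B $ i $ i) \<ge> 0" for i
    using q_real[of "e i"] by (simp add: q_def e_sum) (simp add: e_def)
  then show "Re (B $ i $ i) \<ge> 0" by blast
  have off: "Im (B $ i $ j * \<omega> + cnj \<omega> * B $ j $ i) = 0" if "i \<noteq> j" "cnj \<omega> * \<omega> = 1" for \<omega>
  proof -
    define c where "c = complex_of_real (sqrt (1/2))"
    have c: "cnj c * c = 1/2" unfolding c_def complex_cnj_complex_of_real of_real_mult[symmetric] by simp
    define v where "v k = c * (e i k + \<omega> * e j k)" for k
    have "(\<Sum>k\<in>UNIV. cnj (v k) * v k) = cnj c * c * (\<Sum>k\<in>UNIV. cnj (e i k) * (e i k + \<omega> * e j k) + cnj \<omega> * (cnj (e j k) * (e i k + \<omega> * e j k)))"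
      by (simp add: v_def sum_distrib_left algebra_simps)
    also have "\<dots> = cnj c * c * (1 + cnj \<omega> * \<omega>)"
      unfolding sum.distrib sum_distrib_left[symmetric] e_sum using that(1) by (simp add: e_def)
    finally have unit: "(\<Sum>k\<in>UNIV. cnj (v k) * v k) = 1" using c that(2) by simp
    have row: "(\<Sum>l\<in>UNIV. B $ k $ l * v l) = c * (B $ k $ i + B $ k $ j * \<omega>)" for k
    proof -
      have "(\<Sum>l\<in>UNIV. B $ k $ l * v l) = (\<Sum>l\<in>UNIV. (c * B $ k $ l) * e i l + (c * B $ k $ l * \<omega>) * e j l)"
        by (simp add: v_def algebra_simps)
      then show ?thesis unfolding sum.distrib e_sum by (simp add: algebra_simps)
    qed
    have "q v = (\<Sum>k\<in>UNIV. cnj (e i k) * (cnj c * c * (B $ k $ i + B $ k $ j * \<omega>)) +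
        cnj (e j k) * (cnj \<omega> * (cnj c * c * (B $ k $ i + B $ k $ j * \<omega>))))"
      unfolding q_def row by (simp add: v_def algebra_simps)
    also have "\<dots> = (B $ i $ i + B $ i $ j * \<omega> + cnj \<omega> * B $ j $ i + (cnj \<omega> * \<omega>) * B $ j $ j) / 2"
      unfolding sum.distrib e_sum c by (simp add: field_simps)
    finally have "2 * q v = B $ i $ i + B $ i $ j * \<omega> + cnj \<omega> * B $ j $ i + B $ j $ j"
      unfolding that(2) by (simp add: mult.commute)
    then have "Im (2 * q v) = Im (B $ i $ i + B $ i $ j * \<omega> + cnj \<omega> * B $ j $ i + B $ j $ j)"
      by (rule arg_cong)
    then show ?thesis using q_real[OF unit] diag by simp
  qed
  show "B $ i $ j = cnj (B $ j $ i)"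
  proof (cases "i = j")
    case True
    then show ?thesis using diag[of j] by (simp add: complex_eq_iff)
  next
    case False
    show ?thesis using off[OF False, of 1] off[OF False, of \<i>] by (simp add: complex_eq_iff)
  qed
qed

text \<open>A pair of unitaries that maximises $\mathrm{Re}\,\mathrm{tr}(D E^* X U)$ for a diagonal $D$ with
  distinct positive entries diagonalises $X$: with $M = E^* X U$ both $M^*D$ and $MD$ are Hermitian,
  which forces the off-diagonal entries of $M$ to vanish.\<close>

theorem singular_value_decomposition:
  fixes X :: "complex ^ 'n ^ 'n"
  obtains E U d where "unitary_matrix E" "unitary_matrix U" "\<And>i. 0 \<le> d $ i"
    "X = E ** real_diag d ** cadjoint U"
proof -
  obtain f :: "'n \<Rightarrow> nat" where f: "inj f"
    using finite_imp_inj_to_nat_seg[of "UNIV :: 'n set"] by auto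
  define \<kappa> :: "real ^ 'n" where "\<kappa> = (\<chi> i. 1 + real (f i))"
  have pos: "\<kappa> $ i > 0" for i by (simp add: \<kappa>_def add_pos_nonneg)
  have dist: "\<kappa> $ i \<noteq> \<kappa> $ j" if "i \<noteq> j" for i j
    using f that by (simp add: \<kappa>_def inj_eq)
  let ?Un = "{U :: complex ^ 'n ^ 'n. unitary_matrix U}"
  let ?D = "real_diag \<kappa> :: complex ^ 'n ^ 'n"
  have cont: "continuous_on (?Un \<times> ?Un) (\<lambda>p. inner ?D (cadjoint (fst p) ** X ** snd p))"
    by (intro continuous_intros)
  have one: "mat 1 \<in> ?Un" by (simp add: unitary_matrix_def)
  have "\<exists>p\<in>?Un \<times> ?Un. \<forall>q\<in>?Un \<times> ?Un. inner ?D (cadjoint (fst q) ** X ** snd q)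
      \<le> inner ?D (cadjoint (fst p) ** X ** snd p)"
    by (rule continuous_attains_sup[OF compact_Times[OF compact_unitary compact_unitary] _ cont])
      (use one in blast)
  then obtain E U where E: "unitary_matrix E" and U: "unitary_matrix U"
    and max: "\<And>E' U'. unitary_matrix E' \<Longrightarrow> unitary_matrix U' \<Longrightarrow>
      inner ?D (cadjoint E' ** X ** U') \<le> inner ?D (cadjoint E ** X ** U)"
    by auto
  define M where "M = cadjoint E ** X ** U"
  have 1: "inner R (cadjoint M ** ?D) \<le> inner (mat 1) (cadjoint M ** ?D)" if "unitary_matrix R" for R
  proof -
    have "inner ?D (M ** R) \<le> inner ?D M"
      using max[OF E unitary_mult[OF U that]] by (simp add: M_def matrix_mul_assoc)
    then have "inner (M ** R) ?D \<le> inner (M ** mat 1) ?D" by (simp add: inner_commute)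
    then show ?thesis unfolding inner_mult_left .
  qed
  have 2: "inner R (M ** ?D) \<le> inner (mat 1) (M ** ?D)" if "unitary_matrix R" for R
  proof -
    have "inner ?D (cadjoint R ** M) \<le> inner ?D M"
      using max[OF unitary_mult[OF E that] U] by (simp add: M_def matrix_mul_assoc cadjoint_mult)
    then have "inner (cadjoint R ** M) ?D \<le> inner (cadjoint (mat 1) ** M) ?D" by (simp add: inner_commute)
    then have "inner (cadjoint R) (?D ** cadjoint M) \<le> inner (cadjoint (mat 1)) (?D ** cadjoint M)"
      unfolding inner_mult_right .
    then show ?thesis
      using inner_cadjoint[of R "M ** ?D"] inner_cadjoint[of "mat 1" "M ** ?D"] by (simp add: cadjoint_mult)
  qed
  have h1: "cnj (M $ j $ i) * \<kappa> $ j = M $ i $ j * \<kappa> $ i" for i j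
    using hermitian_if_unitary_max(1)[OF 1, of i j] by (simp add: real_diag_mult_component)
  have h2: "M $ i $ j * \<kappa> $ j = cnj (M $ j $ i) * \<kappa> $ i" for i j
    using hermitian_if_unitary_max(1)[OF 2, of i j] by (simp add: real_diag_mult_component)
  have off: "M $ i $ j = 0" if "i \<noteq> j" for i j
  proof -
    have "M $ i $ j * (\<kappa> $ i * \<kappa> $ i) = (cnj (M $ j $ i) * \<kappa> $ j) * \<kappa> $ i"
      unfolding h1[of j i] by (simp add: mult_ac)
    also have "\<dots> = M $ i $ j * (\<kappa> $ j * \<kappa> $ j)"
      using arg_cong[OF h2[of i j], of "\<lambda>z. z * complex_of_real (\<kappa> $ j)", symmetric] by (simp only: mult_ac of_real_mult)
    finally have "M $ i $ j * (complex_of_real (\<kappa> $ i * \<kappa> $ i - \<kappa> $ j * \<kappa> $ j)) = 0"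
      by (simp add: algebra_simps)
    moreover have "\<kappa> $ i * \<kappa> $ i \<noteq> \<kappa> $ j * \<kappa> $ j"
      using dist[OF that] pos[of i] pos[of j] by (simp add: square_eq_iff order_less_imp_not_eq2)
    ultimately show ?thesis by (simp del: of_real_diff of_real_mult)
  qed
  have on: "Re (M $ i $ i) \<ge> 0 \<and> Im (M $ i $ i) = 0" for i
    using hermitian_if_unitary_max(2)[OF 2, of i] h1[of i i] pos[of i]
    by (simp add: real_diag_mult_component complex_eq_iff zero_le_mult_iff)
  define d where "d = (\<chi> i. Re (M $ i $ i))"
  have "M = real_diag d"
    using off on by (auto simp: vec_eq_iff real_diag_def d_def complex_eq_iff)
  then have "E ** real_diag d ** cadjoint U = E ** (cadjoint E ** X ** U) ** cadjoint U"
    by (simp add: M_def)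
  also have "\<dots> = X"
    by (simp add: matrix_mul_assoc unitaryD E) (simp add: matrix_mul_assoc[symmetric] unitaryD U)
  finally show thesis using that[OF E U, of d] on by (simp add: d_def)
qed

section \<open>Functional calculus of positive semidefinite matrices\<close>

definition udiag :: "complex ^ 'n ^ 'n \<Rightarrow> real ^ 'n \<Rightarrow> complex ^ 'n ^ 'n" where
  "udiag U d = U ** real_diag d ** cadjoint U"

text \<open>A hermitian matrix is handled through a unitary diagonalisation $UdU^*$. Existence of the
  diagonalisation and the location of the spectrum are put into one predicate, because the functional calculus
  needs both; Gram matrices satisfy it by the singular value decomposition.\<close>

definition spec_in :: "real set \<Rightarrow> complex ^ 'n ^ 'n \<Rightarrow> bool" where
  "spec_in S A \<longleftrightarrow> (\<exists>U d. unitary_matrix U \<and> A = udiag U d \<and> (\<forall>i. d $ i \<in> S))"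

lemma spec_inE:
  assumes "spec_in S A"
  obtains U d where "unitary_matrix U" "A = udiag U d" "\<And>i. d $ i \<in> S"
  using assms unfolding spec_in_def by blast

lemma hermitian_fun_udiag:
  "unitary_matrix U \<Longrightarrow> hermitian_fun f (udiag U d) = udiag U (\<chi> i. f (d $ i))"
  unfolding udiag_def by (rule hermitian_fun_diag)

lemma cadjoint_udiag [simp]: "cadjoint (udiag U d) = udiag U d"
  by (simp add: udiag_def cadjoint_mult matrix_mul_assoc)

lemma real_diag_simps:
  "real_diag d ** real_diag e = real_diag (\<chi> i. d $ i * e $ i)"
  "real_diag d + real_diag e = real_diag (\<chi> i. d $ i + e $ i)"
  "real_diag d - real_diag e = real_diag (\<chi> i. d $ i - e $ i)"
  "r *\<^sub>R real_diag d = real_diag (\<chi> i. r * d $ i)"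
  by (auto simp: vec_eq_iff real_diag_mult_component) (auto simp: real_diag_def scaleR_conv_of_real)

lemma real_diag_const: "real_diag (\<chi> i. c) = mat (complex_of_real c)"
  by (simp add: vec_eq_iff real_diag_def mat_def)

lemma udiag_simps:
  "unitary_matrix U \<Longrightarrow> udiag U d ** udiag U e = udiag U (\<chi> i. d $ i * e $ i)"
  "udiag U d + udiag U e = udiag U (\<chi> i. d $ i + e $ i)"
  "udiag U d - udiag U e = udiag U (\<chi> i. d $ i - e $ i)"
  "r *\<^sub>R udiag U d = udiag U (\<chi> i. r * d $ i)"
  unfolding udiag_def real_diag_simps[symmetric]
  by (simp_all add: mm_distribs unitary_cancel)

lemma udiag_const: "unitary_matrix U \<Longrightarrow> udiag U (\<chi> i. c) = mat (complex_of_real c)"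
  unfolding udiag_def real_diag_const mat_commute
  by (simp add: matrix_mul_assoc[symmetric] unitaryD)

lemma spec_in_mat: "c \<in> S \<Longrightarrow> spec_in S (mat (complex_of_real c))"
  unfolding spec_in_def
  by (rule exI[of _ "mat 1"], rule exI[of _ "\<chi> i. c"]) (simp add: udiag_const unitary_matrix_def)

lemma hermitian_fun_mat: "hermitian_fun f (mat (complex_of_real c)) = mat (complex_of_real (f c))"
proof -
  have u: "unitary_matrix (mat 1)" by (simp add: unitary_matrix_def)
  show ?thesis
    unfolding udiag_const[OF u, symmetric] hermitian_fun_udiag[OF u] by simp
qed

lemma cadjoint_hermitian_fun [simp]: "spec_in S A \<Longrightarrow> cadjoint (hermitian_fun f A) = hermitian_fun f A"
  by (auto elim!: spec_inE simp: hermitian_fun_udiag)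

lemma hermitian_fun_cong:
  assumes "spec_in S A" "\<And>x. x \<in> S \<Longrightarrow> f x = g x"
  shows "hermitian_fun f A = hermitian_fun g A"
  using assms by (auto elim!: spec_inE simp: hermitian_fun_udiag)

lemma hermitian_fun_comp:
  assumes "spec_in S A"
  shows "hermitian_fun f (hermitian_fun g A) = hermitian_fun (\<lambda>x. f (g x)) A"
  using assms by (auto elim!: spec_inE simp: hermitian_fun_udiag)

lemma hermitian_fun_mult:
  assumes "spec_in S A"
  shows "hermitian_fun f A ** hermitian_fun g A = hermitian_fun (\<lambda>x. f x * g x) A"
  using assms by (auto elim!: spec_inE simp: hermitian_fun_udiag udiag_simps)

lemma hermitian_fun_add:
  assumes "spec_in S A"
  shows "hermitian_fun (\<lambda>x. f x + g x) A = hermitian_fun f A + hermitian_fun g A"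
  using assms by (auto elim!: spec_inE simp: hermitian_fun_udiag udiag_simps)

lemma hermitian_fun_diff:
  assumes "spec_in S A"
  shows "hermitian_fun (\<lambda>x. f x - g x) A = hermitian_fun f A - hermitian_fun g A"
  using assms by (auto elim!: spec_inE simp: hermitian_fun_udiag udiag_simps)

lemma hermitian_fun_const:
  assumes "spec_in S A"
  shows "hermitian_fun (\<lambda>x. c) A = mat (complex_of_real c)"
  using assms by (auto elim!: spec_inE simp: hermitian_fun_udiag udiag_const)

lemma hermitian_fun_id:
  assumes "spec_in S A"
  shows "hermitian_fun (\<lambda>x. x) A = A"
  using assms by (auto elim!: spec_inE simp: hermitian_fun_udiag)

lemma inner_real_diag_mult:
  fixes A :: "complex ^ 'n ^ 'n"
  shows "inner (real_diag d ** A) A = (\<Sum>i\<in>UNIV. \<Sum>j\<in>UNIV. d $ i * (cmod (A $ i $ j))\<^sup>2)"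
proof -
  have "Re (cnj ((real_diag d ** A) $ i $ j) * A $ i $ j) = d $ i * (cmod (A $ i $ j))\<^sup>2" for i j
    unfolding real_diag_mult_component cmod_power2 by (simp add: power2_eq_square algebra_simps)
  then show ?thesis unfolding inner_matrix by (simp only:)
qed

lemma inner_udiag_mult:
  fixes A U :: "complex ^ 'n ^ 'n"
  assumes "unitary_matrix U"
  shows "inner (udiag U d ** A) A = (\<Sum>i\<in>UNIV. \<Sum>j\<in>UNIV. d $ i * (cmod ((cadjoint U ** A) $ i $ j))\<^sup>2)"
proof -
  have "inner (udiag U d ** A) A = inner (U ** (real_diag d ** (cadjoint U ** A))) A"
    by (simp add: udiag_def matrix_mul_assoc)
  also have "\<dots> = inner (real_diag d ** (cadjoint U ** A)) (cadjoint U ** A)"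
    by (rule inner_mult_left)
  finally show ?thesis unfolding inner_real_diag_mult .
qed

lemma hermitian_fun_lower:
  fixes A P :: "complex ^ 'n ^ 'n"
  assumes "spec_in S P" "\<And>x. x \<in> S \<Longrightarrow> c \<le> f x"
  shows "c * (norm A)\<^sup>2 \<le> inner (hermitian_fun f P ** A) A"
proof -
  obtain U d where U: "unitary_matrix U" and P: "P = udiag U d" and d: "\<And>i. d $ i \<in> S"
    using assms(1) by (rule spec_inE) blast
  have "c * (norm A)\<^sup>2 = c * (norm (cadjoint U ** A))\<^sup>2"
    by (simp add: norm_unitary_mult unitary_cadjoint U)
  also have "\<dots> \<le> (\<Sum>i\<in>UNIV. \<Sum>j\<in>UNIV. f (d $ i) * (cmod ((cadjoint U ** A) $ i $ j))\<^sup>2)"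
    unfolding norm_matrix_sq sum_distrib_left using assms(2) d by (intro sum_mono mult_right_mono) auto
  also have "\<dots> = inner (hermitian_fun f P ** A) A"
    by (simp add: P hermitian_fun_udiag U inner_udiag_mult)
  finally show ?thesis .
qed

lemma hermitian_fun_upper:
  fixes A P :: "complex ^ 'n ^ 'n"
  assumes "spec_in S P" "\<And>x. x \<in> S \<Longrightarrow> f x \<le> c"
  shows "inner (hermitian_fun f P ** A) A \<le> c * (norm A)\<^sup>2"
proof -
  obtain U d where U: "unitary_matrix U" and P: "P = udiag U d" and d: "\<And>i. d $ i \<in> S"
    using assms(1) by (rule spec_inE) blast
  have "inner (hermitian_fun f P ** A) A = (\<Sum>i\<in>UNIV. \<Sum>j\<in>UNIV. f (d $ i) * (cmod ((cadjoint U ** A) $ i $ j))\<^sup>2)"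
    by (simp add: P hermitian_fun_udiag U inner_udiag_mult)
  also have "\<dots> \<le> c * (norm (cadjoint U ** A))\<^sup>2"
    unfolding norm_matrix_sq sum_distrib_left using assms(2) d by (intro sum_mono mult_right_mono) auto
  also have "\<dots> = c * (norm A)\<^sup>2"
    by (simp add: norm_unitary_mult unitary_cadjoint U)
  finally show ?thesis .
qed

text \<open>In eigenbases of $P$ and $Q$ the matrix $f(P)F - Fg(Q) - a(P)(PF - FQ)$ is the entrywise product
  of $F$ with $f(p_i) - g(q_j) - a(p_i)(p_i - q_j)$. So a scalar estimate on the spectra gives an estimate
  in the Hilbert-Schmidt norm. The function $a$ linearises $f$; $a = 0$ gives Lipschitz bounds.\<close>

lemma intertwining_estimate:
  fixes F P Q :: "complex ^ 'n ^ 'n"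
  assumes "spec_in S P" "spec_in S' Q"
    and est: "\<And>p q. p \<in> S \<Longrightarrow> q \<in> S' \<Longrightarrow> \<bar>f p - g q - a p * (p - q)\<bar> \<le> \<epsilon> + \<eta> * \<bar>p - q\<bar>"
    and "0 \<le> \<epsilon>" "0 \<le> \<eta>"
  shows "norm (hermitian_fun f P ** F - F ** hermitian_fun g Q - hermitian_fun a P ** (P ** F - F ** Q))
    \<le> \<epsilon> * norm F + \<eta> * norm (P ** F - F ** Q)"
proof -
  obtain U p where U: "unitary_matrix U" and P: "P = udiag U p" and p: "\<And>i. p $ i \<in> S"
    using assms(1) by (rule spec_inE) blast
  obtain V q where V: "unitary_matrix V" and Q: "Q = udiag V q" and q: "\<And>i. q $ i \<in> S'"
    using assms(2) by (rule spec_inE) blast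
  define G where "G = cadjoint U ** F ** V"
  have tr: "norm A = norm (cadjoint U ** A ** V)" for A :: "complex ^ 'n ^ 'n"
    by (simp add: norm_unitary_mult unitary_cadjoint U V)
  have c1: "cadjoint U ** (udiag U d ** A) ** V = real_diag d ** (cadjoint U ** A ** V)" for d A
    unfolding udiag_def by (simp add: matrix_mul_assoc unitaryD U)
  have c2: "cadjoint U ** (A ** udiag V d) ** V = (cadjoint U ** A ** V) ** real_diag d" for d A
    unfolding udiag_def by (simp add: matrix_mul_assoc[symmetric] unitaryD V)
  define L where "L = hermitian_fun f P ** F - F ** hermitian_fun g Q - hermitian_fun a P ** (P ** F - F ** Q)"
  have L: "(cadjoint U ** L ** V) $ i $ j = of_real (f (p$i) - g (q$j) - a (p$i) * (p$i - q$j)) * G $ i $ j" for i j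
  proof -
    have "cadjoint U ** L ** V = real_diag (\<chi> i. f (p$i)) ** G - G ** real_diag (\<chi> i. g (q$i))
        - real_diag (\<chi> i. a (p$i)) ** (real_diag p ** G - G ** real_diag q)"
      unfolding L_def P Q hermitian_fun_udiag[OF U] hermitian_fun_udiag[OF V] mmult.diff_left mmult.diff_right c1 c2
      by (simp add: G_def c1 c2)
    then show ?thesis
      by (simp add: real_diag_mult_component right_diff_distrib left_diff_distrib mult_ac)
  qed
  have PQ: "(cadjoint U ** (P ** F - F ** Q) ** V) $ i $ j = of_real (p$i - q$j) * G $ i $ j" for i j
    unfolding P Q mmult.diff_left mmult.diff_right c1 c2
    by (simp add: G_def[symmetric] real_diag_mult_component algebra_simps)
  let ?abs = "\<lambda>A. (\<chi> i j. complex_of_real (cmod (A $ i $ j))) :: complex ^ 'n ^ 'n"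
  have nabs: "norm (?abs A) = norm A" for A
  proof -
    have "(norm (?abs A))\<^sup>2 = (norm A)\<^sup>2" unfolding norm_matrix_sq by simp
    then show ?thesis by simp
  qed
  have "norm (cadjoint U ** L ** V) \<le> norm (\<epsilon> *\<^sub>R ?abs G + \<eta> *\<^sub>R ?abs (cadjoint U ** (P ** F - F ** Q) ** V))"
  proof (rule power2_le_imp_le, unfold norm_matrix_sq, intro sum_mono power_mono)
    fix i j
    have "cmod ((cadjoint U ** L ** V) $ i $ j) = \<bar>f (p$i) - g (q$j) - a (p$i) * (p$i - q$j)\<bar> * cmod (G $ i $ j)"
      unfolding L norm_mult by (simp del: of_real_diff of_real_mult)
    also have "\<dots> \<le> (\<epsilon> + \<eta> * \<bar>p$i - q$j\<bar>) * cmod (G $ i $ j)"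
      by (intro mult_right_mono est p q) simp
    also have "\<dots> = \<epsilon> * cmod (G $ i $ j) + \<eta> * cmod ((cadjoint U ** (P ** F - F ** Q) ** V) $ i $ j)"
      unfolding PQ norm_mult by (simp del: of_real_diff add: algebra_simps)
    also have "\<dots> = Re ((\<epsilon> *\<^sub>R ?abs G + \<eta> *\<^sub>R ?abs (cadjoint U ** (P ** F - F ** Q) ** V)) $ i $ j)"
      by simp
    also have "\<dots> \<le> cmod ((\<epsilon> *\<^sub>R ?abs G + \<eta> *\<^sub>R ?abs (cadjoint U ** (P ** F - F ** Q) ** V)) $ i $ j)"
      by (rule complex_Re_le_cmod)
    finally show "cmod ((cadjoint U ** L ** V) $ i $ j) \<le> \<dots>" .
  qed auto
  also have "\<dots> \<le> \<epsilon> * norm G + \<eta> * norm (cadjoint U ** (P ** F - F ** Q) ** V)"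
    by (rule order_trans[OF norm_triangle_ineq]) (simp add: nabs assms(4,5))
  finally show ?thesis
    unfolding L_def[symmetric] tr[of L] tr[of "P ** F - F ** Q"] G_def tr[of F] .
qed

lemma hermitian_fun_lipschitz:
  fixes P Q :: "complex ^ 'n ^ 'n"
  assumes "spec_in S P" "spec_in S' Q"
    and "\<And>p q. p \<in> S \<Longrightarrow> q \<in> S' \<Longrightarrow> \<bar>f p - g q\<bar> \<le> \<epsilon> + L * \<bar>p - q\<bar>" "0 \<le> \<epsilon>" "0 \<le> L"
  shows "norm (hermitian_fun f P - hermitian_fun g Q) \<le> \<epsilon> * norm (mat 1 :: complex ^ 'n ^ 'n) + L * norm (P - Q)"
  using intertwining_estimate[of S P S' Q f g "\<lambda>_. 0" \<epsilon> L "mat 1"] assms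
  by (simp add: hermitian_fun_const[OF assms(1)] mmult.zero_left)

text \<open>The estimate with $\varepsilon = 0$ and a large $\eta$ is an exact statement when $PF = FQ$.\<close>

lemma hermitian_fun_intertwine:
  fixes F P Q :: "complex ^ 'n ^ 'n"
  assumes "spec_in S P" "spec_in S' Q" "P ** F = F ** Q"
  shows "hermitian_fun f P ** F = F ** hermitian_fun f Q"
proof -
  obtain U p where U: "unitary_matrix U" and P: "P = udiag U p"
    using assms(1) by (rule spec_inE) blast
  obtain V q where V: "unitary_matrix V" and Q: "Q = udiag V q"
    using assms(2) by (rule spec_inE) blast
  have sp: "spec_in (range (($) p)) P" "spec_in (range (($) q)) Q"
    using U V P Q unfolding spec_in_def by blast+
  define \<eta> where "\<eta> = (\<Sum>x\<in>range (($) p) \<times> range (($) q). \<bar>f (fst x) - f (snd x)\<bar> / \<bar>fst x - snd x\<bar>)"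
  have "\<bar>f x - f y\<bar> \<le> \<eta> * \<bar>x - y\<bar>" if "x \<in> range (($) p)" "y \<in> range (($) q)" for x y
  proof (cases "x = y")
    case False
    have "\<bar>f (fst (x,y)) - f (snd (x,y))\<bar> / \<bar>fst (x,y) - snd (x,y)\<bar> \<le> \<eta>"
      unfolding \<eta>_def by (rule member_le_sum) (use that in auto)
    then show ?thesis using False by (simp add: divide_le_eq)
  qed simp
  then have "norm (hermitian_fun f P ** F - F ** hermitian_fun f Q - hermitian_fun (\<lambda>_. 0) P ** (P ** F - F ** Q))
    \<le> 0 * norm F + \<eta> * norm (P ** F - F ** Q)"
    by (intro intertwining_estimate[OF sp]) (auto simp: \<eta>_def intro!: sum_nonneg)
  then show ?thesis using assms(3) by (simp add: hermitian_fun_const[OF assms(1)])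
qed

section \<open>Singular values and the field of the flow\<close>

text \<open>Matrices $A$ take the place of vectors: the left multiplication by $X$ on matrices has the same norm as $X$
  on vectors, and all estimates can stay within the Hilbert-Schmidt inner product.\<close>

definition op_bounded :: "real \<Rightarrow> complex ^ 'n ^ 'n \<Rightarrow> bool" where
  "op_bounded b X \<longleftrightarrow> (\<forall>A :: complex ^ 'n ^ 'n. norm (X ** A) \<le> b * norm A)"

lemma gram_svd:
  fixes E U X :: "complex ^ 'n ^ 'n"
  assumes "unitary_matrix E" "unitary_matrix U" "X = E ** real_diag s ** cadjoint U"
  shows "cadjoint X ** X = udiag U (\<chi> i. (s $ i)\<^sup>2)" "X ** cadjoint X = udiag E (\<chi> i. (s $ i)\<^sup>2)"
proof -
  have "cadjoint X ** X = U ** real_diag s ** (cadjoint E ** E) ** real_diag s ** cadjoint U"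
    by (simp add: assms(3) cadjoint_mult matrix_mul_assoc)
  then show "cadjoint X ** X = udiag U (\<chi> i. (s $ i)\<^sup>2)"
    by (simp add: unitaryD assms udiag_def power2_eq_square flip: real_diag_simps(1))
      (simp add: matrix_mul_assoc)
  have "X ** cadjoint X = E ** real_diag s ** (cadjoint U ** U) ** real_diag s ** cadjoint E"
    by (simp add: assms(3) cadjoint_mult matrix_mul_assoc)
  then show "X ** cadjoint X = udiag E (\<chi> i. (s $ i)\<^sup>2)"
    by (simp add: unitaryD assms udiag_def power2_eq_square flip: real_diag_simps(1))
      (simp add: matrix_mul_assoc)
qed

lemma matrix_abs_svd:
  fixes E U X :: "complex ^ 'n ^ 'n"
  assumes "unitary_matrix E" "unitary_matrix U" "\<And>i. 0 \<le> s $ i" "X = E ** real_diag s ** cadjoint U"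
  shows "matrix_abs X = udiag U s" "matrix_abs (cadjoint X) = udiag E s"
  unfolding matrix_abs_def cadjoint_cadjoint gram_svd[OF assms(1,2,4)]
  by (simp_all add: hermitian_fun_udiag assms(1-3))

definition unit_diag :: "'n \<Rightarrow> complex ^ 'n ^ 'n" where
  "unit_diag i = real_diag (axis i 1)"

lemma norm_unit_diag [simp]: "norm (unit_diag i) = 1"
proof -
  have "(cmod (unit_diag i $ k $ l))\<^sup>2 = (if l = k then (if k = i then 1 else 0) else 0)" for k l
    by (simp add: unit_diag_def real_diag_def axis_def)
  then have "(norm (unit_diag i))\<^sup>2 = 1"
    unfolding norm_matrix_sq by (simp only:) simp
  then show ?thesis using power2_eq_imp_eq[of "norm (unit_diag i)" 1] by simp
qed

lemma real_diag_unit_diag: "real_diag d ** unit_diag i = d $ i *\<^sub>R unit_diag i"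
  unfolding unit_diag_def real_diag_simps by (rule arg_cong[of _ _ real_diag]) (simp add: vec_eq_iff axis_def)

lemma op_bounded_svd:
  fixes E U X :: "complex ^ 'n ^ 'n"
  assumes "unitary_matrix E" "unitary_matrix U" "\<And>i. 0 \<le> s $ i" "X = E ** real_diag s ** cadjoint U" "0 \<le> b"
  shows "op_bounded b X \<longleftrightarrow> (\<forall>i. s $ i \<le> b)"
proof
  assume X: "op_bounded b X"
  show "\<forall>i. s $ i \<le> b"
  proof
    fix i
    have "X ** (U ** unit_diag i) = E ** (s $ i *\<^sub>R unit_diag i)"
      by (simp add: assms(4) matrix_mul_assoc[symmetric] unitary_cancel assms(2) real_diag_unit_diag)
    then have "norm (X ** (U ** unit_diag i)) = s $ i"
      by (simp add: norm_unitary_mult assms(1,3))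
    moreover have "norm (X ** (U ** unit_diag i)) \<le> b * norm (U ** unit_diag i)"
      using X unfolding op_bounded_def by blast
    ultimately show "s $ i \<le> b" by (simp add: norm_unitary_mult assms(2))
  qed
next
  assume s: "\<forall>i. s $ i \<le> b"
  show "op_bounded b X" unfolding op_bounded_def
  proof
    fix A :: "complex ^ 'n ^ 'n"
    have "norm (X ** A) = norm (real_diag s ** (cadjoint U ** A))"
      by (simp add: assms(4) matrix_mul_assoc[symmetric] norm_unitary_mult assms(1))
    also have "\<dots> \<le> b * norm (cadjoint U ** A)"
    proof (rule power2_le_imp_le)
      show "(norm (real_diag s ** (cadjoint U ** A)))\<^sup>2 \<le> (b * norm (cadjoint U ** A))\<^sup>2"
        unfolding norm_matrix_sq power_mult_distrib sum_distrib_left real_diag_mult_component norm_mult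
        using s assms(3) by (intro sum_mono mult_right_mono) (auto intro!: power_mono)
    qed (simp add: assms(5))
    finally show "norm (X ** A) \<le> b * norm A"
      by (simp add: norm_unitary_mult unitary_cadjoint assms(2))
  qed
qed

lemma spec_in_udiag: "unitary_matrix U \<Longrightarrow> (\<And>i. d $ i \<in> S) \<Longrightarrow> spec_in S (udiag U d)"
  unfolding spec_in_def by blast

lemma spec_in_gram:
  fixes X :: "complex ^ 'n ^ 'n"
  assumes "op_bounded b X" "0 \<le> b"
  shows "spec_in {0..b\<^sup>2} (cadjoint X ** X)" "spec_in {0..b\<^sup>2} (X ** cadjoint X)"
proof -
  obtain E U d where s: "unitary_matrix E" "unitary_matrix U" "\<And>i. 0 \<le> d $ i"
    "X = E ** real_diag d ** cadjoint U" by (rule singular_value_decomposition[of X]) blast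
  have "(d $ i)\<^sup>2 \<in> {0..b\<^sup>2}" for i
    using op_bounded_svd[OF s assms(2)] assms(1) s(3) by (auto intro: power_mono)
  then show "spec_in {0..b\<^sup>2} (cadjoint X ** X)" "spec_in {0..b\<^sup>2} (X ** cadjoint X)"
    unfolding gram_svd[OF s(1,2,4)] using s(1,2) by (auto intro!: spec_in_udiag)
qed

lemma spec_in_gram_nonneg:
  fixes X :: "complex ^ 'n ^ 'n"
  shows "spec_in {0..} (cadjoint X ** X)" "spec_in {0..} (X ** cadjoint X)" "spec_in {0..} (matrix_abs X)"
proof -
  obtain E U d where s: "unitary_matrix E" "unitary_matrix U" "\<And>i. 0 \<le> d $ i"
    "X = E ** real_diag d ** cadjoint U" by (rule singular_value_decomposition[of X]) blast
  then show "spec_in {0..} (cadjoint X ** X)" "spec_in {0..} (X ** cadjoint X)" "spec_in {0..} (matrix_abs X)"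
    unfolding gram_svd[OF s(1,2,4)] matrix_abs_svd[OF s] by (auto intro!: spec_in_udiag)
qed

lemma diagonal_mult_component:
  fixes A B :: "complex ^ 'n ^ 'n"
  assumes "\<And>k. k \<noteq> i \<Longrightarrow> A $ i $ k = 0"
  shows "(A ** B) $ i $ j = A $ i $ i * B $ i $ j"
proof -
  have "(A ** B) $ i $ j = (\<Sum>k\<in>UNIV. A $ i $ k * B $ k $ j)"
    by (simp add: matrix_matrix_mult_def)
  also have "\<dots> = (\<Sum>k\<in>UNIV. if k = i then A $ i $ i * B $ i $ j else 0)"
    by (rule sum.cong[OF refl]) (use assms in auto)
  finally show ?thesis by simp
qed

lemma spectrum_udiag:
  fixes U :: "complex ^ 'n ^ 'n"
  assumes U: "unitary_matrix U"
  shows "matrix_spectrum (udiag U d) = (\<lambda>i. complex_of_real (d $ i)) ` UNIV"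
proof -
  have shift: "udiag U d - mat z = U ** (real_diag d - mat z) ** cadjoint U" for z
  proof -
    have "U ** mat z ** cadjoint U = mat z ** (U ** cadjoint U)"
      unfolding mat_commute[of U z] by (simp add: matrix_mul_assoc)
    then have "U ** mat z ** cadjoint U = mat z"
      unfolding unitaryD(2)[OF U] by simp
    then show ?thesis
      unfolding udiag_def mmult.diff_left mmult.diff_right by simp
  qed
  have singular: "\<not> invertible (udiag U d - mat (complex_of_real (d $ i)))" for i
  proof
    assume "invertible (udiag U d - mat (complex_of_real (d $ i)))"
    then obtain B where B: "B ** (udiag U d - mat (complex_of_real (d $ i))) = mat 1"
      unfolding invertible_def by blast
    have "(udiag U d - mat (complex_of_real (d $ i))) ** (U ** unit_diag i) =
        U ** ((real_diag d - mat (complex_of_real (d $ i))) ** unit_diag i)"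
      unfolding shift by (simp add: matrix_mul_assoc[symmetric] unitary_cancel U)
    also have "\<dots> = 0"
      by (simp add: mmult.diff_left real_diag_unit_diag mat_of_real mmult.zero_right)
    finally have "B ** (udiag U d - mat (complex_of_real (d $ i))) ** (U ** unit_diag i) = 0"
      by (simp add: matrix_mul_assoc[symmetric] mmult.zero_right)
    then have "U ** unit_diag i = 0" unfolding B by simp
    then show False by (metis norm_unit_diag norm_unitary_mult(1) U norm_zero zero_neq_one)
  qed
  have regular: "invertible (udiag U d - mat z)" if z: "\<And>i. complex_of_real (d $ i) \<noteq> z" for z
  proof -
    define B :: "complex ^ 'n ^ 'n" where "B = (\<chi> i j. if i = j then 1 / (complex_of_real (d $ i) - z) else 0)"
    define A :: "complex ^ 'n ^ 'n" where "A = real_diag d - mat z"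
    have A: "A $ i $ j = (if i = j then complex_of_real (d $ i) - z else 0)" for i j
      by (simp add: A_def real_diag_def mat_def)
    have B: "B $ i $ j = (if i = j then 1 / (complex_of_real (d $ i) - z) else 0)" for i j
      by (simp add: B_def)
    have nz: "complex_of_real (d $ i) - z \<noteq> 0" for i using z[of i] by simp
    have "(A ** B) $ i $ j = mat 1 $ i $ j \<and> (B ** A) $ i $ j = mat 1 $ i $ j" for i j
    proof -
      have "(A ** B) $ i $ j = A $ i $ i * B $ i $ j" by (rule diagonal_mult_component) (simp add: A)
      moreover have "(B ** A) $ i $ j = B $ i $ i * A $ i $ j" by (rule diagonal_mult_component) (simp add: B)
      ultimately show ?thesis using nz[of i] unfolding A B by (cases "i = j") (simp_all add: mat_def)
    qed
    then have m: "(real_diag d - mat z) ** B = mat 1" "B ** (real_diag d - mat z) = mat 1"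
      unfolding A_def[symmetric] by (simp_all add: vec_eq_iff)
    have "(udiag U d - mat z) ** (U ** B ** cadjoint U) = U ** ((real_diag d - mat z) ** B) ** cadjoint U"
      unfolding shift by (simp only: matrix_mul_assoc unitary_cancel(3)[OF U])
    moreover have "(U ** B ** cadjoint U) ** (udiag U d - mat z) = U ** (B ** (real_diag d - mat z)) ** cadjoint U"
      unfolding shift by (simp only: matrix_mul_assoc unitary_cancel(3)[OF U])
    ultimately have "(udiag U d - mat z) ** (U ** B ** cadjoint U) = mat 1"
      "(U ** B ** cadjoint U) ** (udiag U d - mat z) = mat 1"
      by (simp_all only: m matrix_mul_rid unitaryD(2)[OF U])
    then show ?thesis unfolding invertible_def by blast
  qed
  have "\<not> invertible (udiag U d - mat z) \<longleftrightarrow> z \<in> range (\<lambda>i. complex_of_real (d $ i))" for z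
  proof (cases "\<exists>i. complex_of_real (d $ i) = z")
    case True
    then show ?thesis using singular by auto
  next
    case False
    then show ?thesis using regular[of z] by auto
  qed
  then show ?thesis unfolding matrix_spectrum_def by blast
qed

lemma matrices_upto_iff:
  fixes X :: "complex ^ 'n ^ 'n"
  assumes "0 \<le> b" shows "X \<in> matrices_upto b \<longleftrightarrow> op_bounded b X"
proof -
  obtain E U d where s: "unitary_matrix E" "unitary_matrix U" "\<And>i. 0 \<le> d $ i"
    "X = E ** real_diag d ** cadjoint U" by (rule singular_value_decomposition[of X]) blast
  show ?thesis
    unfolding matrices_upto_def op_bounded_svd[OF s assms] matrix_abs_svd[OF s] mem_Collect_eq spectrum_udiag[OF s(2)]
      image_subset_iff inj_image_mem_iff[OF inj_of_real]
    using s(3) by simp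
qed

lemma phi_matrix_gram:
  "phi_matrix \<phi>1 \<phi>2 X = hermitian_fun (\<lambda>x. \<phi>1 (sqrt x)) (cadjoint X ** X)
     - hermitian_fun (\<lambda>x. \<phi>2 (sqrt x)) (X ** cadjoint X)"
  unfolding phi_matrix_def matrix_abs_def cadjoint_cadjoint
  by (simp add: hermitian_fun_comp[OF spec_in_gram_nonneg(1)] hermitian_fun_comp[OF spec_in_gram_nonneg(2)])

lemma cadjoint_phi_matrix [simp]: "cadjoint (phi_matrix \<phi>1 \<phi>2 X) = phi_matrix \<phi>1 \<phi>2 X"
  unfolding phi_matrix_gram cadjoint_diff
  by (simp add: cadjoint_hermitian_fun[OF spec_in_gram_nonneg(1)] cadjoint_hermitian_fun[OF spec_in_gram_nonneg(2)])

lemma phi_matrix_cong: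
  assumes "op_bounded b X" "0 \<le> b" "\<And>x. x \<in> {0..b} \<Longrightarrow> \<phi>1 x = \<chi>1 x \<and> \<phi>2 x = \<chi>2 x"
  shows "phi_matrix \<phi>1 \<phi>2 X = phi_matrix \<chi>1 \<chi>2 X"
proof -
  have "sqrt x \<in> {0..b}" if "x \<in> {0..b\<^sup>2}" for x
    using that assms(2) real_sqrt_le_mono[of x "b\<^sup>2"] by (simp add: real_sqrt_abs)
  then have eq: "\<phi>1 (sqrt x) = \<chi>1 (sqrt x)" "\<phi>2 (sqrt x) = \<chi>2 (sqrt x)" if "x \<in> {0..b\<^sup>2}" for x
    using assms(3) that by blast+
  show ?thesis
    unfolding phi_matrix_gram
    by (rule arg_cong2[of _ _ _ _ "(-)"])
      (rule hermitian_fun_cong[OF spec_in_gram(1)[OF assms(1,2)]], erule eq,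
        rule hermitian_fun_cong[OF spec_in_gram(2)[OF assms(1,2)]], erule eq)
qed

lemma inner_real_diag:
  fixes M :: "complex ^ 'n ^ 'n"
  shows "inner (real_diag s) M = (\<Sum>i\<in>UNIV. s $ i * Re (M $ i $ i))"
proof -
  have "Re (cnj (real_diag s $ i $ j) * M $ i $ j) = (if i = j then s $ i * Re (M $ i $ j) else 0)" for i j
    by (simp add: real_diag_def)
  then show ?thesis unfolding inner_matrix by (simp add: sum.delta)
qed

lemma Re_diag_sandwich:
  fixes a c :: "complex ^ 'n ^ 'n"
  shows "Re ((c ** real_diag t ** cadjoint a) $ i $ i) = (\<Sum>j\<in>UNIV. t $ j * Re (c $ i $ j * cnj (a $ i $ j)))"
proof -
  have "(c ** real_diag t ** cadjoint a) $ i $ i = (\<Sum>j\<in>UNIV. (c ** real_diag t) $ i $ j * cnj (a $ i $ j))"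
    by (subst matrix_matrix_mult_def) simp
  then have "Re ((c ** real_diag t ** cadjoint a) $ i $ i) = (\<Sum>j\<in>UNIV. Re ((c ** real_diag t) $ i $ j * cnj (a $ i $ j)))"
    by (simp only: Re_sum)
  moreover have "Re ((c ** real_diag t) $ i $ j * cnj (a $ i $ j)) = t $ j * Re (c $ i $ j * cnj (a $ i $ j))" for j
  proof -
    have "(c ** real_diag t) $ i $ j * cnj (a $ i $ j) = complex_of_real (t $ j) * (c $ i $ j * cnj (a $ i $ j))"
      unfolding real_diag_mult_component by (simp only: mult_ac)
    then show ?thesis by (simp only: times_complex.sel Re_complex_of_real Im_complex_of_real)
  qed
  ultimately show ?thesis by (simp only:)
qed

lemma inner_svd:
  fixes E E' U V :: "complex ^ 'n ^ 'n"
  shows "inner (E ** real_diag s ** cadjoint U) (E' ** real_diag t ** cadjoint V) =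
    (\<Sum>i\<in>UNIV. \<Sum>j\<in>UNIV. s $ i * (t $ j * Re ((cadjoint E ** E') $ i $ j * cnj ((cadjoint U ** V) $ i $ j))))"
proof -
  define Y where "Y = E' ** real_diag t ** cadjoint V"
  have "inner (E ** real_diag s ** cadjoint U) Y = inner (E ** real_diag s) (Y ** cadjoint (cadjoint U))"
    by (rule inner_mult_right)
  also have "\<dots> = inner (real_diag s) (cadjoint E ** (Y ** cadjoint (cadjoint U)))"
    by (rule inner_mult_left)
  also have "cadjoint E ** (Y ** cadjoint (cadjoint U)) = (cadjoint E ** E') ** real_diag t ** cadjoint (cadjoint U ** V)"
    by (simp add: Y_def cadjoint_mult matrix_mul_assoc)
  finally show ?thesis
    unfolding Y_def inner_real_diag Re_diag_sandwich sum_distrib_left .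
qed

lemma inner_udiag:
  fixes U V :: "complex ^ 'n ^ 'n"
  shows "inner (udiag U s) (udiag V t) = (\<Sum>i\<in>UNIV. \<Sum>j\<in>UNIV. s $ i * (t $ j * (cmod ((cadjoint U ** V) $ i $ j))\<^sup>2))"
proof -
  have "Re (z * cnj z) = (cmod z)\<^sup>2" for z
    unfolding complex_norm_square[symmetric] by simp
  then show ?thesis unfolding udiag_def inner_svd by (simp only:)
qed

text \<open>The cross terms $\langle X, Y\rangle$ are bounded by those of $|X|, |Y|$ and of $|X^*|, |Y^*|$, because
  $2\,\mathrm{Re}(c\bar a) \le |a|^2 + |c|^2$ for the two overlap matrices of the singular vectors.\<close>

lemma matrix_abs_lipschitz:
  fixes X Y :: "complex ^ 'n ^ 'n"
  shows "norm (matrix_abs X - matrix_abs Y) \<le> sqrt 2 * norm (X - Y)"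
proof -
  obtain E U s where X: "unitary_matrix E" "unitary_matrix U" "\<And>i. 0 \<le> s $ i"
    "X = E ** real_diag s ** cadjoint U" by (rule singular_value_decomposition[of X]) blast
  obtain E' V t where Y: "unitary_matrix E'" "unitary_matrix V" "\<And>i. 0 \<le> t $ i"
    "Y = E' ** real_diag t ** cadjoint V" by (rule singular_value_decomposition[of Y]) blast
  have nrm: "norm (udiag W d) = norm (real_diag d)" "norm (W ** real_diag d ** cadjoint W') = norm (real_diag d)"
    if "unitary_matrix W" "unitary_matrix W'" for W W' :: "complex ^ 'n ^ 'n" and d
    unfolding udiag_def using that by (simp_all add: norm_unitary_mult unitary_cadjoint)
  have expand: "(norm (A - B))\<^sup>2 = (norm A)\<^sup>2 + (norm B)\<^sup>2 - 2 * inner A B" for A B :: "complex ^ 'n ^ 'n"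
    by (simp add: power2_norm_eq_inner inner_diff_left inner_diff_right inner_commute)
  have "2 * inner X Y \<le> inner (udiag E s) (udiag E' t) + inner (udiag U s) (udiag V t)"
  proof -
    define c a where "c = cadjoint E ** E'" and "a = cadjoint U ** V"
    have "2 * (s$i * (t$j * Re (c$i$j * cnj (a$i$j)))) \<le>
        s$i * (t$j * (cmod (c$i$j))\<^sup>2) + s$i * (t$j * (cmod (a$i$j))\<^sup>2)" for i j
    proof -
      have "Re (c$i$j * cnj (a$i$j)) \<le> cmod (c$i$j) * cmod (a$i$j)"
        using complex_Re_le_cmod[of "c$i$j * cnj (a$i$j)"] by (simp only: norm_mult complex_mod_cnj)
      moreover have "2 * (cmod (c$i$j) * cmod (a$i$j)) \<le> (cmod (c$i$j))\<^sup>2 + (cmod (a$i$j))\<^sup>2"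
        using sum_squares_bound[of "cmod (c$i$j)" "cmod (a$i$j)"] by simp
      ultimately have "2 * Re (c$i$j * cnj (a$i$j)) \<le> (cmod (c$i$j))\<^sup>2 + (cmod (a$i$j))\<^sup>2" by linarith
      then have "(s$i * t$j) * (2 * Re (c$i$j * cnj (a$i$j))) \<le> (s$i * t$j) * ((cmod (c$i$j))\<^sup>2 + (cmod (a$i$j))\<^sup>2)"
        using X(3) Y(3) by (intro mult_left_mono) auto
      then show ?thesis by (simp only: distrib_left mult_ac)
    qed
    then have "(\<Sum>i\<in>UNIV. \<Sum>j\<in>UNIV. 2 * (s$i * (t$j * Re (c$i$j * cnj (a$i$j))))) \<le>
        (\<Sum>i\<in>UNIV. \<Sum>j\<in>UNIV. s$i * (t$j * (cmod (c$i$j))\<^sup>2) + s$i * (t$j * (cmod (a$i$j))\<^sup>2))"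
      by (intro sum_mono)
    then show ?thesis
      unfolding X(4) Y(4) inner_svd inner_udiag c_def a_def sum.distrib sum_distrib_left .
  qed
  moreover have "(norm (matrix_abs X - matrix_abs Y))\<^sup>2 = (norm X)\<^sup>2 + (norm Y)\<^sup>2 - 2 * inner (udiag U s) (udiag V t)"
    unfolding matrix_abs_svd(1)[OF X] matrix_abs_svd(1)[OF Y] expand nrm(1)[OF X(2) X(2)] nrm(1)[OF Y(2) Y(2)]
    unfolding X(4) Y(4) nrm(2)[OF X(1,2)] nrm(2)[OF Y(1,2)] ..
  moreover have "0 \<le> (norm X)\<^sup>2 + (norm Y)\<^sup>2 - 2 * inner (udiag E s) (udiag E' t)"
  proof -
    have "(norm (udiag E s - udiag E' t))\<^sup>2 = (norm X)\<^sup>2 + (norm Y)\<^sup>2 - 2 * inner (udiag E s) (udiag E' t)"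
      unfolding expand nrm(1)[OF X(1) X(1)] nrm(1)[OF Y(1) Y(1)]
      unfolding X(4) Y(4) nrm(2)[OF X(1,2)] nrm(2)[OF Y(1,2)] ..
    then show ?thesis using zero_le_power2[of "norm (udiag E s - udiag E' t)"] by (simp only:)
  qed
  moreover have "N \<le> 2 * (n + m - 2 * x)" if "2 * x \<le> a + b" "N = n + m - 2 * b" "0 \<le> n + m - 2 * a"
    for N n m x a b :: real
    using that by (simp add: algebra_simps)
  ultimately have "(norm (matrix_abs X - matrix_abs Y))\<^sup>2 \<le> 2 * (norm (X - Y))\<^sup>2"
    unfolding expand[of X Y] by blast
  then have "(norm (matrix_abs X - matrix_abs Y))\<^sup>2 \<le> (sqrt 2 * norm (X - Y))\<^sup>2"
    by (simp add: power_mult_distrib)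
  then show ?thesis by (rule power2_le_imp_le) simp
qed

definition lipschitz_nonneg :: "real \<Rightarrow> (real \<Rightarrow> real) \<Rightarrow> bool" where
  "lipschitz_nonneg L f \<longleftrightarrow> 0 \<le> L \<and> (\<forall>x\<ge>0. \<forall>y\<ge>0. \<bar>f x - f y\<bar> \<le> L * \<bar>x - y\<bar>)"

lemma phi_matrix_lipschitz:
  fixes X Y :: "complex ^ 'n ^ 'n"
  assumes "lipschitz_nonneg L \<phi>1" "lipschitz_nonneg L \<phi>2"
  shows "norm (phi_matrix \<phi>1 \<phi>2 X - phi_matrix \<phi>1 \<phi>2 Y) \<le> 2 * sqrt 2 * L * norm (X - Y)"
proof -
  have 1: "norm (hermitian_fun f (matrix_abs A) - hermitian_fun f (matrix_abs B)) \<le> sqrt 2 * L * norm (A - B)"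
    if "lipschitz_nonneg L f" for f and A B :: "complex ^ 'n ^ 'n"
  proof -
    have "norm (hermitian_fun f (matrix_abs A) - hermitian_fun f (matrix_abs B)) \<le> 
      0 * norm (mat 1 :: complex ^ 'n ^ 'n) + L * norm (matrix_abs A - matrix_abs B)"
      by (rule hermitian_fun_lipschitz[OF spec_in_gram_nonneg(3) spec_in_gram_nonneg(3)])
        (use that in \<open>auto simp: lipschitz_nonneg_def\<close>)
    also have "\<dots> \<le> 0 + L * (sqrt 2 * norm (A - B))"
      using that by (intro add_mono mult_left_mono matrix_abs_lipschitz) (auto simp: lipschitz_nonneg_def)
    finally show ?thesis by (simp add: mult_ac)
  qed
  have "norm (phi_matrix \<phi>1 \<phi>2 X - phi_matrix \<phi>1 \<phi>2 Y) \<le>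
     norm (hermitian_fun \<phi>1 (matrix_abs X) - hermitian_fun \<phi>1 (matrix_abs Y)) +
     norm (hermitian_fun \<phi>2 (matrix_abs (cadjoint X)) - hermitian_fun \<phi>2 (matrix_abs (cadjoint Y)))"
    unfolding phi_matrix_def by norm
  also have "\<dots> \<le> sqrt 2 * L * norm (X - Y) + sqrt 2 * L * norm (cadjoint X - cadjoint Y)"
    by (intro add_mono 1 assms)
  also have "norm (cadjoint X - cadjoint Y) = norm (X - Y)"
    by (metis cadjoint_diff norm_cadjoint)
  finally show ?thesis by (simp add: mult_ac)
qed

section \<open>Differential equations\<close>

lemma has_integral_power:
  assumes "0 \<le> t"
  shows "((\<lambda>s::real. s ^ m) has_integral t ^ Suc m / real (Suc m)) {0..t}"
proof -
  have "((\<lambda>s::real. s ^ m) has_integral t ^ Suc m / real (Suc m) - 0 ^ Suc m / real (Suc m)) {0..t}"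
  proof (rule fundamental_theorem_of_calculus[OF assms])
    fix x :: real
    have "((\<lambda>x. x ^ Suc m / real (Suc m)) has_real_derivative (1 + real m) * (1 * x ^ m) / real (Suc m)) (at x within {0..t})"
      by (intro DERIV_cdivide DERIV_power_Suc DERIV_ident)
    then show "((\<lambda>x. x ^ Suc m / real (Suc m)) has_vector_derivative x ^ m) (at x within {0..t})"
      by (simp add: has_real_derivative_iff_has_vector_derivative del: power_Suc)
  qed
  then show ?thesis by simp
qed

text \<open>Picard iteration on the whole half-line: successive iterates differ at time $t$ by at most
  $|V(T)| L^m t^{m+1}/(m+1)!$, so they converge uniformly on every $[0, b]$.\<close>

theorem global_solution_exists:
  fixes V :: "'a::euclidean_space \<Rightarrow> 'a"
  assumes "0 \<le> L" and lip: "\<And>x y. norm (V x - V y) \<le> L * norm (x - y)"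
  obtains X where "X 0 = T" "\<And>t. t \<ge> 0 \<Longrightarrow> (X has_vector_derivative V (X t)) (at t within {0..})"
proof -
  define Y where "Y = rec_nat (\<lambda>t::real. T) (\<lambda>_ y t. T + integral {0..t} (\<lambda>s. V (y s)))"
  have Y0: "Y 0 t = T" and YS: "Y (Suc m) t = T + integral {0..t} (\<lambda>s. V (Y m s))" for m t
    by (simp_all add: Y_def)
  have "L-lipschitz_on UNIV V"
    using assms by (intro lipschitz_onI) (auto simp: dist_norm)
  then have Vcont: "continuous_on UNIV V" by (rule lipschitz_on_continuous_on)
  have Vc: "continuous_on S (\<lambda>s. V (f s))" if "continuous_on S f" for S and f :: "real \<Rightarrow> 'a"
    by (rule continuous_on_compose2[OF Vcont that]) simp
  have cont: "continuous_on {0..b} (Y m)" for b m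
  proof (induction m)
    case 0
    then show ?case by (simp add: Y0[abs_def])
  next
    case (Suc m)
    have "continuous_on {0..b} (\<lambda>t. T + integral {0..t} (\<lambda>s. V (Y m s)))"
      by (intro continuous_intros indefinite_integral_continuous_1 integrable_continuous_real Vc Suc)
    then show ?case by (simp add: YS[abs_def])
  qed
  have int: "(\<lambda>s. V (Y m s)) integrable_on {0..b}" for m b
    by (intro integrable_continuous_real Vc cont)
  have step: "norm (Y (Suc m) t - Y m t) \<le> norm (V T) * L ^ m * t ^ Suc m / fact (Suc m)" if "0 \<le> t" for m t
    using that
  proof (induction m arbitrary: t)
    case 0
    then show ?case by (simp add: YS Y0)
  next
    case (Suc m)
    define c where "c = L * (norm (V T) * L ^ m / fact (Suc m))"
    have hi: "((\<lambda>s. c * s ^ Suc m) has_integral c * (t ^ Suc (Suc m) / real (Suc (Suc m)))) {0..t}"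
      by (intro has_integral_mult_right has_integral_power Suc.prems)
    have "Y (Suc (Suc m)) t - Y (Suc m) t = integral {0..t} (\<lambda>s. V (Y (Suc m) s) - V (Y m s))"
      unfolding YS[of "Suc m" t] YS[of m t] integral_diff[OF int int] by simp
    also have "norm \<dots> \<le> integral {0..t} (\<lambda>s. c * s ^ Suc m)"
    proof (rule integral_norm_bound_integral)
      show "(\<lambda>s. V (Y (Suc m) s) - V (Y m s)) integrable_on {0..t}"
        by (intro integrable_diff int)
      show "(\<lambda>s. c * s ^ Suc m) integrable_on {0..t}" using hi by (rule has_integral_integrable)
      fix s assume "s \<in> {0..t}"
      then have "norm (Y (Suc m) s - Y m s) \<le> norm (V T) * L ^ m * s ^ Suc m / fact (Suc m)"
        using Suc.IH by simp
      then have "L * norm (Y (Suc m) s - Y m s) \<le> L * (norm (V T) * L ^ m * s ^ Suc m / fact (Suc m))"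
        using assms(1) by (rule mult_left_mono)
      also have "\<dots> = c * s ^ Suc m" by (simp add: c_def del: fact_Suc power_Suc)
      finally show "norm (V (Y (Suc m) s) - V (Y m s)) \<le> c * s ^ Suc m"
        using lip[of "Y (Suc m) s" "Y m s"] by linarith
    qed
    also have "\<dots> = c * (t ^ Suc (Suc m) / real (Suc (Suc m)))"
      using hi by (rule integral_unique)
    also have "\<dots> = norm (V T) * L ^ Suc m * t ^ Suc (Suc m) / fact (Suc (Suc m))"
      unfolding c_def fact_Suc[of "Suc m"] power_Suc[of L m] of_nat_mult by (simp add: field_simps del: fact_Suc power_Suc of_nat_Suc)
    finally show ?case .
  qed
  define X where "X t = T + (\<Sum>m. Y (Suc m) t - Y m t)" for t
  have unif: "uniform_limit {0..b} Y X sequentially" if "0 \<le> b" for b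
  proof -
    have "uniform_limit {0..b} (\<lambda>n t. \<Sum>m<n. Y (Suc m) t - Y m t) (\<lambda>t. \<Sum>m. Y (Suc m) t - Y m t) sequentially"
    proof (rule Weierstrass_m_test)
      show "summable (\<lambda>m. norm (V T) * b * ((L * b) ^ m /\<^sub>R fact m))"
        by (intro summable_mult summable_exp_generic)
      fix m t assume t: "t \<in> {0..b}"
      have "norm (Y (Suc m) t - Y m t) \<le> norm (V T) * L ^ m * t ^ Suc m / fact (Suc m)"
        using step[of t m] t by (simp del: fact_Suc power_Suc)
      also have "\<dots> \<le> norm (V T) * L ^ m * b ^ Suc m / fact m"
        using t assms(1) by (intro frac_le mult_left_mono power_mono fact_mono mult_nonneg_nonneg zero_le_power) auto
      also have "\<dots> = norm (V T) * b * ((L * b) ^ m /\<^sub>R fact m)"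
        by (simp add: power_mult_distrib field_simps)
      finally show "norm (Y (Suc m) t - Y m t) \<le> norm (V T) * b * ((L * b) ^ m /\<^sub>R fact m)" .
    qed
    then have "uniform_limit {0..b} (\<lambda>n t. T + (\<Sum>m<n. Y (Suc m) t - Y m t)) X sequentially"
      unfolding X_def by (intro uniform_limit_add uniform_limit_const)
    moreover have "T + (\<Sum>m<n. Y (Suc m) t - Y m t) = Y n t" for n t
      using sum_lessThan_telescope[of "\<lambda>m. Y m t" n] by (simp add: Y0)
    ultimately show ?thesis by (simp only:)
  qed
  have Xcont: "continuous_on {0..b} X" for b
  proof (cases "0 \<le> b")
    case True
    show ?thesis by (rule uniform_limit_theorem[OF _ unif[OF True]]) (auto simp: cont)
  qed simp
  have Xint: "X t = T + integral {0..t} (\<lambda>s. V (X s))" if "0 \<le> t" for t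
  proof -
    have "(\<lambda>n. integral {0..t} (\<lambda>s. V (Y n s))) \<longlonglongrightarrow> integral {0..t} (\<lambda>s. V (X s))"
    proof (rule LIMSEQ_I)
      fix e :: real assume e: "0 < e"
      define d where "d = e / (1 + L * t)"
      have pos: "0 < 1 + L * t" using assms(1) that by (simp add: add_pos_nonneg)
      then have "0 < d" using e by (simp add: d_def)
      from uniform_limitD[OF unif[OF that] this] obtain N where
        N: "\<And>n s. n \<ge> N \<Longrightarrow> s \<in> {0..t} \<Longrightarrow> dist (Y n s) (X s) < d"
        unfolding eventually_sequentially by blast
      have "norm (integral {0..t} (\<lambda>s. V (Y n s)) - integral {0..t} (\<lambda>s. V (X s))) < e" if "n \<ge> N" for n
      proof -
        have Xi: "(\<lambda>s. V (X s)) integrable_on {0..t}" by (intro integrable_continuous_real Vc Xcont)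
        have "norm (integral {0..t} (\<lambda>s. V (Y n s) - V (X s))) \<le> integral {0..t} (\<lambda>s. L * d)"
        proof (rule integral_norm_bound_integral)
          show "(\<lambda>s. V (Y n s) - V (X s)) integrable_on {0..t}" by (intro integrable_diff int Xi)
          fix s assume "s \<in> {0..t}"
          then have "norm (Y n s - X s) \<le> d" using N[OF that] by (simp add: dist_norm less_imp_le)
          then have "L * norm (Y n s - X s) \<le> L * d" using assms(1) by (rule mult_left_mono)
          with lip[of "Y n s" "X s"] show "norm (V (Y n s) - V (X s)) \<le> L * d" by linarith
        qed (rule integrable_const_ivl)
        also have "\<dots> = L * t * d" using \<open>0 \<le> t\<close> by (simp add: mult_ac)
        also have "\<dots> < (1 + L * t) * d" using \<open>0 < d\<close> by (simp add: algebra_simps)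
        also have "\<dots> = e" using pos by (simp add: d_def)
        finally show ?thesis by (simp add: integral_diff[OF int Xi])
      qed
      then show "\<exists>N. \<forall>n\<ge>N. norm (integral {0..t} (\<lambda>s. V (Y n s)) - integral {0..t} (\<lambda>s. V (X s))) < e"
        by blast
    qed
    then have "(\<lambda>n. Y (Suc n) t) \<longlonglongrightarrow> T + integral {0..t} (\<lambda>s. V (X s))"
      unfolding YS by (intro tendsto_intros)
    moreover have "(\<lambda>n. Y (Suc n) t) \<longlonglongrightarrow> X t"
      using tendsto_uniform_limitI[OF unif[OF that], of t] that by (intro LIMSEQ_Suc) simp
    ultimately show ?thesis using LIMSEQ_unique by blast
  qed
  show thesis
  proof (rule that[of X])
    show "X 0 = T" using Xint[of 0] by simp
    fix t :: real assume t: "0 \<le> t"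
    have "((\<lambda>u. T + integral {0..u} (\<lambda>s. V (X s))) has_vector_derivative 0 + V (X t)) (at t within {0..t+1})"
      by (intro has_vector_derivative_add has_vector_derivative_const integral_has_vector_derivative Vc Xcont) (use t in auto)
    then have "(X has_vector_derivative V (X t)) (at t within {0..t+1})"
      using t by (intro has_vector_derivative_transform[of t "{0..t+1}" X]) (auto simp: Xint)
    moreover have "at t within {0..t+1} = at t within {0..}"
      by (rule at_within_nhd[of _ "{..<t+1}"]) (use t in auto)
    ultimately show "(X has_vector_derivative V (X t)) (at t within {0..})" by simp
  qed
qed

lemma nonincreasing_on_halfline:
  fixes g :: "real \<Rightarrow> real"
  assumes g: "\<And>t. t \<ge> 0 \<Longrightarrow> (g has_real_derivative g' t) (at t within {0..})"
    and neg: "\<And>x. s < x \<Longrightarrow> x < t \<Longrightarrow> g' x \<le> 0" and "0 \<le> s" "s \<le> t"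
  shows "g t \<le> g s"
proof (rule DERIV_nonpos_imp_decreasing_open[where a = s and b = t and f = g])
  show "s \<le> t" by fact
  fix x assume x: "s < x" "x < t"
  have "at x within {0..} = at x"
    by (rule at_within_interior) (use x assms in auto)
  then show "\<exists>y. (g has_real_derivative y) (at x) \<and> y \<le> 0"
    using g[of x] neg[of x] x assms by auto
next
  show "continuous_on {s..t} g"
    unfolding continuous_on_eq_continuous_within
  proof
    fix x assume "x \<in> {s..t}"
    then have "0 \<le> x" using assms by simp
    then have "continuous (at x within {0..}) g"
      by (rule DERIV_continuous[OF g])
    then show "continuous (at x within {s..t}) g"
      by (rule continuous_within_subset) (use assms in auto)
  qed
qed

text \<open>A mean value inequality: a curve that is nowhere faster than $h$ moves no further than $h$.\<close>

lemma displacement_bound: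
  fixes x :: "real \<Rightarrow> 'a::real_normed_vector" and h :: "real \<Rightarrow> real"
  assumes x: "\<And>t. t \<ge> 0 \<Longrightarrow> (x has_vector_derivative x' t) (at t within {0..})"
    and h: "\<And>t. t \<ge> 0 \<Longrightarrow> (h has_real_derivative h' t) (at t within {0..})"
    and le: "\<And>u. s < u \<Longrightarrow> u < t \<Longrightarrow> norm (x' u) \<le> h' u" and st: "0 \<le> s" "s \<le> t"
  shows "norm (x t - x s) \<le> h t - h s"
proof (cases "s = t")
  case False
  have at: "at u within {0..} = at u" if "s < u" for u
    by (rule at_within_interior) (use that st in auto)
  have cont: "continuous_on {s..t} y"
    if y: "\<And>t. t \<ge> 0 \<Longrightarrow> (y has_vector_derivative y' t) (at t within {0..})"
    for y :: "real \<Rightarrow> 'c::real_normed_vector" and y'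
  proof -
    have "continuous_on {0..} y"
      unfolding continuous_on_eq_continuous_within
      using has_vector_derivative_continuous[OF y] by simp
    then show ?thesis by (rule continuous_on_subset) (use st in auto)
  qed
  have h2: "(h has_vector_derivative h' u) (at u within {0..})" if "u \<ge> 0" for u
    using h[OF that] by (simp add: has_real_derivative_iff_has_vector_derivative)
  show ?thesis
  proof (rule differentiable_bound_general[where f' = x' and \<phi>' = h'])
    show "s < t" using False st by simp
    show "continuous_on {s..t} x" by (rule cont[OF x])
    show "continuous_on {s..t} h" by (rule cont[OF h2])
    fix u assume u: "s < u" "u < t"
    then show "(x has_vector_derivative x' u) (at u)" using x[of u] at[of u] st by simp
    show "(h has_vector_derivative h' u) (at u)" using h2[of u] at[of u] u st by simp
    show "norm (x' u) \<le> h' u" by (rule le[OF u])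
  qed
qed simp

lemma has_real_derivative_inner_self:
  fixes f :: "real \<Rightarrow> 'a::real_inner"
  assumes "(f has_vector_derivative f') (at t within S)"
  shows "((\<lambda>s. inner (f s) (f s)) has_real_derivative 2 * inner (f t) f') (at t within S)"
  using bounded_bilinear.has_vector_derivative[OF bounded_bilinear_inner assms assms]
  by (simp add: inner_commute has_real_derivative_iff_has_vector_derivative)

text \<open>Gronwall: $e^{-2Lt}|f(t)|^2$ is nonincreasing.\<close>

lemma gronwall_zero:
  fixes f :: "real \<Rightarrow> 'a::real_inner"
  assumes f: "\<And>t. t \<ge> 0 \<Longrightarrow> (f has_vector_derivative f' t) (at t within {0..})"
    and bound: "\<And>t. t \<ge> 0 \<Longrightarrow> norm (f' t) \<le> L * norm (f t)" and "f 0 = 0" "0 \<le> t"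
  shows "f t = 0"
proof -
  let ?g = "\<lambda>t. exp (- (2 * L * t)) * inner (f t) (f t)"
  have "?g t \<le> ?g 0"
  proof (rule nonincreasing_on_halfline[where g = ?g and
        g' = "\<lambda>s. exp (- (2 * L * s)) * (2 * inner (f s) (f' s) - 2 * L * inner (f s) (f s))"])
    fix s :: real assume s: "0 \<le> s"
    show "(?g has_real_derivative exp (- (2 * L * s)) * (2 * inner (f s) (f' s) - 2 * L * inner (f s) (f s))) (at s within {0..})"
      by (rule derivative_eq_intros has_real_derivative_inner_self[OF f[OF s]] refl)+ (simp add: algebra_simps)
  next
    fix s :: real assume s: "0 < s"
    have "inner (f s) (f' s) \<le> norm (f s) * norm (f' s)" by (rule norm_cauchy_schwarz)
    also have "\<dots> \<le> norm (f s) * (L * norm (f s))" using bound[of s] s by (intro mult_left_mono) auto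
    also have "\<dots> = L * inner (f s) (f s)" by (simp add: power2_norm_eq_inner[symmetric] power2_eq_square)
    finally show "exp (- (2 * L * s)) * (2 * inner (f s) (f' s) - 2 * L * inner (f s) (f s)) \<le> 0"
      by (simp add: mult_le_0_iff)
  qed (use assms in auto)
  then have "inner (f t) (f t) \<le> 0" using assms by (simp add: mult_le_0_iff)
  then have "inner (f t) (f t) = 0" by (intro antisym) auto
  then show ?thesis by simp
qed

text \<open>A continuous function whose left difference quotients are asymptotically nonpositive is
  nonincreasing: otherwise consider the first time at which, after a linear correction, a higher
  value is reached.\<close>

lemma nonincreasing_if_left_dini:
  fixes g :: "real \<Rightarrow> real"
  assumes cont: "continuous_on {0..} g" and "0 \<le> s" "s \<le> t"
    and dini: "\<And>t e. 0 < t \<Longrightarrow> 0 < e \<Longrightarrow> \<exists>d>0. \<forall>r. 0 \<le> r \<and> t - d < r \<and> r < t \<longrightarrow> g t - g r \<le> e * (t - r)"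
  shows "g t \<le> g s"
proof (rule ccontr)
  assume "\<not> g t \<le> g s"
  then have "g s < g t" and st: "s < t" using assms by (cases "s = t"; simp)+
  define e where "e = (g t - g s) / (2 * (t - s))"
  have e: "e > 0" using \<open>g s < g t\<close> st by (simp add: e_def)
  define k where "k x = g x - e * (x - s)" for x
  have "e * (t - s) = (g t - g s) / 2" using st by (simp add: e_def field_simps)
  then have kst: "k s < k t" using \<open>g s < g t\<close> by (simp add: k_def)
  have kcont: "continuous_on {s..t} k" unfolding k_def
    by (intro continuous_intros continuous_on_subset[OF cont]) (use assms in auto)
  define A where "A = {x \<in> {s..t}. k t \<le> k x}"
  have "closed A" unfolding A_def
    by (rule continuous_on_closed_Collect_le[OF continuous_on_const kcont]) simp
  moreover have "A \<noteq> {}" "bdd_below A" using st by (auto simp: A_def intro: bdd_belowI[of _ s])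
  ultimately have inA: "Inf A \<in> A" by (intro closed_contains_Inf) auto
  define u where "u = Inf A"
  have u: "s \<le> u" "u \<le> t" "k t \<le> k u" using inA by (auto simp: A_def u_def)
  then have "s < u" using kst by (cases "u = s") auto
  have before: "k x < k t" if "s \<le> x" "x < u" for x
  proof (rule ccontr)
    assume "\<not> k x < k t"
    then have "x \<in> A" using that u by (simp add: A_def)
    then have "u \<le> x" unfolding u_def using \<open>bdd_below A\<close> by (rule cInf_lower)
    then show False using that by simp
  qed
  from dini[of u "e"] \<open>s < u\<close> \<open>0 \<le> s\<close> e obtain d where d: "d > 0"
    "\<And>r. 0 \<le> r \<Longrightarrow> u - d < r \<Longrightarrow> r < u \<Longrightarrow> g u - g r \<le> e * (u - r)" by force
  define r where "r = max s (u - d / 2)"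
  have r: "s \<le> r" "u - d < r" "r < u" using d(1) \<open>s < u\<close> by (auto simp: r_def)
  then have "g u - g r \<le> e * (u - r)" using d(2)[of r] \<open>0 \<le> s\<close> by simp
  then have "k u \<le> k r" by (simp add: k_def algebra_simps)
  with before[OF r(1,3)] u(3) show False by simp
qed

section \<open>Existence and uniqueness of the flow\<close>

lemma norm_commutator_le:
  fixes A B :: "complex ^ 'n ^ 'n"
  shows "norm (commutator A B) \<le> 2 * norm A * norm B"
proof -
  have "norm (A ** B - B ** A) \<le> norm (A ** B) + norm (B ** A)" by (rule norm_triangle_ineq4)
  also have "\<dots> \<le> norm A * norm B + norm B * norm A" by (intro add_mono norm_matrix_mult)
  finally show ?thesis by (simp add: commutator_def mult_ac)
qed

lemma flow_field_lipschitz_on_ball: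
  assumes "lipschitz_nonneg L f" "lipschitz_nonneg L g" "0 \<le> R"
  obtains K where "0 \<le> K"
    "\<And>A B :: complex ^ 'n ^ 'n. norm A \<le> R \<Longrightarrow> norm B \<le> R \<Longrightarrow>
      norm (commutator (phi_matrix f g A) A - commutator (phi_matrix f g B) B) \<le> K * norm (A - B)"
proof -
  define c where "c = 2 * sqrt 2 * L"
  have c: "0 \<le> c" using assms by (simp add: c_def lipschitz_nonneg_def)
  define M where "M = norm (phi_matrix f g (0 :: complex ^ 'n ^ 'n)) + c * R"
  have M: "0 \<le> M" using c assms by (simp add: M_def)
  show thesis
  proof (rule that[of "2 * c * R + 2 * M"])
    show "0 \<le> 2 * c * R + 2 * M" using c M assms by simp
    fix A B :: "complex ^ 'n ^ 'n" assume A: "norm A \<le> R" and B: "norm B \<le> R"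
    have lip: "norm (phi_matrix f g C - phi_matrix f g D) \<le> c * norm (C - D)" for C D :: "complex ^ 'n ^ 'n"
      using phi_matrix_lipschitz[OF assms(1,2)] by (simp add: c_def)
    have "norm (phi_matrix f g B) \<le> norm (phi_matrix f g (0 :: complex ^ 'n ^ 'n)) + norm (phi_matrix f g B - phi_matrix f g 0)"
      using norm_triangle_sub by blast
    also have "\<dots> \<le> M" unfolding M_def
      using lip[of B 0] mult_left_mono[OF B c] by simp
    finally have pB: "norm (phi_matrix f g B) \<le> M" .
    have "commutator (phi_matrix f g A) A - commutator (phi_matrix f g B) B =
        commutator (phi_matrix f g A - phi_matrix f g B) A + commutator (phi_matrix f g B) (A - B)"
      by (simp add: commutator_def mm_distribs)
    then have "norm (commutator (phi_matrix f g A) A - commutator (phi_matrix f g B) B) \<le>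
        norm (commutator (phi_matrix f g A - phi_matrix f g B) A) + norm (commutator (phi_matrix f g B) (A - B))"
      using norm_triangle_ineq by metis
    also have "\<dots> \<le> 2 * norm (phi_matrix f g A - phi_matrix f g B) * norm A + 2 * norm (phi_matrix f g B) * norm (A - B)"
      by (intro add_mono norm_commutator_le)
    also have "\<dots> \<le> 2 * (c * norm (A - B)) * R + 2 * M * norm (A - B)"
      using lip[of A B] pB A c M by (intro add_mono mult_mono) auto
    also have "\<dots> = (2 * c * R + 2 * M) * norm (A - B)" by (simp add: algebra_simps)
    finally show "norm (commutator (phi_matrix f g A) A - commutator (phi_matrix f g B) B) \<le> (2 * c * R + 2 * M) * norm (A - B)" .
  qed
qed

definition op_norm :: "complex ^ 'n ^ 'n \<Rightarrow> real" where
  "op_norm X = onorm (\<lambda>A :: complex ^ 'n ^ 'n. X ** A)"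

lemma op_norm_bound: "norm (X ** A) \<le> op_norm X * norm A"
  for X A :: "complex ^ 'n ^ 'n"
  unfolding op_norm_def by (rule onorm[OF mmult.bounded_linear_right])

lemma op_norm_le: "op_bounded b X \<Longrightarrow> op_norm X \<le> b" if "0 \<le> b"
  unfolding op_norm_def op_bounded_def using that by (intro onorm_bound) auto

lemma op_norm_nonneg: "0 \<le> op_norm X"
  unfolding op_norm_def by (rule onorm_pos_le[OF mmult.bounded_linear_right])

lemma op_norm_lipschitz: "\<bar>op_norm X - op_norm Y\<bar> \<le> norm (X - Y)"
  for X Y :: "complex ^ 'n ^ 'n"
proof -
  have "op_norm C \<le> op_norm D + norm (C - D)" for C D :: "complex ^ 'n ^ 'n"
    unfolding op_norm_def[of C]
  proof (rule onorm_bound)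
    show "0 \<le> op_norm D + norm (C - D)" by (simp add: op_norm_nonneg)
    fix A :: "complex ^ 'n ^ 'n"
    have "C ** A = D ** A + (C - D) ** A" by (simp add: mm_distribs)
    then have "norm (C ** A) \<le> norm (D ** A) + norm ((C - D) ** A)" by (metis norm_triangle_ineq)
    also have "\<dots> \<le> op_norm D * norm A + norm (C - D) * norm A"
      by (intro add_mono op_norm_bound norm_matrix_mult)
    finally show "norm (C ** A) \<le> (op_norm D + norm (C - D)) * norm A" by (simp add: algebra_simps)
  qed
  from this[of X Y] this[of Y X] show ?thesis by (simp add: norm_minus_commute abs_le_iff)
qed

lemma op_bounded_norm_le:
  "op_bounded b X \<Longrightarrow> norm X \<le> b * norm (mat 1 :: complex ^ 'n ^ 'n)"
  for X :: "complex ^ 'n ^ 'n"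
  unfolding op_bounded_def using matrix_mul_rid[of X] by metis

lemma closest_point_ball_scaled:
  fixes x :: "'a::euclidean_space"
  assumes "0 \<le> R"
  shows "\<exists>\<theta>\<ge>0. closest_point (cball 0 R) x = \<theta> *\<^sub>R x"
proof (cases "norm x \<le> R")
  case True
  then have "closest_point (cball 0 R) x = 1 *\<^sub>R x" by (simp add: closest_point_self)
  then show ?thesis by (metis zero_le_one)
next
  case False
  have "(R / norm x) *\<^sub>R x = closest_point (cball 0 R) x"
  proof (rule closest_point_unique)
    show "(R / norm x) *\<^sub>R x \<in> cball 0 R" using False assms by (cases "x = 0") auto
    show "\<forall>z\<in>cball 0 R. dist x ((R / norm x) *\<^sub>R x) \<le> dist x z"
    proof
      fix z :: 'a assume z: "z \<in> cball 0 R"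
      have "x - (R / norm x) *\<^sub>R x = (1 - R / norm x) *\<^sub>R x" by (simp add: algebra_simps)
      then have "dist x ((R / norm x) *\<^sub>R x) = \<bar>1 - R / norm x\<bar> * norm x" by (simp add: dist_norm)
      also have "\<dots> = norm x - R"
      proof -
        have "0 < norm x" "R \<le> norm x" using False assms by linarith+
        then show ?thesis by (simp add: abs_if field_simps)
      qed
      also have "\<dots> \<le> norm x - norm z" using z by simp
      also have "\<dots> \<le> dist x z" by (simp add: dist_norm norm_triangle_ineq2)
      finally show "dist x ((R / norm x) *\<^sub>R x) \<le> dist x z" .
    qed
  qed auto
  then show ?thesis using assms by (metis divide_nonneg_nonneg norm_ge_zero)
qed

lemma inner_udiag_le:
  fixes A U :: "complex ^ 'n ^ 'n"
  assumes "unitary_matrix U" "\<And>i. d $ i \<le> c" "norm A = 1"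
  shows "inner A (udiag U d ** A) \<le> c"
proof -
  have sp: "spec_in {..c} (udiag U d)" using assms by (intro spec_in_udiag) auto
  from hermitian_fun_upper[OF sp, of "\<lambda>x. x" c A] show ?thesis
    using assms(3) by (simp add: hermitian_fun_id[OF sp] inner_commute)
qed

text \<open>At a top right singular vector the field does not increase the largest singular value:
  $\varphi_1(|X|)$ and $\varphi_2(|X^*|)$ take their maximal values on the top singular vectors.\<close>

lemma top_singular_value_decreases:
  fixes X :: "complex ^ 'n ^ 'n"
  assumes mono: "mono_on {0..} f" "mono_on {0..} g" and \<theta>: "0 \<le> \<theta>"
  obtains y :: "complex ^ 'n ^ 'n" where "norm y = 1" "norm (X ** y) = op_norm X"
    "inner (X ** y) (commutator (phi_matrix f g (\<theta> *\<^sub>R X)) (\<theta> *\<^sub>R X) ** y) \<le> 0"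
proof -
  obtain E U s where X: "unitary_matrix E" "unitary_matrix U" "\<And>i. 0 \<le> s $ i"
    "X = E ** real_diag s ** cadjoint U" by (rule singular_value_decomposition[of X]) blast
  obtain i where i: "\<And>j. s $ j \<le> s $ i"
  proof -
    have "finite (range (($) s))" "range (($) s) \<noteq> {}" by auto
    from Max_in[OF this] obtain i where "s $ i = Max (range (($) s))" by (metis imageE)
    then have "s $ j \<le> s $ i" for j by simp
    then show thesis by (rule that)
  qed
  define J :: "complex ^ 'n ^ 'n" where "J = unit_diag i"
  define y where "y = U ** J"
  have ny: "norm y = 1" "norm (E ** J) = 1" by (simp_all add: y_def J_def norm_unitary_mult X)
  have DJ: "real_diag d ** J = d $ i *\<^sub>R J" for d unfolding J_def by (rule real_diag_unit_diag)
  have Uy: "udiag U d ** y = d $ i *\<^sub>R y" "udiag E d ** (E ** J) = d $ i *\<^sub>R (E ** J)" for d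
    by (simp_all add: udiag_def y_def matrix_mul_assoc[symmetric] unitary_cancel X DJ mm_distribs(9,10))
  have Xy: "X ** y = s $ i *\<^sub>R (E ** J)"
    by (simp add: X(4) y_def matrix_mul_assoc[symmetric] unitary_cancel X(2) DJ mm_distribs(9,10))
  have "op_bounded (s $ i) X" using op_bounded_svd[OF X X(3)] i by blast
  then have "op_norm X \<le> s $ i" by (rule op_norm_le[OF X(3)])
  moreover have "s $ i \<le> op_norm X" using op_norm_bound[of X y] by (simp add: Xy ny X(3))
  ultimately have top: "norm (X ** y) = op_norm X" by (simp add: Xy ny X(3))
  have \<theta>X: "\<theta> *\<^sub>R X = E ** real_diag (\<chi> j. \<theta> * s $ j) ** cadjoint U"
    unfolding real_diag_simps(4)[symmetric] X(4) by (simp add: mm_distribs)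
  have nn: "0 \<le> (\<chi> j. \<theta> * s $ j) $ j" for j using \<theta> X(3) by simp
  define H1 where "H1 = udiag U (\<chi> j. f (\<theta> * s $ j))"
  define H2 where "H2 = udiag E (\<chi> j. g (\<theta> * s $ j))"
  have phi: "phi_matrix f g (\<theta> *\<^sub>R X) = H1 - H2"
    unfolding phi_matrix_def matrix_abs_svd[OF X(1,2) nn \<theta>X] H1_def H2_def
    by (simp add: hermitian_fun_udiag X)
  have le: "\<theta> * s $ j \<le> \<theta> * s $ i" for j using \<theta> i by (simp add: mult_left_mono)
  have f: "f (\<theta> * s $ j) \<le> f (\<theta> * s $ i)" and g: "g (\<theta> * s $ j) \<le> g (\<theta> * s $ i)" for j
    using mono_onD[OF mono(1), of "\<theta> * s $ j" "\<theta> * s $ i"] mono_onD[OF mono(2), of "\<theta> * s $ j" "\<theta> * s $ i"] le[of j] \<theta> X(3) by simp_all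
  have 1: "inner (X ** y) (H1 ** (X ** y)) \<le> (s $ i)\<^sup>2 * f (\<theta> * s $ i)"
  proof -
    have "inner (E ** J) (H1 ** (E ** J)) \<le> f (\<theta> * s $ i)"
      unfolding H1_def using f by (intro inner_udiag_le X ny) auto
    then have "(s $ i)\<^sup>2 * inner (E ** J) (H1 ** (E ** J)) \<le> (s $ i)\<^sup>2 * f (\<theta> * s $ i)"
      by (rule mult_left_mono) simp
    then show ?thesis by (simp add: Xy mm_distribs(9,10) power2_eq_square mult.assoc)
  qed
  have 2: "inner (X ** y) (H2 ** (X ** y)) = (s $ i)\<^sup>2 * g (\<theta> * s $ i)"
    by (simp add: Xy mm_distribs(9,10) H2_def Uy power2_eq_square)
      (simp add: dot_square_norm ny)
  have 3: "inner (X ** y) (X ** (H1 ** y)) = (s $ i)\<^sup>2 * f (\<theta> * s $ i)"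
    by (simp add: H1_def Uy mm_distribs(9,10) Xy power2_eq_square)
      (simp add: dot_square_norm ny)
  have 4: "inner (X ** y) (X ** (H2 ** y)) \<le> (s $ i)\<^sup>2 * g (\<theta> * s $ i)"
  proof -
    have "inner (X ** y) (X ** (H2 ** y)) = inner (cadjoint X ** X ** y) (H2 ** y)"
      using inner_mult_left[of X "H2 ** y" "X ** y"] by (simp add: inner_commute matrix_mul_assoc)
    also have "cadjoint X ** X ** y = (s $ i)\<^sup>2 *\<^sub>R y"
      unfolding gram_svd(1)[OF X(1,2,4)] Uy by simp
    finally have "inner (X ** y) (X ** (H2 ** y)) = (s $ i)\<^sup>2 * inner y (H2 ** y)" by simp
    moreover have "inner y (H2 ** y) \<le> g (\<theta> * s $ i)"
      unfolding H2_def using g by (intro inner_udiag_le X ny) auto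
    then have "(s $ i)\<^sup>2 * inner y (H2 ** y) \<le> (s $ i)\<^sup>2 * g (\<theta> * s $ i)"
      by (rule mult_left_mono) simp
    ultimately show ?thesis by simp
  qed
  have "commutator (phi_matrix f g (\<theta> *\<^sub>R X)) (\<theta> *\<^sub>R X) ** y =
      \<theta> *\<^sub>R (H1 ** (X ** y) - H2 ** (X ** y) - X ** (H1 ** y) + X ** (H2 ** y))"
    unfolding phi commutator_def by (simp add: mm_distribs algebra_simps)
  then have "inner (X ** y) (commutator (phi_matrix f g (\<theta> *\<^sub>R X)) (\<theta> *\<^sub>R X) ** y) =
      \<theta> * (inner (X ** y) (H1 ** (X ** y)) - inner (X ** y) (H2 ** (X ** y)) - inner (X ** y) (X ** (H1 ** y)) + inner (X ** y) (X ** (H2 ** y)))"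
    by (simp add: inner_diff_right inner_add_right)
  also have "\<dots> \<le> 0"
    using 1 2 3 4 \<theta> by (intro mult_nonneg_nonpos) auto
  finally show thesis using that[OF ny(1) top] by blast
qed

text \<open>The field is Lipschitz on balls only, so it is composed with the nearest-point projection onto a ball, which
  makes it globally Lipschitz. The projection scales its argument, and the largest singular value still does
  not increase (\<open>top_singular_value_decreases\<close> has the factor $\theta$ for this purpose). Hence the solution
  stays inside the ball, where the projection is the identity.\<close>

theorem flow_exists:
  fixes T :: "complex ^ 'n ^ 'n"
  assumes mono: "mono_on {0..} f" "mono_on {0..} g"
    and lip: "lipschitz_nonneg L f" "lipschitz_nonneg L g"
    and "0 \<le> b" "op_bounded b T"
  obtains X where "X 0 = T" "\<And>t. 0 \<le> t \<Longrightarrow> op_bounded b (X t)"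
    "\<And>t. 0 \<le> t \<Longrightarrow> (X has_vector_derivative commutator (phi_matrix f g (X t)) (X t)) (at t within {0..})"
proof -
  define R where "R = b * norm (mat 1 :: complex ^ 'n ^ 'n)"
  have R: "0 \<le> R" using assms by (simp add: R_def)
  define cp where "cp = closest_point (cball (0 :: complex ^ 'n ^ 'n) R)"
  define V where "V A = commutator (phi_matrix f g (cp A)) (cp A)" for A
  obtain K where K: "0 \<le> K" "\<And>A B :: complex ^ 'n ^ 'n. norm A \<le> R \<Longrightarrow> norm B \<le> R \<Longrightarrow>
      norm (commutator (phi_matrix f g A) A - commutator (phi_matrix f g B) B) \<le> K * norm (A - B)"
    using flow_field_lipschitz_on_ball[OF lip R] by blast
  have cp_in: "norm (cp A) \<le> R" for A
    using closest_point_in_set[of "cball 0 R" A] R by (simp add: cp_def)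
  have cp_lip: "norm (cp A - cp B) \<le> norm (A - B)" for A B
    using closest_point_lipschitz[of "cball 0 R" A B] R by (simp add: cp_def dist_norm)
  have "norm (V A - V B) \<le> K * norm (A - B)" for A B
    using K(2)[OF cp_in cp_in, of A B] mult_left_mono[OF cp_lip[of A B] K(1)] unfolding V_def by linarith
  from global_solution_exists[OF K(1) this, of T] obtain X where X: "X 0 = T"
    "\<And>t. t \<ge> 0 \<Longrightarrow> (X has_vector_derivative V (X t)) (at t within {0..})" by blast
  have Xcont: "continuous_on {0..} X"
    unfolding continuous_on_eq_continuous_within using X(2) by (auto intro: has_vector_derivative_continuous)
  define G where "G t = (op_norm (X t))\<^sup>2" for t
  have Gcont: "continuous_on {0..} G"
  proof -
    have "1-lipschitz_on UNIV (op_norm :: complex ^ 'n ^ 'n \<Rightarrow> real)"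
      by (intro lipschitz_onI) (auto simp: dist_norm op_norm_lipschitz)
    then have "continuous_on UNIV (op_norm :: complex ^ 'n ^ 'n \<Rightarrow> real)" by (rule lipschitz_on_continuous_on)
    then have "continuous_on {0..} (\<lambda>t. op_norm (X t))"
      by (rule continuous_on_compose2[OF _ Xcont]) simp
    then show ?thesis unfolding G_def by (intro continuous_intros)
  qed
  have dini: "\<exists>d>0. \<forall>r. 0 \<le> r \<and> t - d < r \<and> r < t \<longrightarrow> G t - G r \<le> e * (t - r)" if "0 < t" "0 < e" for t e
  proof -
    obtain \<theta> where \<theta>: "0 \<le> \<theta>" "cp (X t) = \<theta> *\<^sub>R X t"
      using closest_point_ball_scaled[OF R, of "X t"] by (auto simp: cp_def)
    obtain y :: "complex ^ 'n ^ 'n" where y: "norm y = 1" "norm (X t ** y) = op_norm (X t)"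
      "inner (X t ** y) (commutator (phi_matrix f g (\<theta> *\<^sub>R X t)) (\<theta> *\<^sub>R X t) ** y) \<le> 0"
      using top_singular_value_decreases[OF mono \<theta>(1), of "X t"] by blast
    define h where "h r = inner (X r ** y) (X r ** y)" for r
    define D where "D = 2 * inner (X t ** y) (V (X t) ** y)"
    have D: "D \<le> 0" using y(3) by (simp add: D_def V_def \<theta>)
    have "((\<lambda>r. X r ** y) has_vector_derivative V (X t) ** y) (at t within {0..})"
      using X(2)[of t] \<open>0 < t\<close> by (intro bounded_linear.has_vector_derivative[OF mmult.bounded_linear_left]) auto
    then have "(h has_real_derivative D) (at t within {0..})"
      unfolding h_def D_def by (rule has_real_derivative_inner_self)
    then have "(h has_derivative (*) D) (at t within {0..})" by (simp add: has_field_derivative_def)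
    then obtain d where d: "d > 0" "\<And>r. r \<ge> 0 \<Longrightarrow> norm (r - t) < d \<Longrightarrow> norm (h r - h t - D * (r - t)) \<le> e * norm (r - t)"
      using \<open>0 < e\<close> unfolding has_derivative_within_alt by (metis atLeast_iff)
    have "G t - G r \<le> e * (t - r)" if "0 \<le> r" "t - d < r" "r < t" for r
    proof -
      have "h r \<le> G r"
        using op_norm_bound[of "X r" y] y(1) by (simp add: h_def G_def power2_norm_eq_inner[symmetric] power_mono)
      moreover have "G t = h t" using y(2) by (simp add: h_def G_def power2_norm_eq_inner[symmetric])
      moreover have "\<bar>h r - h t - D * (r - t)\<bar> \<le> e * (t - r)"
        using d(2)[of r] that by simp
      moreover have "0 \<le> D * (r - t)" using D that by (intro mult_nonpos_nonpos) auto
      ultimately show ?thesis by linarith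
    qed
    then show ?thesis using d(1) by blast
  qed
  have bounded: "op_bounded b (X t)" if "0 \<le> t" for t
  proof -
    have "G t \<le> G 0" by (rule nonincreasing_if_left_dini[OF Gcont _ that dini]) auto
    then have "op_norm (X t) \<le> op_norm T"
      unfolding G_def X(1) using op_norm_nonneg by (rule power2_le_imp_le)
    also have "\<dots> \<le> b" by (rule op_norm_le[OF assms(5,6)])
    finally show ?thesis
      unfolding op_bounded_def using op_norm_bound by (meson mult_right_mono norm_ge_zero order_trans)
  qed
  show thesis
  proof (rule that[of X])
    fix t :: real assume t: "0 \<le> t"
    have "norm (X t) \<le> R" using op_bounded_norm_le[OF bounded[OF t]] by (simp add: R_def)
    then have "V (X t) = commutator (phi_matrix f g (X t)) (X t)"
      by (simp add: V_def cp_def closest_point_self)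
    then show "(X has_vector_derivative commutator (phi_matrix f g (X t)) (X t)) (at t within {0..})"
      using X(2)[OF t] by simp
  qed (use X bounded in auto)
qed

theorem flow_unique:
  fixes X Y :: "real \<Rightarrow> complex ^ 'n ^ 'n"
  assumes lip: "lipschitz_nonneg L f" "lipschitz_nonneg L g" and "0 \<le> b"
    and X: "\<And>t. 0 \<le> t \<Longrightarrow> op_bounded b (X t)"
      "\<And>t. 0 \<le> t \<Longrightarrow> (X has_vector_derivative commutator (phi_matrix f g (X t)) (X t)) (at t within {0..})"
    and Y: "\<And>t. 0 \<le> t \<Longrightarrow> op_bounded b (Y t)"
      "\<And>t. 0 \<le> t \<Longrightarrow> (Y has_vector_derivative commutator (phi_matrix f g (Y t)) (Y t)) (at t within {0..})"
    and "X 0 = Y 0" "0 \<le> t"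
  shows "X t = Y t"
proof -
  define R where "R = b * norm (mat 1 :: complex ^ 'n ^ 'n)"
  have R: "0 \<le> R" using assms by (simp add: R_def)
  obtain K where K: "0 \<le> K" "\<And>A B :: complex ^ 'n ^ 'n. norm A \<le> R \<Longrightarrow> norm B \<le> R \<Longrightarrow>
      norm (commutator (phi_matrix f g A) A - commutator (phi_matrix f g B) B) \<le> K * norm (A - B)"
    using flow_field_lipschitz_on_ball[OF lip R] by blast
  have "X t - Y t = 0"
  proof (rule gronwall_zero[where f = "\<lambda>t. X t - Y t" and L = K])
    fix s :: real assume s: "0 \<le> s"
    show "((\<lambda>t. X t - Y t) has_vector_derivative
        commutator (phi_matrix f g (X s)) (X s) - commutator (phi_matrix f g (Y s)) (Y s)) (at s within {0..})"
      by (intro has_vector_derivative_diff X(2) Y(2) s)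
    show "norm (commutator (phi_matrix f g (X s)) (X s) - commutator (phi_matrix f g (Y s)) (Y s)) \<le> K * norm (X s - Y s)"
      using op_bounded_norm_le[OF X(1)[OF s]] op_bounded_norm_le[OF Y(1)[OF s]] by (intro K(2)) (auto simp: R_def)
  qed (use assms in auto)
  then show ?thesis by simp
qed

section \<open>Limit points are normal\<close>

text \<open>For $p < q$ the difference of the two sides is
  $\int_p^q (\psi_1(x) - \psi_1(p)) + (\psi_2(q) - \psi_2(x))\,dx$.\<close>

lemma scalar_klein_inequality:
  fixes \<psi>1 \<psi>2 :: "real \<Rightarrow> real"
  assumes mono: "mono_on {0..B} \<psi>1" "mono_on {0..B} \<psi>2"
    and cont: "continuous_on {0..B} \<psi>1" "continuous_on {0..B} \<psi>2"
    and strict: "strict_mono_on {0..B} (\<lambda>x. \<psi>1 x + \<psi>2 x)"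
  obtains \<Theta> where
    "\<And>p q. p \<in> {0..B} \<Longrightarrow> q \<in> {0..B} \<Longrightarrow> \<Theta> p - \<Theta> q \<le> \<psi>1 p * (p - q) + \<psi>2 q * (q - p)"
    "\<And>p q. p \<in> {0..B} \<Longrightarrow> q \<in> {0..B} \<Longrightarrow> \<psi>1 p * (p - q) + \<psi>2 q * (q - p) = \<Theta> p - \<Theta> q \<Longrightarrow> p = q"
proof -
  define \<Theta> where "\<Theta> x = integral {0..x} (\<lambda>x. \<psi>1 x - \<psi>2 x)" for x
  have int: "(\<lambda>x. \<psi>1 x - \<psi>2 x) integrable_on {a..c}" if "0 \<le> a" "c \<le> B" for a c
    using that by (intro integrable_continuous_real continuous_intros continuous_on_subset[OF cont(1)] continuous_on_subset[OF cont(2)]) auto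
  have diff: "\<Theta> q - \<Theta> p = integral {p..q} (\<lambda>x. \<psi>1 x - \<psi>2 x)" if "0 \<le> p" "p \<le> q" "q \<le> B" for p q
    unfolding \<Theta>_def using Henstock_Kurzweil_Integration.integral_combine[OF that(1,2) int[OF order_refl that(3)]] by simp
  have sgn: "0 \<le> \<sigma> * (c * (q - p) + (\<Theta> q - \<Theta> p)) \<and> (\<sigma> * (c * (q - p) + (\<Theta> q - \<Theta> p)) = 0 \<longrightarrow> c + (\<psi>1 p - \<psi>2 p) = 0 \<and> c + (\<psi>1 q - \<psi>2 q) = 0)"
    if pq: "0 \<le> p" "p < q" "q \<le> B" and "\<sigma> = 1 \<or> \<sigma> = -1"
      and nonneg: "\<And>x. x \<in> {p..q} \<Longrightarrow> 0 \<le> \<sigma> * (c + (\<psi>1 x - \<psi>2 x))" for p q c \<sigma>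
  proof -
    let ?h = "\<lambda>x. \<sigma> * (c + (\<psi>1 x - \<psi>2 x))"
    have hc: "continuous_on {p..q} ?h"
      using pq by (intro continuous_intros continuous_on_subset[OF cont(1)] continuous_on_subset[OF cont(2)]) auto
    have "integral {p..q} ?h = \<sigma> * (integral {p..q} (\<lambda>x. c) + integral {p..q} (\<lambda>x. \<psi>1 x - \<psi>2 x))"
      using int[of p q] pq by (simp add: integral_add[OF integrable_const_ivl] mult.commute)
    also have "\<dots> = \<sigma> * (c * (q - p) + (\<Theta> q - \<Theta> p))" using pq by (simp add: diff)
    finally have eq: "integral {p..q} ?h = \<sigma> * (c * (q - p) + (\<Theta> q - \<Theta> p))" .
    have "0 \<le> integral {p..q} ?h" by (rule integral_nonneg[OF integrable_continuous_real[OF hc] nonneg])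
    moreover have "integral {p..q} ?h = 0 \<Longrightarrow> ?h p = 0 \<and> ?h q = 0"
      using integral_eq_0_iff[OF hc pq(2) nonneg] pq(2) by auto
    ultimately show ?thesis unfolding eq using \<open>\<sigma> = 1 \<or> \<sigma> = -1\<close> by auto
  qed
  have main: "\<Theta> p - \<Theta> q \<le> \<psi>1 p * (p - q) + \<psi>2 q * (q - p) \<and>
      (\<psi>1 p * (p - q) + \<psi>2 q * (q - p) = \<Theta> p - \<Theta> q \<longrightarrow> p = q)"
    if pq: "p \<in> {0..B}" "q \<in> {0..B}" for p q
  proof (cases p q rule: linorder_cases)
    case less
    have "0 \<le> 1 * ((\<psi>2 q - \<psi>1 p) + (\<psi>1 x - \<psi>2 x))" if "x \<in> {p..q}" for x
      using mono_onD[OF mono(1), of p x] mono_onD[OF mono(2), of x q] that pq by simp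
    from sgn[OF _ less _ _ this] pq
    have s: "0 \<le> (\<psi>2 q - \<psi>1 p) * (q - p) + (\<Theta> q - \<Theta> p)"
      "(\<psi>2 q - \<psi>1 p) * (q - p) + (\<Theta> q - \<Theta> p) = 0 \<longrightarrow> \<psi>2 q - \<psi>2 p = 0 \<and> \<psi>1 q - \<psi>1 p = 0"
      by auto
    have "\<psi>1 p + \<psi>2 p < \<psi>1 q + \<psi>2 q" using strict_mono_onD[OF strict pq less] .
    with s show ?thesis by (auto simp: algebra_simps)
  next
    case greater
    have "0 \<le> -1 * ((\<psi>2 q - \<psi>1 p) + (\<psi>1 x - \<psi>2 x))" if "x \<in> {q..p}" for x
      using mono_onD[OF mono(1), of x p] mono_onD[OF mono(2), of q x] that pq by simp
    from sgn[OF _ greater _ _ this] pq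
    have s: "0 \<le> - ((\<psi>2 q - \<psi>1 p) * (p - q) + (\<Theta> p - \<Theta> q))"
      "(\<psi>2 q - \<psi>1 p) * (p - q) + (\<Theta> p - \<Theta> q) = 0 \<longrightarrow> \<psi>1 q - \<psi>1 p = 0 \<and> \<psi>2 q - \<psi>2 p = 0"
      by auto
    have "\<psi>1 q + \<psi>2 q < \<psi>1 p + \<psi>2 p" using strict_mono_onD[OF strict pq(2,1) greater] .
    with s show ?thesis by (auto simp: algebra_simps)
  qed simp
  show thesis by (rule that[of \<Theta>]) (use main in blast)+
qed

lemma inner_udiag_one:
  fixes U :: "complex ^ 'n ^ 'n"
  assumes "unitary_matrix U"
  shows "inner (udiag U d) (mat 1) = (\<Sum>i\<in>UNIV. d $ i)"
proof -
  have "inner (udiag U d) (mat 1) = inner (U ** real_diag d) (mat 1 ** U)"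
    unfolding udiag_def inner_mult_right by simp
  also have "\<dots> = inner (real_diag d) (cadjoint U ** (mat 1 ** U))" by (rule inner_mult_left)
  finally show ?thesis by (simp add: unitaryD[OF assms] inner_real_diag) (simp add: mat_def)
qed

definition dissipation :: "(real \<Rightarrow> real) \<Rightarrow> (real \<Rightarrow> real) \<Rightarrow> complex ^ 'n ^ 'n \<Rightarrow> real" where
  "dissipation f g X = inner (phi_matrix f g X) (cadjoint X ** X - X ** cadjoint X)"

text \<open>The spectral decompositions of $X^*X$ and $XX^*$ have the same eigenvalues, so the weights
  $|\langle u_i, e_j\rangle|^2$ are doubly stochastic and the potential $\Theta$ of the scalar inequality cancels.\<close>

lemma dissipation_nonneg:
  fixes X :: "complex ^ 'n ^ 'n"
  assumes mono: "mono_on {0..b} f" "mono_on {0..b} g"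
    and cont: "continuous_on {0..b} f" "continuous_on {0..b} g"
    and strict: "strict_mono_on {0..b} (\<lambda>x. f x + g x)"
    and "0 \<le> b" "op_bounded b X"
  shows "0 \<le> dissipation f g X" and "dissipation f g X = 0 \<Longrightarrow> normal_matrix X"
proof -
  obtain E U s where X: "unitary_matrix E" "unitary_matrix U" "\<And>i. 0 \<le> s $ i"
    "X = E ** real_diag s ** cadjoint U" by (rule singular_value_decomposition[of X]) blast
  have sb: "s $ i \<le> b" for i using op_bounded_svd[OF X \<open>0 \<le> b\<close>] assms by blast
  let ?\<psi>1 = "\<lambda>x. f (sqrt x)" and ?\<psi>2 = "\<lambda>x. g (sqrt x)"
  have sq: "sqrt x \<in> {0..b}" if "x \<in> {0..b\<^sup>2}" for x
    using that real_sqrt_le_mono[of x "b\<^sup>2"] \<open>0 \<le> b\<close> by (simp add: real_sqrt_abs)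
  obtain \<Theta> where \<Theta>: "\<And>p q. p \<in> {0..b\<^sup>2} \<Longrightarrow> q \<in> {0..b\<^sup>2} \<Longrightarrow> \<Theta> p - \<Theta> q \<le> ?\<psi>1 p * (p - q) + ?\<psi>2 q * (q - p)"
    "\<And>p q. p \<in> {0..b\<^sup>2} \<Longrightarrow> q \<in> {0..b\<^sup>2} \<Longrightarrow> ?\<psi>1 p * (p - q) + ?\<psi>2 q * (q - p) = \<Theta> p - \<Theta> q \<Longrightarrow> p = q"
  proof (rule scalar_klein_inequality[of "b\<^sup>2" ?\<psi>1 ?\<psi>2])
    show "mono_on {0..b\<^sup>2} ?\<psi>1"
      by (intro mono_onI mono_onD[OF mono(1)] sq) (auto intro: real_sqrt_le_mono)
    show "mono_on {0..b\<^sup>2} ?\<psi>2"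
      by (intro mono_onI mono_onD[OF mono(2)] sq) (auto intro: real_sqrt_le_mono)
    show "strict_mono_on {0..b\<^sup>2} (\<lambda>x. ?\<psi>1 x + ?\<psi>2 x)"
    proof (rule strict_mono_onI)
      fix x y assume "x \<in> {0..b\<^sup>2}" "y \<in> {0..b\<^sup>2}" "x < y"
      then show "?\<psi>1 x + ?\<psi>2 x < ?\<psi>1 y + ?\<psi>2 y"
        using strict_mono_onD[OF strict sq sq, of x y] by simp
    qed
    show "continuous_on {0..b\<^sup>2} ?\<psi>1" "continuous_on {0..b\<^sup>2} ?\<psi>2"
      by (rule continuous_on_compose2[OF cont(1), of _ sqrt] continuous_on_compose2[OF cont(2), of _ sqrt];
          use sq in \<open>auto intro!: continuous_intros\<close>)+
  qed blast
  define p where "p i = (s $ i)\<^sup>2" for i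
  have pin: "p i \<in> {0..b\<^sup>2}" for i using sb X(3) by (auto simp: p_def intro: power_mono)
  have sp: "?\<psi>1 (p i) = f (s $ i)" "?\<psi>2 (p i) = g (s $ i)" for i using X(3) by (simp_all add: p_def)
  define w where "w i j = (cmod ((cadjoint U ** E) $ i $ j))\<^sup>2" for i j
  have iw: "inner (udiag U d) (udiag E e) = (\<Sum>i\<in>UNIV. \<Sum>j\<in>UNIV. d $ i * (e $ j * w i j))" for d e
    unfolding inner_udiag w_def ..
  have U1: "udiag U (\<chi> i. 1) = mat 1" and E1: "udiag E (\<chi> i. 1) = mat 1"
    using udiag_const[OF X(2), of 1] udiag_const[OF X(1), of 1] by simp_all
  have UU: "inner (udiag U d) (udiag U e) = (\<Sum>i\<in>UNIV. \<Sum>j\<in>UNIV. d $ i * e $ i * w i j)" for d e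
  proof -
    have "inner (udiag U d) (udiag U e) = inner (udiag U d ** udiag U e) (mat 1)"
      unfolding inner_mult_right by simp
    also have "\<dots> = inner (udiag U (\<chi> i. d $ i * e $ i)) (udiag E (\<chi> i. 1))"
      by (simp add: udiag_simps X E1)
    finally show ?thesis unfolding iw by simp
  qed
  have EE: "inner (udiag E d) (udiag E e) = (\<Sum>i\<in>UNIV. \<Sum>j\<in>UNIV. d $ j * e $ j * w i j)" for d e
  proof -
    have "inner (udiag E d) (udiag E e) = inner (mat 1) (udiag E d ** udiag E e)"
      using inner_mult_right[of "udiag E e" "udiag E d" "mat 1"] 
      by (simp add: inner_mult_right[of "udiag E d" "udiag E e" "mat 1"] inner_commute[of "mat 1"])
    also have "\<dots> = inner (udiag U (\<chi> i. 1)) (udiag E (\<chi> i. d $ i * e $ i))"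
      by (simp add: udiag_simps X U1)
    finally show ?thesis unfolding iw by simp
  qed
  have potential: "(\<Sum>i\<in>UNIV. \<Sum>j\<in>UNIV. (\<Theta> (p i) - \<Theta> (p j)) * w i j) = 0"
  proof -
    have "inner (udiag U (\<chi> i. \<Theta> (p i))) (udiag E (\<chi> i. 1)) = inner (udiag U (\<chi> i. 1)) (udiag E (\<chi> i. \<Theta> (p i)))"
      unfolding U1 E1 by (simp add: inner_udiag_one X inner_commute[of "mat 1"])
    then show ?thesis unfolding iw by (simp add: left_diff_distrib sum_subtractf)
  qed
  define \<tau> where "\<tau> i j = (?\<psi>1 (p i) * (p i - p j) + ?\<psi>2 (p j) * (p j - p i)) - (\<Theta> (p i) - \<Theta> (p j))" for i j
  have gram: "cadjoint X ** X = udiag U (\<chi> i. p i)" "X ** cadjoint X = udiag E (\<chi> i. p i)"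
    unfolding p_def using gram_svd[OF X(1,2,4)] by simp_all
  have phi: "phi_matrix f g X = udiag U (\<chi> i. f (s $ i)) - udiag E (\<chi> i. g (s $ i))"
    unfolding phi_matrix_def matrix_abs_svd[OF X] by (simp add: hermitian_fun_udiag X)
  have "dissipation f g X = (\<Sum>i\<in>UNIV. \<Sum>j\<in>UNIV. (?\<psi>1 (p i) * (p i - p j) + ?\<psi>2 (p j) * (p j - p i)) * w i j)"
    unfolding dissipation_def phi gram inner_diff_left inner_diff_right UU EE iw
      inner_commute[of "udiag E (\<chi> i. g (s $ i))" "udiag U (\<chi> i. p i)"] sp
      sum_subtractf[symmetric]
    by (intro sum.cong refl) (simp add: algebra_simps)
  also have "\<dots> = (\<Sum>i\<in>UNIV. \<Sum>j\<in>UNIV. \<tau> i j * w i j) + (\<Sum>i\<in>UNIV. \<Sum>j\<in>UNIV. (\<Theta> (p i) - \<Theta> (p j)) * w i j)"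
    unfolding sum.distrib[symmetric] by (intro sum.cong refl) (simp add: \<tau>_def algebra_simps)
  finally have D: "dissipation f g X = (\<Sum>i\<in>UNIV. \<Sum>j\<in>UNIV. \<tau> i j * w i j)" unfolding potential by simp
  have nn: "0 \<le> \<tau> i j * w i j" for i j
    using \<Theta>(1)[OF pin pin, of i j] by (simp add: \<tau>_def w_def)
  show "0 \<le> dissipation f g X" unfolding D by (intro sum_nonneg nn)
  show "normal_matrix X" if "dissipation f g X = 0"
  proof -
    have "\<tau> i j * w i j = 0" for i j
    proof -
      have "(\<Sum>i\<in>UNIV. \<Sum>j\<in>UNIV. \<tau> i j * w i j) = 0" using that D by simp
      then have "\<forall>i\<in>UNIV. (\<Sum>j\<in>UNIV. \<tau> i j * w i j) = 0"
        by (subst (asm) sum_nonneg_eq_0_iff) (auto intro: sum_nonneg nn)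
      then show ?thesis by (subst (asm) sum_nonneg_eq_0_iff) (auto intro: nn)
    qed
    then have "p i = p j \<or> (cadjoint U ** E) $ i $ j = 0" for i j
      using \<Theta>(2)[OF pin pin, of i j] by (fastforce simp: \<tau>_def w_def)
    then have "real_diag (\<chi> i. p i) ** (cadjoint U ** E) = (cadjoint U ** E) ** real_diag (\<chi> i. p i)"
      by (simp add: vec_eq_iff real_diag_mult_component) (metis mult.commute mult_zero_right)
    then have "U ** (real_diag (\<chi> i. p i) ** (cadjoint U ** E)) ** cadjoint E = U ** ((cadjoint U ** E) ** real_diag (\<chi> i. p i)) ** cadjoint E"
      by simp
    then have "udiag U (\<chi> i. p i) = udiag E (\<chi> i. p i)"
      unfolding udiag_def matrix_mul_assoc unitary_cancel(4)[OF X(1)] unitaryD(2)[OF X(2)] by simp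
    then show ?thesis unfolding normal_matrix_def gram .
  qed
qed

lemma continuous_phi_matrix:
  assumes "lipschitz_nonneg L f" "lipschitz_nonneg L g"
  shows "continuous_on UNIV (phi_matrix f g :: complex ^ 'n ^ 'n \<Rightarrow> _)"
proof -
  have "(2 * sqrt 2 * L)-lipschitz_on UNIV (phi_matrix f g :: complex ^ 'n ^ 'n \<Rightarrow> _)"
    using assms by (intro lipschitz_onI) (auto simp: dist_norm phi_matrix_lipschitz lipschitz_nonneg_def)
  then show ?thesis by (rule lipschitz_on_continuous_on)
qed

lemma op_bounded_limit:
  fixes X :: "nat \<Rightarrow> complex ^ 'n ^ 'n"
  assumes "X \<longlonglongrightarrow> N" "\<And>m. op_bounded b (X m)"
  shows "op_bounded b N"
  unfolding op_bounded_def
proof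
  fix A :: "complex ^ 'n ^ 'n"
  have "(\<lambda>m. norm (X m ** A)) \<longlonglongrightarrow> norm (N ** A)"
    by (intro tendsto_intros assms)
  then show "norm (N ** A) \<le> b * norm A"
    by (rule LIMSEQ_le_const2) (use assms(2) in \<open>auto simp: op_bounded_def\<close>)
qed

section \<open>Polynomials in a matrix\<close>

definition poly_matrix :: "complex poly \<Rightarrow> complex ^ 'n ^ 'n \<Rightarrow> complex ^ 'n ^ 'n" where
  "poly_matrix p A = fold_coeffs (\<lambda>a B. mat a + A ** B) p 0"

lemma poly_matrix_0 [simp]: "poly_matrix 0 A = 0"
  by (simp add: poly_matrix_def)

lemma poly_matrix_pCons: "poly_matrix (pCons a p) A = mat a + A ** poly_matrix p A"
proof (cases "a = 0 \<and> p = 0")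
  case True
  then show ?thesis by (simp add: mm_distribs)
next
  case False
  then show ?thesis unfolding poly_matrix_def
    by (cases "p = 0") simp_all
qed

lemma poly_matrix_1 [simp]: "poly_matrix 1 A = mat 1"
  unfolding one_pCons poly_matrix_pCons by (simp add: mm_distribs)

lemma poly_matrix_linear: "poly_matrix [:- \<mu>, 1:] A = A - mat \<mu>"
  unfolding poly_matrix_pCons by (simp add: mm_distribs) (simp add: vec_eq_iff mat_def)

lemma poly_matrix_add: "poly_matrix (p + q) A = poly_matrix p A + poly_matrix q A"
proof (induction p q rule: poly_induct2)
  case (pCons a p b q)
  then show ?case by (simp add: poly_matrix_pCons mat_add mmult.add_right)
qed simp

lemma poly_matrix_smult: "poly_matrix (smult c p) A = mat c ** poly_matrix p A"
proof (induction p)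
  case (pCons a p)
  have "A ** (mat c ** poly_matrix p A) = mat c ** (A ** poly_matrix p A)"
    by (simp only: matrix_mul_assoc mat_commute[of A c])
  then show ?case
    by (simp add: poly_matrix_pCons pCons mmult.add_right mat_mult_mat)
qed (simp add: mmult.zero_right)

lemma poly_matrix_diff: "poly_matrix (p - q) A = poly_matrix p A - poly_matrix q A"
  using poly_matrix_add[of "p - q" q A] by simp

lemma poly_matrix_mult: "poly_matrix (p * q) A = poly_matrix p A ** poly_matrix q A"
proof (induction p)
  case (pCons a p)
  then show ?case
    by (simp add: poly_matrix_pCons poly_matrix_add poly_matrix_smult mmult.add_left matrix_mul_assoc)
qed (simp add: mmult.zero_left)

lemma poly_matrix_dvd: "q dvd p \<Longrightarrow> poly_matrix q A = 0 \<Longrightarrow> poly_matrix p A = 0"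
  by (auto elim!: dvdE simp: poly_matrix_mult mmult.zero_left)

lemma poly_matrix_commute:
  fixes A C :: "complex ^ 'n ^ 'n"
  assumes "C ** A = A ** C"
  shows "C ** poly_matrix p A = poly_matrix p A ** C"
proof (induction p)
  case (pCons a p)
  have "C ** (A ** poly_matrix p A) = A ** (C ** poly_matrix p A)"
    by (simp add: matrix_mul_assoc assms)
  also have "\<dots> = A ** poly_matrix p A ** C" unfolding pCons.IH by (simp add: matrix_mul_assoc)
  finally show ?case
    by (simp add: poly_matrix_pCons mmult.add_left mmult.add_right mat_commute[of C])
qed (simp add: mmult.zero_left mmult.zero_right)

lemma poly_matrix_eigen:
  fixes A B :: "complex ^ 'n ^ 'n"
  assumes "A ** B = mat \<mu> ** B"
  shows "poly_matrix p A ** B = mat (poly p \<mu>) ** B"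
proof (induction p)
  case (pCons a p)
  have "A ** poly_matrix p A ** B = A ** (mat (poly p \<mu>) ** B)"
    by (simp only: matrix_mul_assoc[symmetric] pCons.IH)
  also have "\<dots> = mat (poly p \<mu>) ** (A ** B)"
    by (simp only: matrix_mul_assoc mat_commute[of A])
  also have "\<dots> = mat (\<mu> * poly p \<mu>) ** B"
    unfolding assms by (simp add: matrix_mul_assoc mat_mult_mat mult.commute)
  finally show ?case unfolding poly_matrix_pCons poly_pCons mat_add mmult.add_left by simp
qed (simp add: mmult.zero_left)

lemma continuous_poly_matrix: "continuous_on S (poly_matrix p)"
proof (induction p)
  case (pCons a p)
  then have "continuous_on S (\<lambda>A. mat a + A ** poly_matrix p A)"
    by (intro continuous_intros)
  then show ?case by (simp add: poly_matrix_pCons[abs_def])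
qed (simp add: poly_matrix_def)

lemma tendsto_poly_matrix:
  fixes A :: "complex ^ 'n ^ 'n"
  assumes "X \<longlonglongrightarrow> A"
  shows "(\<lambda>m. poly_matrix p (X m)) \<longlonglongrightarrow> poly_matrix p A"
proof -
  have "isCont (poly_matrix p) A"
    by (rule continuous_on_interior[OF continuous_poly_matrix[of UNIV p]]) simp
  then show ?thesis using assms by (rule isCont_tendsto_compose)
qed

text \<open>$[H, \cdot]$ is a derivation, so polynomials in $X$ evolve by the same Lie bracket: the flow conjugates $X$.\<close>

lemma poly_matrix_has_derivative:
  assumes "(X has_vector_derivative commutator H (X t)) (at t within S)"
  shows "((\<lambda>t. poly_matrix p (X t)) has_vector_derivative commutator H (poly_matrix p (X t))) (at t within S)"
proof (induction p)
  case (pCons a p)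
  have "((\<lambda>t. mat a + X t ** poly_matrix p (X t)) has_vector_derivative
      0 + (X t ** commutator H (poly_matrix p (X t)) + commutator H (X t) ** poly_matrix p (X t))) (at t within S)"
    by (intro has_vector_derivative_add has_vector_derivative_const mmult.has_vector_derivative assms pCons.IH)
  moreover have "0 + (X t ** commutator H (poly_matrix p (X t)) + commutator H (X t) ** poly_matrix p (X t)) =
      commutator H (mat a + X t ** poly_matrix p (X t))"
    unfolding commutator_def by (simp add: mm_distribs mat_commute[of H])
  ultimately show ?case by (simp only: poly_matrix_pCons)
qed (simp add: commutator_def mmult.zero_left mmult.zero_right)

lemma poly_matrix_sum: "finite I \<Longrightarrow> poly_matrix (\<Sum>i\<in>I. p i) A = (\<Sum>i\<in>I. poly_matrix (p i) A)"
  by (induction I rule: finite_induct) (simp_all add: poly_matrix_add)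

text \<open>The powers of $A$ are linearly dependent over the reals. Any annihilating polynomial serves the purpose
  of the characteristic polynomial.\<close>

lemma annihilating_polynomial_exists:
  fixes A :: "complex ^ 'n ^ 'n"
  obtains q where "q \<noteq> 0" "poly_matrix q A = 0"
proof -
  define n where "n = DIM(complex ^ 'n ^ 'n)"
  define e where "e i = poly_matrix (monom 1 i) A" for i
  show thesis
  proof (cases "inj_on e {..n}")
    case False
    then obtain i j where ij: "i \<noteq> j" "e i = e j" unfolding inj_on_def by blast
    have "coeff (monom 1 i - monom 1 j :: complex poly) i \<noteq> 0" using ij(1) by simp
    then have "monom 1 i - monom 1 j \<noteq> (0 :: complex poly)" by (metis coeff_0)
    moreover have "poly_matrix (monom 1 i - monom 1 j) A = 0"
      using ij(2) by (simp add: poly_matrix_diff e_def)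
    ultimately show thesis by (rule that)
  next
    case True
    then have "card (e ` {..n}) = Suc n" by (simp add: card_image)
    then have "dependent (e ` {..n})"
      using independent_bound[of "e ` {..n}"] by (auto simp: n_def)
    then obtain u where u: "\<exists>v\<in>e ` {..n}. u v \<noteq> 0" "(\<Sum>v\<in>e ` {..n}. u v *\<^sub>R v) = 0"
      by (subst (asm) dependent_finite) auto
    define q where "q = (\<Sum>i\<in>{..n}. monom (complex_of_real (u (e i))) i)"
    have "poly_matrix (monom (complex_of_real r) i) A = r *\<^sub>R e i" for r i
    proof -
      have "monom (complex_of_real r) i = smult (complex_of_real r) (monom 1 i)" by (simp add: smult_monom)
      then show ?thesis by (simp add: poly_matrix_smult mat_of_real e_def)
    qed
    then have "poly_matrix q A = (\<Sum>i\<in>{..n}. u (e i) *\<^sub>R e i)"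
      unfolding q_def by (simp add: poly_matrix_sum)
    also have "\<dots> = 0" using u(2) by (simp add: sum.reindex[OF True])
    finally have "poly_matrix q A = 0" .
    moreover have "q \<noteq> 0"
    proof -
      obtain i where i: "i \<le> n" "u (e i) \<noteq> 0" using u(1) by auto
      have "coeff q i = complex_of_real (u (e i))"
        unfolding q_def using i(1) by (simp add: coeff_sum)
      then show ?thesis using i(2) by auto
    qed
    ultimately show thesis by (intro that)
  qed
qed

text \<open>A Bezout identity for $(x - \mu)^m$ and the cofactor gives a polynomial that is idempotent modulo $q$:
  the Riesz projection for $\mu$ is a polynomial in the matrix.\<close>

lemma riesz_polynomial:
  fixes q :: "complex poly"
  assumes "q \<noteq> 0"
  obtains p where "q dvd p * p - p" "[:- \<mu>, 1:] ^ order \<mu> q dvd 1 - p" "q dvd [:- \<mu>, 1:] ^ order \<mu> q * p"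
proof -
  obtain r where r: "q = [:- \<mu>, 1:] ^ order \<mu> q * r" "\<not> [:- \<mu>, 1:] dvd r"
    using order_decomp[OF assms, of \<mu>] by blast
  have "coprime [:- \<mu>, 1:] r"
  proof (rule coprimeI)
    fix c assume c: "c dvd [:- \<mu>, 1:]" "c dvd r"
    then obtain d where d: "[:- \<mu>, 1:] = c * d" unfolding dvd_def by blast
    have nz: "c \<noteq> 0" "d \<noteq> 0" using d by auto
    have "degree c + degree d = 1"
      using degree_mult_eq[OF nz] unfolding d[symmetric] by simp
    then consider "degree c = 0" | "degree d = 0" by linarith
    then show "is_unit c"
    proof cases
      case 1
      then show ?thesis using nz by (simp add: is_unit_iff_degree)
    next
      case 2
      then have "is_unit d" using nz by (simp add: is_unit_iff_degree)
      then have "[:- \<mu>, 1:] dvd c" using d by (simp add: mult_unit_dvd_iff)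
      then show ?thesis using c(2) r(2) dvd_trans by blast
    qed
  qed
  then have "coprime ([:- \<mu>, 1:] ^ order \<mu> q) r" by (simp add: coprime_power_left_iff)
  then obtain x y where xy: "x * [:- \<mu>, 1:] ^ order \<mu> q + y * r = 1"
    using bezout_coefficients_fst_snd[of "[:- \<mu>, 1:] ^ order \<mu> q" r]
    unfolding coprime_iff_gcd_eq_1 by (intro that[of "fst (bezout_coefficients ([:- \<mu>, 1:] ^ order \<mu> q) r)"]) simp
  show thesis
  proof (rule that[of "y * r"])
    have one: "1 - y * r = x * [:- \<mu>, 1:] ^ order \<mu> q" using xy by (simp add: algebra_simps)
    then show "[:- \<mu>, 1:] ^ order \<mu> q dvd 1 - y * r" by simp
    show "q dvd [:- \<mu>, 1:] ^ order \<mu> q * (y * r)"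
      by (subst r(1)) (simp add: mult_dvd_mono)
    have "(y * r) * (y * r) - y * r = - (y * r) * (1 - y * r)" by (simp add: algebra_simps)
    also have "\<dots> = - (y * x) * ([:- \<mu>, 1:] ^ order \<mu> q * r)" unfolding one by (simp add: algebra_simps)
    also have "\<dots> = - (y * x) * q" using r(1) by simp
    finally show "q dvd (y * r) * (y * r) - y * r" by simp
  qed
qed

section \<open>Normal matrices\<close>

lemma normal_diff_mat:
  fixes N :: "complex ^ 'n ^ 'n"
  assumes "normal_matrix N"
  shows "normal_matrix (N - mat \<mu>)"
  using assms unfolding normal_matrix_def cadjoint_diff cadjoint_mat
  by (simp add: mmult.diff_left mmult.diff_right mat_commute[of N] mat_commute[of "cadjoint N"]
      mat_mult_mat mult.commute[of \<mu>])

lemma normal_norm: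
  fixes M B :: "complex ^ 'n ^ 'n"
  assumes "normal_matrix M"
  shows "norm (cadjoint M ** B) = norm (M ** B)"
proof -
  have "inner (cadjoint M ** B) (cadjoint M ** B) = inner B ((M ** cadjoint M) ** B)"
    unfolding inner_mult_left by (simp add: matrix_mul_assoc)
  also have "\<dots> = inner B ((cadjoint M ** M) ** B)" using assms by (simp add: normal_matrix_def)
  also have "\<dots> = inner (M ** B) (M ** B)"
    unfolding inner_mult_left by (simp add: matrix_mul_assoc)
  finally show ?thesis by (simp add: norm_eq_sqrt_inner)
qed

lemma normal_square_kernel:
  fixes M B :: "complex ^ 'n ^ 'n"
  assumes "normal_matrix M" "M ** (M ** B) = 0"
  shows "M ** B = 0"
proof -
  have "cadjoint M ** (M ** B) = 0"
    using normal_norm[OF assms(1), of "M ** B"] assms(2) by simp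
  then have "inner (M ** B) (M ** B) = 0" unfolding inner_mult_left by simp
  then show ?thesis by simp
qed

text \<open>A normal matrix has no nilpotent part: generalised eigenvectors are eigenvectors.\<close>

lemma normal_power_kernel:
  fixes N B :: "complex ^ 'n ^ 'n"
  assumes "normal_matrix N" "poly_matrix ([:- \<mu>, 1:] ^ m) N ** B = 0" "0 < m"
  shows "N ** B = mat \<mu> ** B"
proof -
  define M where "M = N - mat \<mu>"
  have M: "normal_matrix M" unfolding M_def by (rule normal_diff_mat[OF assms(1)])
  have pow: "poly_matrix ([:- \<mu>, 1:] ^ Suc k) N = M ** poly_matrix ([:- \<mu>, 1:] ^ k) N" for k
    by (simp only: power_Suc poly_matrix_mult poly_matrix_linear M_def)
  have "poly_matrix ([:- \<mu>, 1:] ^ Suc k) N ** B = 0 \<Longrightarrow> M ** B = 0" for k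
  proof (induction k)
    case 0
    then show ?case unfolding pow by simp
  next
    case (Suc k)
    then have "M ** (M ** (poly_matrix ([:- \<mu>, 1:] ^ k) N ** B)) = 0"
      unfolding pow by (simp add: matrix_mul_assoc)
    from normal_square_kernel[OF M this] show ?case
      by (intro Suc.IH) (simp only: pow matrix_mul_assoc)
  qed
  from this[of "m - 1"] assms(2,3) have "M ** B = 0" by simp
  then show ?thesis by (simp add: M_def mm_distribs)
qed

lemma normal_poly_matrix:
  assumes "normal_matrix N"
  shows "normal_matrix (poly_matrix p N)"
proof -
  have "cadjoint N ** poly_matrix p N = poly_matrix p N ** cadjoint N"
    using assms by (intro poly_matrix_commute) (simp add: normal_matrix_def)
  then have "cadjoint (cadjoint N ** poly_matrix p N) = cadjoint (poly_matrix p N ** cadjoint N)" by simp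
  then have "cadjoint (poly_matrix p N) ** N = N ** cadjoint (poly_matrix p N)"
    by (simp add: cadjoint_mult)
  then show ?thesis unfolding normal_matrix_def by (rule poly_matrix_commute)
qed

lemma normal_idempotent_hermitian:
  fixes E :: "complex ^ 'n ^ 'n"
  assumes "normal_matrix E" "E ** E = E"
  shows "cadjoint E = E"
proof -
  have "E ** (mat 1 - E) = 0" by (simp add: mm_distribs assms)
  then have "cadjoint E ** (mat 1 - E) = 0"
    using normal_norm[OF assms(1), of "mat 1 - E"] by simp
  then have eq: "cadjoint E = cadjoint E ** E" by (simp add: mm_distribs)
  from arg_cong[OF eq, of cadjoint] have "E = cadjoint E ** E" by (simp add: cadjoint_mult)
  with eq show ?thesis by (rule trans[OF _ sym])
qed

section \<open>Trajectories of the flow\<close>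

locale flow_trajectory =
  fixes f g :: "real \<Rightarrow> real" and L b :: real and X :: "real \<Rightarrow> complex ^ 'n ^ 'n"
  assumes lip: "lipschitz_nonneg L f" "lipschitz_nonneg L g"
    and mono: "mono_on {0..b} f" "mono_on {0..b} g"
    and strict: "strict_mono_on {0..b} (\<lambda>x. f x + g x)"
    and b: "0 < b"
    and bounded: "\<And>t. 0 \<le> t \<Longrightarrow> op_bounded b (X t)"
    and deriv: "\<And>t. 0 \<le> t \<Longrightarrow> (X has_vector_derivative commutator (phi_matrix f g (X t)) (X t)) (at t within {0..})"
begin

definition R where "R = b * norm (mat 1 :: complex ^ 'n ^ 'n)"

lemma norm_X: "0 \<le> t \<Longrightarrow> norm (X t) \<le> R"
  unfolding R_def by (rule op_bounded_norm_le[OF bounded])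

lemma phi_bounded:
  obtains M where "0 < M" "\<And>t. 0 \<le> t \<Longrightarrow> norm (phi_matrix f g (X t)) \<le> M"
proof -
  have "compact (phi_matrix f g ` cball (0 :: complex ^ 'n ^ 'n) R)"
    by (rule compact_continuous_image[OF continuous_on_subset[OF continuous_phi_matrix[OF lip] subset_UNIV] compact_cball])
  then have "bounded (phi_matrix f g ` cball (0 :: complex ^ 'n ^ 'n) R)" by (rule compact_imp_bounded)
  then obtain M where M: "0 < M" "\<forall>Y\<in>phi_matrix f g ` cball (0 :: complex ^ 'n ^ 'n) R. norm Y \<le> M"
    unfolding bounded_pos by blast
  have "norm (phi_matrix f g (X t)) \<le> M" if "0 \<le> t" for t
    using norm_X[OF that] by (intro M(2)[rule_format] imageI) simp
  with M(1) show thesis by (rule that)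
qed

lemma annihilated:
  assumes "poly_matrix q (X 0) = 0" "0 \<le> t"
  shows "poly_matrix q (X t) = 0"
proof -
  obtain M where M: "0 < M" "\<And>t. 0 \<le> t \<Longrightarrow> norm (phi_matrix f g (X t)) \<le> M" by (rule phi_bounded) blast
  show ?thesis
  proof (rule gronwall_zero[where f = "\<lambda>t. poly_matrix q (X t)" and L = "2 * M"])
    fix s :: real assume s: "0 \<le> s"
    show "((\<lambda>t. poly_matrix q (X t)) has_vector_derivative commutator (phi_matrix f g (X s)) (poly_matrix q (X s))) (at s within {0..})"
      by (rule poly_matrix_has_derivative[OF deriv[OF s]])
    have "norm (commutator (phi_matrix f g (X s)) (poly_matrix q (X s))) \<le> 2 * norm (phi_matrix f g (X s)) * norm (poly_matrix q (X s))"
      by (rule norm_commutator_le)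
    also have "\<dots> \<le> 2 * M * norm (poly_matrix q (X s))"
      using M(2)[OF s] by (intro mult_right_mono) auto
    finally show "norm (commutator (phi_matrix f g (X s)) (poly_matrix q (X s))) \<le> 2 * M * norm (poly_matrix q (X s))" .
  qed (use assms in auto)
qed

text \<open>$\|X(t)\|^2$ decreases at the rate given by the dissipation, which stays bounded below for a fixed
  time after each visit to a neighbourhood of a non-normal matrix.\<close>

lemma limit_point_normal:
  assumes s: "filterlim s at_top sequentially" and N: "(\<lambda>m. X (s m)) \<longlonglongrightarrow> N"
  shows "normal_matrix N" "op_bounded b N"
proof -
  have ev: "\<forall>\<^sub>F m in sequentially. c \<le> s m" for c
    using s by (simp add: filterlim_at_top)
  show bN: "op_bounded b N"
    unfolding op_bounded_def
  proof
    fix A :: "complex ^ 'n ^ 'n"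
    have "(\<lambda>m. norm (X (s m) ** A)) \<longlonglongrightarrow> norm (N ** A)"
      by (intro tendsto_intros N)
    moreover have "\<forall>\<^sub>F m in sequentially. norm (X (s m) ** A) \<le> b * norm A"
      using ev[of 0] by eventually_elim (use bounded in \<open>auto simp: op_bounded_def\<close>)
    ultimately show "norm (N ** A) \<le> b * norm A"
      by (rule tendsto_upperbound) simp
  qed
  let ?D = "dissipation f g :: complex ^ 'n ^ 'n \<Rightarrow> real"
  have fg_cont: "continuous_on {0..b} f" "continuous_on {0..b} g"
    using lip by (auto simp: lipschitz_nonneg_def dist_real_def
      intro!: lipschitz_on_continuous_on[of L] lipschitz_onI)
  note D = dissipation_nonneg[OF mono fg_cont strict less_imp_le[OF b]]
  have Dcont: "continuous_on UNIV ?D"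
    unfolding dissipation_def by (intro continuous_intros continuous_phi_matrix[OF lip])
  show "normal_matrix N"
  proof (rule ccontr)
    assume "\<not> normal_matrix N"
    then have "0 < ?D N" using D[OF bN] by force
    define \<delta> where "\<delta> = ?D N / 2"
    have \<delta>: "0 < \<delta>" "\<delta> < ?D N" using \<open>0 < ?D N\<close> by (simp_all add: \<delta>_def)
    have "open {Y. \<delta> < ?D Y}" by (rule open_Collect_less[OF continuous_on_const Dcont])
    then obtain \<rho> where \<rho>: "0 < \<rho>" "ball N \<rho> \<subseteq> {Y. \<delta> < ?D Y}"
      by (rule openE[of _ N]) (use \<delta> in auto)
    obtain M where M: "0 < M" "\<And>t. 0 \<le> t \<Longrightarrow> norm (phi_matrix f g (X t)) \<le> M" by (rule phi_bounded) blast
    define K where "K = 2 * M * (R + 1)"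
    have R0: "0 \<le> R" using norm_X[of 0] norm_ge_zero[of "X 0"] by linarith
    then have K: "0 < K" using M by (simp add: K_def)
    have speed: "norm (commutator (phi_matrix f g (X t)) (X t)) \<le> K" if "0 \<le> t" for t
    proof -
      have "2 * norm (phi_matrix f g (X t)) * norm (X t) \<le> 2 * M * (R + 1)"
        using M(2)[OF that] norm_X[OF that] R0 M(1) by (intro mult_mono) auto
      then show ?thesis using norm_commutator_le[of "phi_matrix f g (X t)" "X t"] by (simp add: K_def)
    qed
    (* A time in which the trajectory, with speed at most K, moves by at most \<rho> / 2. *)
    define \<tau> where "\<tau> = \<rho> / (2 * K)"
    have \<tau>: "0 < \<tau>" using \<rho> K by (simp add: \<tau>_def)
    define F where "F t = inner (X t) (X t)" for t
    have F: "(F has_real_derivative - 2 * ?D (X t)) (at t within {0..})" if "0 \<le> t" for t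
    proof -
      let ?H = "phi_matrix f g (X t)"
      have "inner (X t) (?H ** X t) = inner ?H (X t ** cadjoint (X t))"
        using inner_mult_right[of ?H "X t" "X t"] by (simp add: inner_commute)
      moreover have "inner (X t) (X t ** ?H) = inner ?H (cadjoint (X t) ** X t)"
        using inner_mult_left[of "X t" ?H "X t"] by (simp add: inner_commute)
      ultimately have "inner (X t) (commutator ?H (X t)) = - ?D (X t)"
        by (simp add: dissipation_def commutator_def inner_diff_right)
      then show ?thesis
        using has_real_derivative_inner_self[OF deriv[OF that]] by (simp add: F_def[abs_def])
    qed
    have decr: "F t \<le> F r" if "0 \<le> r" "r \<le> t" for r t
    proof (rule nonincreasing_on_halfline[OF F _ that])
      fix x assume "r < x" "x < t"
      then show "- 2 * ?D (X x) \<le> 0" using D(1)[OF bounded[of x]] that by simp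
    qed
    (* From t0 on, F has less than 2 * \<delta> * \<tau> left to lose, the loss during one visit near N. *)
    define linf where "linf = Inf (F ` {0..})"
    have bdd: "bdd_below (F ` {0..})" by (rule bdd_belowI2[of _ 0]) (simp add: F_def)
    have "\<exists>y\<in>F ` {0..}. y < linf + 2 * \<delta> * \<tau>"
      using \<delta> \<tau> by (intro cInf_lessD) (auto simp: linf_def)
    then obtain t0 where t0: "0 \<le> t0" "F t0 < linf + 2 * \<delta> * \<tau>" by auto
    have "\<forall>\<^sub>F m in sequentially. dist (X (s m)) N < \<rho> / 2"
      by (rule tendstoD[OF N]) (use \<rho>(1) in simp)
    with ev[of t0] have "\<forall>\<^sub>F m in sequentially. t0 \<le> s m \<and> dist (X (s m)) N < \<rho> / 2"
      by eventually_elim simp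
    then obtain m where m: "t0 \<le> s m" "dist (X (s m)) N < \<rho> / 2"
      using eventually_happens'[OF sequentially_bot] by blast
    have near: "\<delta> < ?D (X x)" if "s m < x" "x < s m + \<tau>" for x
    proof -
      have "norm (X x - X (s m)) \<le> K * x - K * s m"
      proof (rule displacement_bound[OF deriv])
        show "((*) K has_real_derivative K) (at t within {0..})" for t
          by (auto intro!: derivative_eq_intros)
      qed (use that m t0 speed in auto)
      also have "\<dots> = K * (x - s m)" by (simp add: algebra_simps)
      also have "\<dots> < K * \<tau>" using that K by simp
      also have "\<dots> = \<rho> / 2" using K by (simp add: \<tau>_def)
      finally have "dist (X x) (X (s m)) < \<rho> / 2" by (simp add: dist_norm)
      with m(2) have "dist N (X x) < \<rho>"
        using dist_triangle[of N "X x" "X (s m)"] by (simp add: dist_commute)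
      then show ?thesis using \<rho>(2) by auto
    qed
    have "F (s m + \<tau>) + 2 * \<delta> * (s m + \<tau>) \<le> F (s m) + 2 * \<delta> * s m"
    proof (rule nonincreasing_on_halfline[where g = "\<lambda>t. F t + 2 * \<delta> * t" and g' = "\<lambda>t. - 2 * ?D (X t) + 2 * \<delta>"])
      fix t :: real assume "0 \<le> t"
      then show "((\<lambda>t. F t + 2 * \<delta> * t) has_real_derivative - 2 * ?D (X t) + 2 * \<delta>) (at t within {0..})"
        by (auto intro!: derivative_eq_intros F)
    next
      fix x assume "s m < x" "x < s m + \<tau>"
      then show "- 2 * ?D (X x) + 2 * \<delta> \<le> 0" using near[of x] by simp
    qed (use m t0 \<tau> in auto)
    then have "F (s m + \<tau>) \<le> F (s m) - 2 * \<delta> * \<tau>" by (simp add: algebra_simps)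
    moreover have "F (s m) \<le> F t0" using decr[OF t0(1) m(1)] .
    moreover have "linf \<le> F (s m + \<tau>)" unfolding linf_def using bdd m t0 \<tau> by (intro cInf_lower) auto
    ultimately show False using t0(2) by simp
  qed
qed

end

section \<open>Divided differences\<close>

definition ddiff :: "(real \<Rightarrow> real) \<Rightarrow> real \<Rightarrow> real \<Rightarrow> real \<Rightarrow> real" where
  "ddiff \<psi> d c x = (if x = c then d else (\<psi> x - \<psi> c) / (x - c))"

lemma ddiff_mult: "\<psi> x - \<psi> c = ddiff \<psi> d c x * (x - c)"
  by (simp add: ddiff_def)

lemma continuous_on_ddiff:
  fixes \<psi> :: "real \<Rightarrow> real"
  assumes cont: "continuous_on S \<psi>" and der: "(\<psi> has_real_derivative d) (at c within S)"
  shows "continuous_on S (ddiff \<psi> d c)"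
  unfolding continuous_on_eq_continuous_within
proof
  fix x assume x: "x \<in> S"
  show "continuous (at x within S) (ddiff \<psi> d c)"
  proof (cases "x = c")
    case True
    have "((\<lambda>y. (\<psi> y - \<psi> c) / (y - c)) \<longlongrightarrow> d) (at c within S)"
      using der by (simp add: has_field_derivative_iff)
    then have "(ddiff \<psi> d c \<longlongrightarrow> d) (at c within S)"
      by (rule Lim_transform_eventually) (simp add: eventually_at_filter ddiff_def)
    then show ?thesis unfolding True continuous_within by (simp add: ddiff_def)
  next
    case False
    have "continuous (at x within S) \<psi>" using cont x by (simp add: continuous_on_eq_continuous_within)
    then have "continuous (at x within S) (\<lambda>y. (\<psi> y - \<psi> c) / (y - c))"
      using False by (intro continuous_intros) auto
    then show ?thesis
    proof (rule continuous_transform_within[where \<delta> = "\<bar>x - c\<bar>"])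
      fix y assume "y \<in> S" "dist y x < \<bar>x - c\<bar>"
      then have "y \<noteq> c" by (auto simp: dist_real_def abs_minus_commute)
      then show "(\<psi> y - \<psi> c) / (y - c) = ddiff \<psi> d c y" by (simp add: ddiff_def)
    qed (use False x in auto)
  qed
qed

text \<open>Near the diagonal point $c$ the function $\psi - \psi'(c)\,\mathrm{id}$ has a small Lipschitz constant;
  away from it the continuity of the divided difference suffices.\<close>

lemma ddiff_linearisation:
  fixes \<psi> \<psi>' :: "real \<Rightarrow> real"
  assumes c: "0 < c" "c \<le> B"
    and der: "\<And>x. x \<in> {0<..B} \<Longrightarrow> (\<psi> has_real_derivative \<psi>' x) (at x within {0..B})"
    and cont': "continuous_on {0<..B} \<psi>'" and cont: "continuous_on {0..B} \<psi>" and "0 < \<eta>"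
  obtains \<delta> where "0 < \<delta>" "\<And>p q. p \<in> {0..B} \<Longrightarrow> q \<in> {0..B} \<Longrightarrow> \<bar>q - c\<bar> < \<delta> \<Longrightarrow>
    \<bar>\<psi> p - \<psi> q - ddiff \<psi> (\<psi>' c) c p * (p - q)\<bar> \<le> \<eta> * \<bar>p - q\<bar>"
proof -
  define \<kappa> where "\<kappa> = \<psi>' c"
  define a where "a = ddiff \<psi> \<kappa> c"
  have cin: "c \<in> {0<..B}" using c by simp
  obtain d0 where d0: "0 < d0" "\<And>y. y \<in> {0<..B} \<Longrightarrow> \<bar>y - c\<bar> < d0 \<Longrightarrow> \<bar>\<psi>' y - \<kappa>\<bar> < \<eta> / 2"
  proof -
    have "\<exists>d>0. \<forall>y\<in>{0<..B}. dist y c < d \<longrightarrow> dist (\<psi>' y) (\<psi>' c) < \<eta> / 2"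
      using cont' cin \<open>0 < \<eta>\<close> unfolding continuous_on_iff by (meson half_gt_zero)
    then show thesis using that by (auto simp: dist_real_def \<kappa>_def)
  qed
  define r where "r = min d0 c"
  have r: "0 < r" "r \<le> d0" "r \<le> c" using d0 c by (auto simp: r_def)
  define k where "k y = \<psi> y - \<kappa> * y" for y
  define S where "S = {max 0 (c - r)<..<c + r} \<inter> {..B}"
  have S: "y \<in> S \<longleftrightarrow> y \<le> B \<and> \<bar>y - c\<bar> < r" for y using r by (auto simp: S_def)
  have Ssub: "S \<subseteq> {0<..B}" by (auto simp: S_def)
  have klip: "\<bar>k p - k q\<bar> \<le> \<eta> / 2 * \<bar>p - q\<bar>" if "p \<in> S" "q \<in> S" for p q
  proof -
    have "norm (k p - k q) \<le> \<eta> / 2 * norm (p - q)"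
    proof (rule field_differentiable_bound[where f' = "\<lambda>y. \<psi>' y - \<kappa>"])
      show "convex S" unfolding S_def by (intro convex_Int) auto
      fix y assume y: "y \<in> S"
      then have y': "y \<in> {0<..B}" using Ssub by auto
      have "(\<psi> has_real_derivative \<psi>' y) (at y within S)"
        by (rule DERIV_subset[OF der[OF y']]) (use Ssub in auto)
      then show "(k has_real_derivative \<psi>' y - \<kappa>) (at y within S)"
        unfolding k_def by (auto intro!: derivative_eq_intros)
      show "norm (\<psi>' y - \<kappa>) \<le> \<eta> / 2" using d0(2)[OF y'] y r by (simp add: S)
    qed (use that in auto)
    then show ?thesis by simp
  qed
  have cS: "c \<in> S" using c r by (simp add: S)
  have ak: "\<bar>a p - \<kappa>\<bar> \<le> \<eta> / 2" if "p \<in> S" for p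
  proof (cases "p = c")
    case False
    have "a p - \<kappa> = (k p - k c) / (p - c)"
      using False by (simp add: a_def ddiff_def k_def field_simps)
    also have "\<bar>\<dots>\<bar> \<le> \<eta> / 2"
      using klip[OF that cS] False by (simp add: divide_le_eq)
    finally show ?thesis .
  qed (use \<open>0 < \<eta>\<close> in \<open>simp add: a_def ddiff_def\<close>)
  have near: "\<bar>\<psi> p - \<psi> q - a p * (p - q)\<bar> \<le> \<eta> * \<bar>p - q\<bar>" if "p \<in> S" "q \<in> S" for p q
  proof -
    have "\<psi> p - \<psi> q - a p * (p - q) = (k p - k q) - (a p - \<kappa>) * (p - q)"
      by (simp add: k_def algebra_simps)
    also have "\<bar>\<dots>\<bar> \<le> \<bar>k p - k q\<bar> + \<bar>a p - \<kappa>\<bar> * \<bar>p - q\<bar>"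
      by (rule order_trans[OF abs_triangle_ineq4]) (simp add: abs_mult)
    also have "\<dots> \<le> \<eta> / 2 * \<bar>p - q\<bar> + \<eta> / 2 * \<bar>p - q\<bar>"
      by (intro add_mono klip that mult_right_mono ak) auto
    finally show ?thesis by simp
  qed
  have acont: "continuous_on {0..B} a"
    unfolding a_def \<kappa>_def by (rule continuous_on_ddiff[OF cont der[OF cin]])
  have "bounded (a ` {0..B})"
    by (rule compact_imp_bounded[OF compact_continuous_image[OF acont compact_Icc]])
  then obtain A where A: "0 < A" "\<And>x. x \<in> {0..B} \<Longrightarrow> \<bar>a x\<bar> \<le> A"
    unfolding bounded_pos by auto
  define \<delta> where "\<delta> = min (r / 2) (\<eta> * r / (4 * A))"
  have \<delta>: "0 < \<delta>" "\<delta> \<le> r / 2" "2 * A * \<delta> \<le> \<eta> * (r / 2)"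
  proof -
    show "0 < \<delta>" using r A \<open>0 < \<eta>\<close> by (simp add: \<delta>_def)
    show "\<delta> \<le> r / 2" by (simp add: \<delta>_def)
    have "2 * A * \<delta> \<le> 2 * A * (\<eta> * r / (4 * A))" using A by (intro mult_left_mono) (auto simp: \<delta>_def)
    then show "2 * A * \<delta> \<le> \<eta> * (r / 2)" using A by (simp add: field_simps)
  qed
  show thesis
  proof (rule that[OF \<delta>(1)])
    fix p q assume p: "p \<in> {0..B}" and q: "q \<in> {0..B}" and qc: "\<bar>q - c\<bar> < \<delta>"
    have "\<bar>\<psi> p - \<psi> q - a p * (p - q)\<bar> \<le> \<eta> * \<bar>p - q\<bar>"
    proof (cases "\<bar>p - c\<bar> < r")
      case True
      then show ?thesis using p q qc \<delta> by (intro near) (auto simp: S)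
    next
      case False
      have far: "r / 2 \<le> \<bar>p - q\<bar>" using False qc \<delta>(2) by linarith
      have "\<psi> p - \<psi> q - a p * (p - q) = (\<psi> p - \<psi> c) - (\<psi> q - \<psi> c) - a p * (p - q)" by simp
      also have "\<dots> = (a p - a q) * (q - c)"
        unfolding ddiff_mult[of \<psi> p c \<kappa>] ddiff_mult[of \<psi> q c \<kappa>] a_def[symmetric] by (simp add: algebra_simps)
      also have "\<bar>\<dots>\<bar> \<le> (2 * A) * \<delta>"
        unfolding abs_mult using A(2)[OF p] A(2)[OF q] qc A(1) by (intro mult_mono) auto
      also have "\<dots> \<le> \<eta> * (r / 2)" by (rule \<delta>(3))
      also have "\<dots> \<le> \<eta> * \<bar>p - q\<bar>" using far \<open>0 < \<eta>\<close> by (intro mult_left_mono) auto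
      finally show ?thesis .
    qed
    then show "\<bar>\<psi> p - \<psi> q - ddiff \<psi> (\<psi>' c) c p * (p - q)\<bar> \<le> \<eta> * \<bar>p - q\<bar>"
      by (simp add: a_def \<kappa>_def)
  qed
qed

text \<open>A uniformly continuous function is Lipschitz up to an additive \<open>\<epsilon>\<close>, which is the form of
  hypothesis under which \<open>intertwining_estimate\<close> gives continuity of the functional calculus.\<close>

lemma tendsto_hermitian_fun:
  fixes P :: "nat \<Rightarrow> complex ^ 'n ^ 'n"
  assumes sp: "\<And>m. spec_in {0..B} (P m)" "spec_in {0..B} Q" and a: "continuous_on {0..B} a" and P: "P \<longlonglongrightarrow> Q"
  shows "(\<lambda>m. hermitian_fun a (P m)) \<longlonglongrightarrow> hermitian_fun a Q"
proof (rule LIMSEQ_I)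
  fix e :: real assume e: "0 < e"
  let ?n = "norm (mat 1 :: complex ^ 'n ^ 'n)"
  define K where "K = ?n + 1"
  have K: "0 < K" "?n < K" by (simp_all add: K_def add_nonneg_pos)
  define \<epsilon> where "\<epsilon> = e / 2 / K"
  have \<epsilon>: "0 < \<epsilon>" "\<epsilon> * ?n < e / 2"
  proof -
    show "0 < \<epsilon>" using e K by (simp add: \<epsilon>_def)
    have "\<epsilon> * ?n < \<epsilon> * K" using \<open>0 < \<epsilon>\<close> K by simp
    also have "\<dots> = e / 2" using K by (simp add: \<epsilon>_def)
    finally show "\<epsilon> * ?n < e / 2" .
  qed
  have "uniformly_continuous_on {0..B} a" by (rule compact_uniformly_continuous[OF a compact_Icc])
  then obtain d where d: "0 < d" "\<And>x y. x \<in> {0..B} \<Longrightarrow> y \<in> {0..B} \<Longrightarrow> dist y x < d \<Longrightarrow> dist (a y) (a x) < \<epsilon>"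
    by (rule uniformly_continuous_onE[OF _ \<epsilon>(1)]) blast
  have "bounded (a ` {0..B})" by (rule compact_imp_bounded[OF compact_continuous_image[OF a compact_Icc]])
  then obtain A where A: "0 < A" "\<And>x. x \<in> {0..B} \<Longrightarrow> \<bar>a x\<bar> \<le> A"
    unfolding bounded_pos by auto
  define L where "L = 2 * A / d"
  have L: "0 < L" using A d by (simp add: L_def)
  have mod: "\<bar>a x - a y\<bar> \<le> \<epsilon> + L * \<bar>x - y\<bar>" if "x \<in> {0..B}" "y \<in> {0..B}" for x y
  proof (cases "\<bar>x - y\<bar> < d")
    case True
    then have "\<bar>a x - a y\<bar> < \<epsilon>" using d(2)[OF that(2,1)] by (simp add: dist_real_def)
    moreover have "0 \<le> L * \<bar>x - y\<bar>" using L by simp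
    ultimately show ?thesis by linarith
  next
    case False
    have "\<bar>a x - a y\<bar> \<le> 2 * A" using A(2)[OF that(1)] A(2)[OF that(2)] by linarith
    also have "2 * A = L * d" using d by (simp add: L_def)
    also have "L * d \<le> L * \<bar>x - y\<bar>" using False L by (intro mult_left_mono) auto
    finally show ?thesis using \<epsilon>(1) by linarith
  qed
  have "\<forall>\<^sub>F m in sequentially. norm (P m - Q) < e / (2 * L)"
    using tendstoD[OF P, of "e / (2 * L)"] e L by (simp add: dist_norm)
  then obtain M where M: "\<And>m. m \<ge> M \<Longrightarrow> norm (P m - Q) < e / (2 * L)"
    unfolding eventually_sequentially by blast
  have "norm (hermitian_fun a (P m) - hermitian_fun a Q) < e" if "m \<ge> M" for m
  proof -
    have "norm (hermitian_fun a (P m) - hermitian_fun a Q) \<le> \<epsilon> * ?n + L * norm (P m - Q)"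
      by (rule hermitian_fun_lipschitz[OF sp(1) sp(2) mod]) (use \<epsilon> L in auto)
    also have "L * norm (P m - Q) < e / 2"
      using mult_strict_left_mono[OF M[OF that] L] L by simp
    finally show ?thesis using \<epsilon>(2) by linarith
  qed
  then show "\<exists>M. \<forall>m\<ge>M. norm (hermitian_fun a (P m) - hermitian_fun a Q) < e" by blast
qed

lemma spec_in_near_scalar:
  fixes P :: "complex ^ 'n ^ 'n"
  assumes "spec_in S P" "norm (P - mat (complex_of_real c)) < \<delta>"
  shows "spec_in (S \<inter> {q. \<bar>q - c\<bar> < \<delta>}) P"
proof -
  obtain U d where U: "unitary_matrix U" and P: "P = udiag U d" and d: "\<And>i. d $ i \<in> S"
    using assms(1) by (rule spec_inE) blast
  have "\<bar>d $ i - c\<bar> < \<delta>" for i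
  proof -
    have "P - mat (complex_of_real c) = udiag U (\<chi> i. d $ i - c)"
      using udiag_simps(3)[of U d "\<chi> i. c"] unfolding P udiag_const[OF U] by simp
    then have "(P - mat (complex_of_real c)) ** (U ** unit_diag i) = (d $ i - c) *\<^sub>R (U ** unit_diag i)"
      by (simp add: udiag_def matrix_mul_assoc[symmetric] unitary_cancel U real_diag_unit_diag mm_distribs(9,10))
    then have "norm ((P - mat (complex_of_real c)) ** (U ** unit_diag i)) = \<bar>d $ i - c\<bar>"
      by (simp add: norm_unitary_mult U)
    moreover have "norm ((P - mat (complex_of_real c)) ** (U ** unit_diag i)) \<le> norm (P - mat (complex_of_real c)) * norm (U ** unit_diag i)"
      by (rule norm_matrix_mult)
    ultimately show ?thesis using assms(2) by (simp add: norm_unitary_mult U)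
  qed
  then show ?thesis unfolding P using d by (intro spec_in_udiag[OF U]) auto
qed

section \<open>The obliqueness of an idempotent\<close>

text \<open>With $E = V s U^*$ the projection is $V$ times the support of $s$; it equals $EG$ for the pseudoinverse $G$ of
  $E$, so that $E$ fixes its range.\<close>

lemma range_projection_exists:
  fixes E :: "complex ^ 'n ^ 'n"
  assumes "E ** E = E"
  obtains F where "cadjoint F = F" "F ** F = F" "F ** E = E" "E ** F = F"
proof -
  obtain V U s where E: "unitary_matrix V" "unitary_matrix U" "\<And>i. 0 \<le> s $ i"
    "E = V ** real_diag s ** cadjoint U" by (rule singular_value_decomposition[of E]) blast
  define z where "z = (\<chi> i. if s $ i = 0 then 0 else (1 :: real))"
  define F where "F = udiag V z"
  have "real_diag z ** real_diag s = real_diag s"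
    unfolding real_diag_simps by (rule arg_cong[of _ _ real_diag]) (simp add: vec_eq_iff z_def)
  moreover have "F ** E = V ** (real_diag z ** real_diag s) ** cadjoint U"
    unfolding F_def udiag_def E(4) by (simp only: matrix_mul_assoc unitary_cancel(3)[OF E(1)])
  ultimately have FE: "F ** E = E" by (simp add: E(4))
  define G where "G = U ** real_diag (\<chi> i. inverse (s $ i)) ** cadjoint V"
  have "real_diag s ** real_diag (\<chi> i. inverse (s $ i)) = real_diag z"
    unfolding real_diag_simps by (rule arg_cong[of _ _ real_diag]) (simp add: vec_eq_iff z_def)
  moreover have "E ** G = V ** (real_diag s ** real_diag (\<chi> i. inverse (s $ i))) ** cadjoint V"
    unfolding E(4) G_def by (simp only: matrix_mul_assoc unitary_cancel(3)[OF E(2)])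
  ultimately have EG: "E ** G = F" by (simp add: F_def udiag_def)
  have "E ** (E ** G) = E ** G" "F ** (E ** G) = E ** G"
    by (simp_all only: matrix_mul_assoc assms FE)
  then have EF: "E ** F = F" and FF: "F ** F = F" by (simp_all only: EG)
  show thesis by (rule that[OF _ FF FE EF]) (simp add: F_def)
qed

text \<open>$F$ is the orthogonal projection onto the range of the idempotent $E$, and $W$ measures the failure of $E$
  to be orthogonal: $W$ maps the orthogonal complement of the range into the range.\<close>

locale oblique_idempotent =
  fixes E F W :: "complex ^ 'n ^ 'n"
  assumes F: "cadjoint F = F" "F ** F = F" "F ** E = E" "E ** F = F"
    and W_def: "W = E - F"
begin

lemma FW: "F ** W = W" and WF: "W ** F = 0" and E_eq: "E = F + W"
  by (simp_all add: W_def mm_distribs F)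

lemma FWs: "F ** cadjoint W = 0" and WsF: "cadjoint W ** F = cadjoint W"
proof -
  show "F ** cadjoint W = 0" using arg_cong[OF WF, of cadjoint] by (simp add: cadjoint_mult F)
  show "cadjoint W ** F = cadjoint W" using arg_cong[OF FW, of cadjoint] by (simp add: cadjoint_mult F)
qed

text \<open>The ranks, hence the traces, of $E$ and $F$ agree, and $W \perp F$. Hence $\|W\|^2$ is a smooth
  function of $E$ alone, with a derivative along the flow that does not involve $F'$.\<close>

lemma norm_W_sq: "(norm W)\<^sup>2 = inner E E - inner (mat 1) E"
proof -
  have FFi: "inner F W = 0"
  proof -
    have "inner F W = inner (F ** mat 1) W" by simp
    also have "\<dots> = inner (mat 1) (F ** W)" by (rule inner_hermitian_mult_self[OF F(1)])
    also have "\<dots> = inner (mat 1) (W)" by (simp add: FW)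
    finally have a: "inner F W = inner (mat 1) W" .
    have "inner F W = inner (mat 1 ** F) W" by simp
    also have "\<dots> = inner (mat 1) (W ** cadjoint F)" by (rule inner_mult_right)
    also have "\<dots> = 0" by (simp add: F WF)
    finally show ?thesis .
  qed
  have 1: "inner (mat 1) W = 0"
  proof -
    have "inner (mat 1) W = inner (mat 1) (F ** W)" by (simp add: FW)
    also have "\<dots> = inner (F ** mat 1) W" by (rule inner_hermitian_mult_self[OF F(1), symmetric])
    finally show ?thesis using FFi by simp
  qed
  have "inner F F = inner (F ** mat 1) F" by simp
  also have "\<dots> = inner (mat 1) (F ** F)" by (rule inner_hermitian_mult_self[OF F(1)])
  finally have "inner F F = inner (mat 1) F" by (simp add: F)
  then show ?thesis
    unfolding E_eq using FFi 1
    by (simp add: inner_add_left inner_add_right inner_commute power2_norm_eq_inner)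
qed

text \<open>This makes $W$ small near a normal matrix, where $E$ is nearly hermitian.\<close>

lemma norm_W_adjoint: "norm (E - cadjoint E) = sqrt 2 * norm W"
proof -
  have z: "inner W (cadjoint W) = 0"
  proof -
    have "inner W (cadjoint W) = inner (F ** W) (cadjoint W)" by (simp add: FW)
    also have "\<dots> = inner W (F ** cadjoint W)" by (rule inner_hermitian_mult_self[OF F(1)])
    finally show ?thesis by (simp add: FWs)
  qed
  have "(norm (E - cadjoint E))\<^sup>2 = (norm (W - cadjoint W))\<^sup>2"
    by (simp add: E_eq cadjoint_add F)
  also have "\<dots> = 2 * (norm W)\<^sup>2"
    using z by (simp add: power2_norm_eq_inner inner_diff_left inner_diff_right inner_commute)
  finally show ?thesis
    using real_sqrt_unique[of "norm (E - cadjoint E)" "2 * (norm W)\<^sup>2"] by (simp add: real_sqrt_mult)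
qed

lemma commutator_adjoint:
  "E ** cadjoint E - cadjoint E ** E = W ** cadjoint W - cadjoint W ** W - W - cadjoint W"
  unfolding E_eq by (simp add: cadjoint_add F mm_distribs FW WF FWs WsF)

end

lemma scaled_mult:
  fixes A B :: "complex ^ 'n ^ 'n"
  shows "(mat a ** A) ** (mat c ** B) = mat (a * c) ** (A ** B)"
proof -
  have "(mat a ** A) ** (mat c ** B) = mat a ** (A ** mat c) ** B" by (simp only: matrix_mul_assoc)
  also have "\<dots> = mat a ** (mat c ** A) ** B" by (simp only: mat_commute[of A c])
  also have "\<dots> = (mat a ** mat c) ** (A ** B)" by (simp only: matrix_mul_assoc)
  finally show ?thesis by (simp only: mat_mult_mat)
qed

lemma block_scalar_mult:
  fixes F :: "complex ^ 'n ^ 'n"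
  assumes "F ** F = F" "a * c = d" "a' * c' = d"
  shows "(mat a ** F + mat a' ** (mat 1 - F)) ** (mat c ** F + mat c' ** (mat 1 - F)) = mat d"
proof -
  have z: "F ** (mat 1 - F) = 0" "(mat 1 - F) ** F = 0" "(mat 1 - F) ** (mat 1 - F) = mat 1 - F"
    by (simp_all add: mmult.diff_left mmult.diff_right assms(1))
  have "(mat a ** F + mat a' ** (mat 1 - F)) ** (mat c ** F + mat c' ** (mat 1 - F)) = mat d ** F + mat d ** (mat 1 - F)"
    unfolding mmult.add_left mmult.add_right scaled_mult z assms by (simp add: mmult.zero_right)
  also have "\<dots> = mat d ** (F + (mat 1 - F))" by (simp only: mmult.add_right)
  finally show ?thesis by simp
qed

context oblique_idempotent
begin

text \<open>With respect to the range of $F$ the matrix $X$ is block triangular. Its diagonal block on that range,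
  completed by a scalar, is $Y$; the defects $X^*XF - FY^*Y$ and $XX^*F - FYY^*$ are exactly linear in $W$.\<close>

lemma block_triangular:
  assumes comm: "X ** E = E ** X" and Y: "Y = X ** F + mat z ** (mat 1 - F)"
  shows "F ** (X ** F) = X ** F"
    and "cadjoint X ** X ** F - F ** (cadjoint Y ** Y) = (cadjoint W ** cadjoint X - cadjoint X ** cadjoint W) ** (X ** F)"
    and "X ** cadjoint X ** F - F ** (Y ** cadjoint Y) = X ** (cadjoint W ** cadjoint X - cadjoint X ** cadjoint W)"
proof -
  have "F ** (X ** F) = F ** (X ** E) ** F" by (simp only: matrix_mul_assoc[symmetric] F(4))
  also have "\<dots> = (F ** E) ** X ** F" by (simp only: comm matrix_mul_assoc)
  also have "\<dots> = E ** X ** F" by (simp only: F(3))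
  also have "\<dots> = X ** (E ** F)" by (simp only: comm[symmetric] matrix_mul_assoc)
  finally show FXF: "F ** (X ** F) = X ** F" by (simp only: F(4))
  have FXs: "F ** cadjoint X ** F = F ** cadjoint X"
    using arg_cong[OF FXF, of cadjoint] by (simp add: cadjoint_mult F(1))
  have "X ** F + X ** W = F ** X + W ** X"
    using comm unfolding E_eq mmult.add_left mmult.add_right .
  then have "X ** W - W ** X = F ** X - X ** F" by (simp add: algebra_simps)
  from arg_cong[OF this, of cadjoint]
  have B: "cadjoint W ** cadjoint X - cadjoint X ** cadjoint W = cadjoint X ** F - F ** cadjoint X"
    by (simp add: cadjoint_diff cadjoint_mult F(1))
  have z: "F ** (mat z ** (mat 1 - F)) = 0" "mat z ** (mat 1 - F) ** F = 0"
    unfolding matrix_mul_assoc mat_commute[of F]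
    by (simp_all add: matrix_mul_assoc[symmetric] mmult.diff_left mmult.diff_right F(2) mmult.zero_right)
  have FY: "F ** Y = X ** F" and YF: "Y ** F = X ** F"
    unfolding Y mmult.add_left mmult.add_right z FXF by (simp_all add: matrix_mul_assoc[symmetric] F(2))
  have FYs: "F ** cadjoint Y = F ** cadjoint X"
    using arg_cong[OF YF, of cadjoint] by (simp add: cadjoint_mult F(1))
  have "F ** cadjoint X ** (mat z ** (mat 1 - F)) = mat z ** (F ** cadjoint X ** (mat 1 - F))"
    by (simp only: matrix_mul_assoc mat_commute[of "F ** cadjoint X" z])
  also have "F ** cadjoint X ** (mat 1 - F) = 0"
    by (simp add: mmult.diff_right FXs)
  finally have q: "F ** cadjoint X ** (mat z ** (mat 1 - F)) = 0" by (simp add: mmult.zero_right)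
  have "F ** (cadjoint Y ** Y) = F ** cadjoint X ** Y" by (simp only: matrix_mul_assoc FYs)
  also have "\<dots> = F ** cadjoint X ** (X ** F)"
    using q by (simp add: Y mmult.add_right)
  finally have 1: "F ** (cadjoint Y ** Y) = F ** cadjoint X ** (X ** F)" .
  have "cadjoint X ** F ** (X ** F) = cadjoint X ** X ** F"
    by (simp only: matrix_mul_assoc[symmetric] FXF)
  then show "cadjoint X ** X ** F - F ** (cadjoint Y ** Y) = (cadjoint W ** cadjoint X - cadjoint X ** cadjoint W) ** (X ** F)"
    unfolding 1 B mmult.diff_left by simp
  have "F ** (Y ** cadjoint Y) = X ** (F ** cadjoint Y)" by (simp only: matrix_mul_assoc FY)
  also have "\<dots> = X ** (F ** cadjoint X)" by (simp only: FYs)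
  finally show "X ** cadjoint X ** F - F ** (Y ** cadjoint Y) = X ** (cadjoint W ** cadjoint X - cadjoint X ** cadjoint W)"
    unfolding B mmult.diff_right by (simp add: matrix_mul_assoc)
qed

lemma block_op_bounded:
  assumes comm: "X ** E = E ** X" and Y: "Y = X ** F + mat (complex_of_real r) ** (mat 1 - F)"
    and X: "op_bounded b X" and r: "0 \<le> r" "r \<le> b"
  shows "op_bounded b Y"
  unfolding op_bounded_def
proof
  fix A :: "complex ^ 'n ^ 'n"
  have b: "0 \<le> b" using r by simp
  define u v where "u = F ** A" and "v = (mat 1 - F) ** A"
  have Fu: "F ** u = u" and Fv: "F ** v = 0"
    unfolding u_def v_def by (simp_all add: matrix_mul_assoc F(2) mmult.diff_right mmult.zero_left)
  have A: "A = u + v" unfolding u_def v_def by (simp add: mmult.add_left[symmetric])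
  have YA: "Y ** A = X ** u + r *\<^sub>R v"
    unfolding Y mmult.add_left u_def v_def by (simp add: matrix_mul_assoc[symmetric] mat_of_real mmult.scaleR_left)
  have orth: "inner x v = 0" if "F ** x = x" for x
    using inner_hermitian_mult_self[OF F(1), of x v] that Fv by simp
  have "F ** (X ** u) = X ** u"
    using block_triangular(1)[OF comm refl] unfolding u_def by (simp only: matrix_mul_assoc)
  then have o1: "inner (X ** u) v = 0" by (rule orth)
  have o2: "inner u v = 0" by (rule orth[OF Fu])
  have pyth: "(norm (x + s *\<^sub>R v))\<^sup>2 = (norm x)\<^sup>2 + s\<^sup>2 * (norm v)\<^sup>2" if "inner x v = 0" for x s
    using that inner_commute[of v x] unfolding power2_norm_eq_inner
    by (simp add: inner_add_left inner_add_right power2_eq_square)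
  have "norm (X ** u) \<le> b * norm u" using X unfolding op_bounded_def by blast
  then have "(norm (X ** u))\<^sup>2 \<le> (b * norm u)\<^sup>2" by (rule power_mono) simp
  moreover have "r\<^sup>2 * (norm v)\<^sup>2 \<le> b\<^sup>2 * (norm v)\<^sup>2"
    using r by (intro mult_right_mono power_mono) auto
  ultimately have "(norm (Y ** A))\<^sup>2 \<le> b\<^sup>2 * (norm u)\<^sup>2 + b\<^sup>2 * (norm v)\<^sup>2"
    unfolding YA pyth[OF o1] by (simp add: power_mult_distrib)
  also have "\<dots> = (b * norm A)\<^sup>2"
    using pyth[OF o2, of 1] by (simp add: A power_mult_distrib distrib_left)
  finally show "norm (Y ** A) \<le> b * norm A" by (rule power2_le_imp_le) (simp add: b)
qed

text \<open>The term $FK$ is free to be chosen, because it is orthogonal to $W^*$. For $H = \psi_k(P)$ the choice of $K$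
  as $\psi_k$ of the diagonal block turns the bracket into a small intertwining defect.\<close>

lemma inner_hermitian_W:
  assumes "cadjoint H = H"
  shows "inner H W = inner (H ** F - F ** K) (cadjoint W)"
proof -
  have "inner (F ** K) (cadjoint W) = inner K (F ** cadjoint W)" by (rule inner_hermitian_mult_self[OF F(1)])
  then have 0: "inner (F ** K) (cadjoint W) = 0" by (simp add: FWs)
  have "inner H W = inner H (F ** W)" by (simp add: FW)
  also have "\<dots> = inner (F ** H) W" by (rule inner_hermitian_mult_self[OF F(1), symmetric])
  also have "\<dots> = inner (cadjoint (F ** H)) (cadjoint W)" by simp
  also have "cadjoint (F ** H) = H ** F" by (simp add: cadjoint_mult assms F(1))
  finally show ?thesis by (simp add: inner_diff_left 0)
qed

end

text \<open>If the intertwining defects of $P$ and $Q$ are of order $\rho$, then so are those of $\psi(P)$ and $\psi(Q)$,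
  and to first order the divided differences of $\psi$ at $c$ turn the former into the latter. Only the base
  point $c$ occurs because the spectrum of $Q$ shrinks to $c$.\<close>

lemma intertwined_linearisation:
  fixes P Q F :: "nat \<Rightarrow> complex ^ 'n ^ 'n" and \<psi> \<psi>' :: "real \<Rightarrow> real"
  assumes c: "0 < c" "c \<le> B"
    and der: "\<And>x. x \<in> {0<..B} \<Longrightarrow> (\<psi> has_real_derivative \<psi>' x) (at x within {0..B})"
    and cont': "continuous_on {0<..B} \<psi>'" and cont: "continuous_on {0..B} \<psi>"
    and P: "\<And>m. spec_in {0..B} (P m)" "spec_in {0..B} P0" "P \<longlonglongrightarrow> P0"
    and Q: "\<And>m. spec_in {0..B} (Q m)" "Q \<longlonglongrightarrow> mat (complex_of_real c)"
    and \<rho>: "\<And>m. 0 < \<rho> m"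
    and \<Gamma>: "(\<lambda>m. (1 / \<rho> m) *\<^sub>R (P m ** F m - F m ** Q m)) \<longlonglongrightarrow> \<Gamma>"
  shows "(\<lambda>m. (1 / \<rho> m) *\<^sub>R (hermitian_fun \<psi> (P m) ** F m - F m ** hermitian_fun \<psi> (Q m)))
    \<longlonglongrightarrow> hermitian_fun (ddiff \<psi> (\<psi>' c) c) P0 ** \<Gamma>"
proof -
  define a where "a = ddiff \<psi> (\<psi>' c) c"
  define G where "G m = (1 / \<rho> m) *\<^sub>R (P m ** F m - F m ** Q m)" for m
  define H where "H m = (1 / \<rho> m) *\<^sub>R (hermitian_fun \<psi> (P m) ** F m - F m ** hermitian_fun \<psi> (Q m))" for m
  have acont: "continuous_on {0..B} a"
    unfolding a_def by (rule continuous_on_ddiff[OF cont der]) (use c in simp)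
  have main: "(\<lambda>m. hermitian_fun a (P m) ** G m) \<longlonglongrightarrow> hermitian_fun a P0 ** \<Gamma>"
    using \<Gamma> unfolding G_def[symmetric] by (intro tendsto_intros tendsto_hermitian_fun[OF P(1,2) acont P(3)])
  obtain C where C: "0 < C" "\<And>m. norm (G m) \<le> C"
  proof -
    have "Bseq G" using \<Gamma> unfolding G_def[symmetric] by (intro convergent_imp_Bseq convergentI)
    then show thesis using that by (auto elim: BseqE)
  qed
  have "(\<lambda>m. H m - hermitian_fun a (P m) ** G m) \<longlonglongrightarrow> 0"
  proof (rule LIMSEQ_I)
    fix e :: real assume e: "0 < e"
    define \<eta> where "\<eta> = e / (2 * C)"
    have \<eta>: "0 < \<eta>" "\<eta> * C < e" using e C by (simp_all add: \<eta>_def)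
    obtain \<delta> where \<delta>: "0 < \<delta>" "\<And>p q. p \<in> {0..B} \<Longrightarrow> q \<in> {0..B} \<Longrightarrow> \<bar>q - c\<bar> < \<delta> \<Longrightarrow>
        \<bar>\<psi> p - \<psi> q - a p * (p - q)\<bar> \<le> \<eta> * \<bar>p - q\<bar>"
      unfolding a_def by (rule ddiff_linearisation[OF c der cont' cont \<eta>(1)]) blast+
    from tendstoD[OF Q(2) \<delta>(1)] obtain M where M: "\<And>m. m \<ge> M \<Longrightarrow> norm (Q m - mat (complex_of_real c)) < \<delta>"
      unfolding eventually_sequentially dist_norm by blast
    have "norm (H m - hermitian_fun a (P m) ** G m - 0) < e" if "m \<ge> M" for m
    proof -
      let ?G = "P m ** F m - F m ** Q m"
      have eq: "H m - hermitian_fun a (P m) ** G m = (1 / \<rho> m) *\<^sub>R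
          (hermitian_fun \<psi> (P m) ** F m - F m ** hermitian_fun \<psi> (Q m) - hermitian_fun a (P m) ** ?G)"
        unfolding H_def G_def mmult.scaleR_right by (simp only: scaleR_diff_right)
      have "norm (hermitian_fun \<psi> (P m) ** F m - F m ** hermitian_fun \<psi> (Q m) - hermitian_fun a (P m) ** ?G)
          \<le> 0 * norm (F m) + \<eta> * norm ?G"
        by (rule intertwining_estimate[OF P(1) spec_in_near_scalar[OF Q(1) M[OF that]]])
          (use \<delta>(2) \<eta>(1) in auto)
      then have "(1 / \<rho> m) * norm (hermitian_fun \<psi> (P m) ** F m - F m ** hermitian_fun \<psi> (Q m) - hermitian_fun a (P m) ** ?G)
          \<le> (1 / \<rho> m) * (\<eta> * norm ?G)"
        using \<rho>[of m] by (intro mult_left_mono) auto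
      also have "\<dots> = \<eta> * norm (G m)" unfolding G_def using \<rho>[of m] by simp
      also have "\<dots> \<le> \<eta> * C" using C(2) \<eta>(1) by (intro mult_left_mono) auto
      finally show ?thesis using \<eta>(2) \<rho>[of m] unfolding eq by simp
    qed
    then show "\<exists>M. \<forall>m\<ge>M. norm (H m - hermitian_fun a (P m) ** G m - 0) < e" by blast
  qed
  from tendsto_add[OF this main] show ?thesis unfolding H_def a_def by simp
qed

section \<open>Exponential decay of the obliqueness\<close>

locale smooth_pair =
  fixes f g f' g' :: "real \<Rightarrow> real" and L b :: real
  assumes b: "0 < b" and lip: "lipschitz_nonneg L f" "lipschitz_nonneg L g"
    and mono: "mono_on {0..b} f" "mono_on {0..b} g"
    and strict: "strict_mono_on {0..b} (\<lambda>x. f x + g x)"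
    and derf: "\<And>x. x \<in> {0..b} \<Longrightarrow> (f has_real_derivative f' x) (at x within {0..b})"
    and derg: "\<And>x. x \<in> {0..b} \<Longrightarrow> (g has_real_derivative g' x) (at x within {0..b})"
    and contf': "continuous_on {0..b} f'" and contg': "continuous_on {0..b} g'"
    and pos: "\<And>x. x \<in> {0<..b} \<Longrightarrow> 0 < f' x + g' x"
begin

lemma sqrt_range: "x \<in> {0..b\<^sup>2} \<Longrightarrow> sqrt x \<in> {0..b}"
  using real_sqrt_le_mono[of x "b\<^sup>2"] b by (simp add: real_sqrt_abs)

lemma derf_all: "\<forall>x\<in>{0..b}. (f has_real_derivative f' x) (at x within {0..b})"
  and derg_all: "\<forall>x\<in>{0..b}. (g has_real_derivative g' x) (at x within {0..b})"
  using derf derg by blast+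

lemma sqrt_comp_regular:
  assumes der_all: "\<forall>x\<in>{0..b}. (h has_real_derivative h' x) (at x within {0..b})"
    and cont': "continuous_on {0..b} h'"
  shows "\<And>x. x \<in> {0<..b\<^sup>2} \<Longrightarrow> ((\<lambda>x. h (sqrt x)) has_real_derivative h' (sqrt x) * (inverse (sqrt x) / 2)) (at x within {0..b\<^sup>2})"
    and "continuous_on {0<..b\<^sup>2} (\<lambda>x. h' (sqrt x) * (inverse (sqrt x) / 2))"
    and "continuous_on {0..b\<^sup>2} (\<lambda>x. h (sqrt x))"
proof -
  note der = der_all[rule_format]
  have sub: "sqrt ` {0..b\<^sup>2} \<subseteq> {0..b}" using sqrt_range by blast
  fix x assume x: "x \<in> {0<..b\<^sup>2}"
  have 1: "(h has_real_derivative h' (sqrt x)) (at (sqrt x) within sqrt ` {0..b\<^sup>2})"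
    by (rule DERIV_subset[OF der sub]) (use sqrt_range x in simp)
  have 2: "(sqrt has_real_derivative inverse (sqrt x) / 2) (at x within {0..b\<^sup>2})"
    by (rule has_field_derivative_at_within[OF DERIV_real_sqrt]) (use x in simp)
  show "((\<lambda>x. h (sqrt x)) has_real_derivative h' (sqrt x) * (inverse (sqrt x) / 2)) (at x within {0..b\<^sup>2})"
    using DERIV_image_chain[OF 1 2] by (simp add: o_def)
next
  have sc: "continuous_on S sqrt" for S by (intro continuous_intros)
  have "continuous_on {0<..b\<^sup>2} (\<lambda>x. h' (sqrt x))"
    by (rule continuous_on_compose2[OF cont' sc]) (use sqrt_range in auto)
  then show "continuous_on {0<..b\<^sup>2} (\<lambda>x. h' (sqrt x) * (inverse (sqrt x) / 2))"
    by (intro continuous_intros sc) auto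
  have "continuous_on {0..b} h"
    unfolding continuous_on_eq_continuous_within using DERIV_continuous[OF der_all[rule_format]] by blast
  then show "continuous_on {0..b\<^sup>2} (\<lambda>x. h (sqrt x))"
    by (rule continuous_on_compose2[OF _ sc]) (use sqrt_range in auto)
qed

abbreviation "\<psi>1 \<equiv> \<lambda>x. f (sqrt x)"
abbreviation "\<psi>2 \<equiv> \<lambda>x. g (sqrt x)"
abbreviation "\<psi>1' \<equiv> \<lambda>x. f' (sqrt x) * (inverse (sqrt x) / 2)"
abbreviation "\<psi>2' \<equiv> \<lambda>x. g' (sqrt x) * (inverse (sqrt x) / 2)"

text \<open>Strict monotonicity makes the divided differences positive off the diagonal, the hypothesis on the
  derivatives makes them positive on it, and compactness makes the bound uniform.\<close>

lemma ddiff_sum_lower_bound: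
  assumes c: "0 < c" "c \<le> b\<^sup>2"
  obtains c0 where "0 < c0"
    "\<And>x. x \<in> {0..b\<^sup>2} \<Longrightarrow> c0 \<le> ddiff \<psi>1 (\<psi>1' c) c x + ddiff \<psi>2 (\<psi>2' c) c x"
proof -
  let ?a = "\<lambda>x. ddiff \<psi>1 (\<psi>1' c) c x + ddiff \<psi>2 (\<psi>2' c) c x"
  have cin: "c \<in> {0<..b\<^sup>2}" using c by simp
  note r1 = sqrt_comp_regular[OF derf_all contf'] and r2 = sqrt_comp_regular[OF derg_all contg']
  have cont: "continuous_on {0..b\<^sup>2} ?a"
    by (intro continuous_intros continuous_on_ddiff r1(1)[OF cin] r2(1)[OF cin] r1(3) r2(3))
  have apos: "0 < ?a x" if x: "x \<in> {0..b\<^sup>2}" for x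
  proof (cases x c rule: linorder_cases)
    case equal
    have "sqrt c \<in> {0<..b}" using sqrt_range[of c] c by simp
    then have "0 < (f' (sqrt c) + g' (sqrt c)) * (inverse (sqrt c) / 2)"
      using pos c by (intro mult_pos_pos) auto
    then show ?thesis using equal by (simp add: ddiff_def algebra_simps)
  next
    case less
    have "f (sqrt x) + g (sqrt x) < f (sqrt c) + g (sqrt c)"
      by (rule strict_mono_onD[OF strict]) (use sqrt_range x c less in auto)
    then have "(f (sqrt x) - f (sqrt c)) + (g (sqrt x) - g (sqrt c)) < 0" by simp
    then have "0 < ((f (sqrt x) - f (sqrt c)) + (g (sqrt x) - g (sqrt c))) / (x - c)"
      using less by (intro divide_neg_neg) auto
    then show ?thesis using less by (simp add: ddiff_def add_divide_distrib)
  next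
    case greater
    have "f (sqrt c) + g (sqrt c) < f (sqrt x) + g (sqrt x)"
      by (rule strict_mono_onD[OF strict]) (use sqrt_range x c greater in auto)
    then have "0 < ((f (sqrt x) - f (sqrt c)) + (g (sqrt x) - g (sqrt c))) / (x - c)"
      using greater by (intro divide_pos_pos) auto
    then show ?thesis using greater by (simp add: ddiff_def add_divide_distrib)
  qed
  obtain x0 where x0: "x0 \<in> {0..b\<^sup>2}" "\<forall>x\<in>{0..b\<^sup>2}. ?a x0 \<le> ?a x"
    using continuous_attains_inf[OF compact_Icc _ cont] by force
  show thesis by (rule that[of "?a x0"]) (use x0 apos in auto)
qed

text \<open>The limit of the normalised derivative of $\|W\|^2$ is a quadratic form with the coefficients
  $-(a_1 + a_2)(|\nu|^2)\,|\nu - \mu|^2$ in an eigenbasis of the normal limit.\<close>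

lemma obliqueness_rate_limit:
  fixes X E F W :: "nat \<Rightarrow> complex ^ 'n ^ 'n"
  assumes X: "X \<longlonglongrightarrow> N" "\<And>m. op_bounded b (X m)" and N: "normal_matrix N"
    and obl: "\<And>m. oblique_idempotent (E m) (F m) (W m)" and comm: "\<And>m. X m ** E m = E m ** X m"
    and W0: "\<And>m. W m \<noteq> 0" "W \<longlonglongrightarrow> 0" and F: "F \<longlonglongrightarrow> F0"
    and eig: "N ** F0 = mat \<mu> ** F0" and \<mu>: "\<mu> \<noteq> 0" "cmod \<mu> \<le> b"
    and w: "(\<lambda>m. (1 / norm (W m)) *\<^sub>R W m) \<longlonglongrightarrow> w"
    and nz: "(N - mat \<mu>) ** cadjoint w \<noteq> 0"
  obtains l where "l < 0"
    "(\<lambda>m. inner (phi_matrix f g (X m)) (E m ** cadjoint (E m) - cadjoint (E m) ** E m) / (norm (W m))\<^sup>2) \<longlonglongrightarrow> l"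
proof -
  define r c where "r = cmod \<mu>" and "c = r\<^sup>2"
  have r: "0 < r" "r \<le> b" using \<mu> by (simp_all add: r_def)
  have c: "0 < c" "c \<le> b\<^sup>2" using r by (auto simp: c_def intro: power_mono)
  have \<mu>c: "cnj \<mu> * \<mu> = complex_of_real c"
    using complex_norm_square[of \<mu>] by (simp add: c_def r_def mult.commute)
  have \<mu>c': "\<mu> * cnj \<mu> = complex_of_real c" using \<mu>c by (simp add: mult.commute)
  have b0: "0 \<le> b" using b by simp
  note r1 = sqrt_comp_regular[OF derf_all contf'] and r2 = sqrt_comp_regular[OF derg_all contg']
  define \<rho> where "\<rho> m = norm (W m)" for m
  have \<rho>: "0 < \<rho> m" for m using W0(1) by (simp add: \<rho>_def)
  define wm where "wm m = (1 / \<rho> m) *\<^sub>R W m" for m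
  have wm: "wm \<longlonglongrightarrow> w" using w by (simp add: wm_def[abs_def] \<rho>_def)
  define v where "v = cadjoint w"
  have vm: "(\<lambda>m. cadjoint (wm m)) \<longlonglongrightarrow> v" unfolding v_def by (intro tendsto_intros wm)
  (* The scalar r on the complement makes Y*Y and Y Y* tend to the single scalar c = r^2,
     while r \<le> b keeps Y in the domain. *)
  define Y where "Y m = X m ** F m + mat (complex_of_real r) ** (mat 1 - F m)" for m
  define P1 P2 Q1 Q2 where "P1 m = cadjoint (X m) ** X m" and "P2 m = X m ** cadjoint (X m)"
    and "Q1 m = cadjoint (Y m) ** Y m" and "Q2 m = Y m ** cadjoint (Y m)" for m
  define \<Pi>0 where "\<Pi>0 = cadjoint N ** N"
  have \<Pi>': "\<Pi>0 = N ** cadjoint N" using N by (simp add: \<Pi>0_def normal_matrix_def)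
  have bN: "op_bounded b N" by (rule op_bounded_limit[OF X])
  have s\<Pi>: "spec_in {0..b\<^sup>2} \<Pi>0" unfolding \<Pi>0_def by (rule spec_in_gram(1)[OF bN b0])
  have bY: "op_bounded b (Y m)" for m
    by (rule oblique_idempotent.block_op_bounded[OF obl comm Y_def X(2)]) (use r in auto)
  have sP: "spec_in {0..b\<^sup>2} (P1 m)" "spec_in {0..b\<^sup>2} (P2 m)" for m
    unfolding P1_def P2_def by (rule spec_in_gram[OF X(2) b0])+
  have sQ: "spec_in {0..b\<^sup>2} (Q1 m)" "spec_in {0..b\<^sup>2} (Q2 m)" for m
    unfolding Q1_def Q2_def by (rule spec_in_gram[OF bY b0])+
  have P: "P1 \<longlonglongrightarrow> \<Pi>0" "P2 \<longlonglongrightarrow> \<Pi>0"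
  proof -
    show "P1 \<longlonglongrightarrow> \<Pi>0" unfolding P1_def \<Pi>0_def by (intro tendsto_intros X)
    show "P2 \<longlonglongrightarrow> \<Pi>0" unfolding P2_def \<Pi>' by (intro tendsto_intros X)
  qed
  note oF = oblique_idempotent.F[OF obl]
  have F0h: "cadjoint F0 = F0"
    by (rule LIMSEQ_unique[OF tendsto_cadjoint[OF F]]) (use F oF(1) in simp)
  have F0i: "F0 ** F0 = F0"
    by (rule LIMSEQ_unique[OF tendsto_matrix_mult[OF F F]]) (use F oF(2) in simp)
  have F0w: "F0 ** w = w"
  proof (rule LIMSEQ_unique[OF tendsto_matrix_mult[OF F wm]])
    have "F m ** wm m = wm m" for m
      using oblique_idempotent.FW[OF obl, of m] by (simp add: wm_def mmult.scaleR_right)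
    then show "(\<lambda>m. F m ** wm m) \<longlonglongrightarrow> w" using wm by simp
  qed
  have vF: "v ** F0 = v" using arg_cong[OF F0w, of cadjoint] by (simp add: v_def cadjoint_mult F0h)
  have eigs: "cadjoint N ** F0 = mat (cnj \<mu>) ** F0"
  proof -
    have "(N - mat \<mu>) ** F0 = 0" by (simp add: mmult.diff_left eig)
    then have "cadjoint (N - mat \<mu>) ** F0 = 0"
      using normal_norm[OF normal_diff_mat[OF N], of \<mu> F0] by simp
    then show ?thesis by (simp add: cadjoint_diff cadjoint_mat mmult.diff_left)
  qed
  have Q: "Q1 \<longlonglongrightarrow> mat (complex_of_real c)" "Q2 \<longlonglongrightarrow> mat (complex_of_real c)"
  proof -
    define Y0 where "Y0 = mat \<mu> ** F0 + mat (complex_of_real r) ** (mat 1 - F0)"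
    have Y: "Y \<longlonglongrightarrow> Y0" unfolding Y_def Y0_def eig[symmetric] by (intro tendsto_intros X F)
    have Y0s: "cadjoint Y0 = mat (cnj \<mu>) ** F0 + mat (complex_of_real r) ** (mat 1 - F0)"
      unfolding Y0_def cadjoint_add cadjoint_mult cadjoint_mat cadjoint_diff F0h cadjoint_one
      by (simp add: mat_commute[of F0] mat_commute[of "mat 1 - F0"])
    have rr: "complex_of_real r * complex_of_real r = complex_of_real c"
      by (simp add: c_def power2_eq_square)
    have "cadjoint Y0 ** Y0 = mat (complex_of_real c)" "Y0 ** cadjoint Y0 = mat (complex_of_real c)"
      unfolding Y0s unfolding Y0_def by (rule block_scalar_mult[OF F0i _ rr]; use \<mu>c in \<open>simp add: mult.commute\<close>)+
    then show "Q1 \<longlonglongrightarrow> mat (complex_of_real c)" "Q2 \<longlonglongrightarrow> mat (complex_of_real c)"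
      unfolding Q1_def Q2_def using tendsto_matrix_mult[OF tendsto_cadjoint[OF Y] Y] tendsto_matrix_mult[OF Y tendsto_cadjoint[OF Y]]
      by simp_all
  qed
  define \<beta> where "\<beta> m = cadjoint (wm m) ** cadjoint (X m) - cadjoint (X m) ** cadjoint (wm m)" for m
  define \<beta>0 where "\<beta>0 = v ** cadjoint N - cadjoint N ** v"
  have \<beta>: "\<beta> \<longlonglongrightarrow> \<beta>0" unfolding \<beta>_def \<beta>0_def by (intro tendsto_intros vm X)
  have \<beta>W: "(1 / \<rho> m) *\<^sub>R (cadjoint (W m) ** cadjoint (X m) - cadjoint (X m) ** cadjoint (W m)) = \<beta> m" for m
    by (simp add: \<beta>_def wm_def cadjoint_scaleR mmult.scaleR_left mmult.scaleR_right scaleR_diff_right)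
  have "(1 / \<rho> m) *\<^sub>R (P1 m ** F m - F m ** Q1 m) = \<beta> m ** (X m ** F m)" for m
    unfolding P1_def Q1_def oblique_idempotent.block_triangular(2)[OF obl comm Y_def] \<beta>W[symmetric] mmult.scaleR_left ..
  then have \<Gamma>1: "(\<lambda>m. (1 / \<rho> m) *\<^sub>R (P1 m ** F m - F m ** Q1 m)) \<longlonglongrightarrow> \<beta>0 ** (N ** F0)"
    by (simp only:) (intro tendsto_intros \<beta> X F)
  have "(1 / \<rho> m) *\<^sub>R (P2 m ** F m - F m ** Q2 m) = X m ** \<beta> m" for m
    unfolding P2_def Q2_def oblique_idempotent.block_triangular(3)[OF obl comm Y_def] \<beta>W[symmetric] mmult.scaleR_right ..
  then have \<Gamma>2: "(\<lambda>m. (1 / \<rho> m) *\<^sub>R (P2 m ** F m - F m ** Q2 m)) \<longlonglongrightarrow> N ** \<beta>0"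
    by (simp only:) (intro tendsto_intros \<beta> X)
  define A1 A2 where "A1 = hermitian_fun (ddiff \<psi>1 (\<psi>1' c) c) \<Pi>0" and "A2 = hermitian_fun (ddiff \<psi>2 (\<psi>2' c) c) \<Pi>0"
  define D1 D2 where "D1 m = (1 / \<rho> m) *\<^sub>R (hermitian_fun \<psi>1 (P1 m) ** F m - F m ** hermitian_fun \<psi>1 (Q1 m))"
    and "D2 m = (1 / \<rho> m) *\<^sub>R (hermitian_fun \<psi>2 (P2 m) ** F m - F m ** hermitian_fun \<psi>2 (Q2 m))" for m
  have D1: "D1 \<longlonglongrightarrow> A1 ** (\<beta>0 ** (N ** F0))"
    unfolding D1_def A1_def
    by (rule intertwined_linearisation[OF c r1(1) r1(2) r1(3) sP(1) s\<Pi> P(1) sQ(1) Q(1) \<rho> \<Gamma>1])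
  have D2: "D2 \<longlonglongrightarrow> A2 ** (N ** \<beta>0)"
    unfolding D2_def A2_def
    by (rule intertwined_linearisation[OF c r2(1) r2(2) r2(3) sP(2) s\<Pi> P(2) sQ(2) Q(2) \<rho> \<Gamma>2])
  define phi where "phi m = phi_matrix f g (X m)" for m
  have phi_eq: "phi m = hermitian_fun \<psi>1 (P1 m) - hermitian_fun \<psi>2 (P2 m)" for m
    unfolding phi_def P1_def P2_def by (rule phi_matrix_gram)
  have phi: "phi \<longlonglongrightarrow> phi_matrix f g N"
    unfolding phi_def
    by (rule isCont_tendsto_compose[OF continuous_on_interior[OF continuous_phi_matrix[OF lip]] X(1)]) simp
  (* The part of E E* - E* E of first order in W also contributes at second order,
     because it is paired with the intertwining defects D1 and D2. *)
  have quotient: "inner (phi m) (E m ** cadjoint (E m) - cadjoint (E m) ** E m) / (norm (W m))\<^sup>2 =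
      inner (phi m) (wm m ** cadjoint (wm m) - cadjoint (wm m) ** wm m)
      - 2 * (inner (D1 m) (cadjoint (wm m)) - inner (D2 m) (cadjoint (wm m)))" for m
  proof -
    have h: "cadjoint (phi m) = phi m" by (simp add: phi_def)
    have "inner (phi m) (cadjoint (W m)) = inner (phi m) (W m)"
      using inner_cadjoint[of "phi m" "W m"] h by simp
    then have K: "inner (phi m) (E m ** cadjoint (E m) - cadjoint (E m) ** E m) =
        inner (phi m) (W m ** cadjoint (W m) - cadjoint (W m) ** W m) - 2 * inner (phi m) (W m)"
      unfolding oblique_idempotent.commutator_adjoint[OF obl] by (simp add: inner_diff_right)
    have H1: "inner (hermitian_fun \<psi>1 (P1 m)) (W m) = inner (hermitian_fun \<psi>1 (P1 m) ** F m - F m ** hermitian_fun \<psi>1 (Q1 m)) (cadjoint (W m))"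
      by (rule oblique_idempotent.inner_hermitian_W[OF obl]) (rule cadjoint_hermitian_fun[OF sP(1)])
    have H2: "inner (hermitian_fun \<psi>2 (P2 m)) (W m) = inner (hermitian_fun \<psi>2 (P2 m) ** F m - F m ** hermitian_fun \<psi>2 (Q2 m)) (cadjoint (W m))"
      by (rule oblique_idempotent.inner_hermitian_W[OF obl]) (rule cadjoint_hermitian_fun[OF sP(2)])
    have W: "W m = \<rho> m *\<^sub>R wm m" using \<rho>[of m] by (simp add: wm_def)
    have d1: "hermitian_fun \<psi>1 (P1 m) ** F m - F m ** hermitian_fun \<psi>1 (Q1 m) = \<rho> m *\<^sub>R D1 m"
      and d2: "hermitian_fun \<psi>2 (P2 m) ** F m - F m ** hermitian_fun \<psi>2 (Q2 m) = \<rho> m *\<^sub>R D2 m"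
      using \<rho>[of m] by (simp_all add: D1_def D2_def)
    have "inner (phi m) (W m) = (\<rho> m)\<^sup>2 * (inner (D1 m) (cadjoint (wm m)) - inner (D2 m) (cadjoint (wm m)))"
      unfolding phi_eq inner_diff_left H1 H2 d1 d2 unfolding W cadjoint_scaleR
      by (simp add: power2_eq_square algebra_simps)
    moreover have "inner (phi m) (W m ** cadjoint (W m) - cadjoint (W m) ** W m) =
        (\<rho> m)\<^sup>2 * inner (phi m) (wm m ** cadjoint (wm m) - cadjoint (wm m) ** wm m)"
      unfolding W cadjoint_scaleR mmult.scaleR_left mmult.scaleR_right inner_diff_right inner_scaleR_right
      by (simp add: power2_eq_square algebra_simps)
    ultimately have "inner (phi m) (E m ** cadjoint (E m) - cadjoint (E m) ** E m) =
        (\<rho> m)\<^sup>2 * (inner (phi m) (wm m ** cadjoint (wm m) - cadjoint (wm m) ** wm m)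
         - 2 * (inner (D1 m) (cadjoint (wm m)) - inner (D2 m) (cadjoint (wm m))))"
      unfolding K by (simp add: algebra_simps)
    then show ?thesis using \<rho>[of m] unfolding \<rho>_def[symmetric] by simp
  qed
  define l where "l = inner (phi_matrix f g N) (w ** v - v ** w)
      - 2 * (inner (A1 ** (\<beta>0 ** (N ** F0))) v - inner (A2 ** (N ** \<beta>0)) v)"
  have lim: "(\<lambda>m. inner (phi m) (E m ** cadjoint (E m) - cadjoint (E m) ** E m) / (norm (W m))\<^sup>2) \<longlonglongrightarrow> l"
    unfolding quotient l_def by (intro tendsto_intros phi wm vm D1 D2)
  define y where "y = (N - mat \<mu>) ** v"
  have "l < 0"
  proof -
    have vw: "inner w w = inner v v" by (simp add: v_def)
    have eigw: "N ** w = mat \<mu> ** w" "cadjoint N ** w = mat (cnj \<mu>) ** w"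
    proof -
      have "N ** (F0 ** w) = mat \<mu> ** (F0 ** w)" by (simp only: matrix_mul_assoc eig)
      then show "N ** w = mat \<mu> ** w" by (simp only: F0w)
      have "cadjoint N ** (F0 ** w) = mat (cnj \<mu>) ** (F0 ** w)" by (simp only: matrix_mul_assoc eigs)
      then show "cadjoint N ** w = mat (cnj \<mu>) ** w" by (simp only: F0w)
    qed
    have vN: "v ** cadjoint N = mat (cnj \<mu>) ** v"
      using arg_cong[OF eigw(1), of cadjoint] by (simp add: cadjoint_mult cadjoint_mat v_def mat_commute[of "cadjoint w"])
    have "\<Pi>0 ** w = cadjoint N ** (N ** w)" by (simp add: \<Pi>0_def matrix_mul_assoc)
    also have "\<dots> = mat \<mu> ** (cadjoint N ** w)"
      unfolding eigw(1) by (simp only: matrix_mul_assoc mat_commute[of "cadjoint N" \<mu>])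
    also have "\<dots> = mat (complex_of_real c) ** w"
      unfolding eigw(2) matrix_mul_assoc mat_mult_mat using \<mu>c by (simp add: mult.commute)
    finally have \<Pi>w: "\<Pi>0 ** w = w ** mat (complex_of_real c)" by (simp only: mat_commute[of w])
    have sc: "spec_in {0..b\<^sup>2} (mat (complex_of_real c) :: complex ^ 'n ^ 'n)"
      by (rule spec_in_mat) (use c in simp)
    have hw: "hermitian_fun \<psi> \<Pi>0 ** w = \<psi> c *\<^sub>R w" for \<psi>
      using hermitian_fun_intertwine[OF s\<Pi> sc \<Pi>w, of \<psi>]
      by (simp add: hermitian_fun_mat mat_commute[of w] mat_of_real)
    have phiN: "phi_matrix f g N = hermitian_fun \<psi>1 \<Pi>0 - hermitian_fun \<psi>2 \<Pi>0"
      unfolding phi_matrix_gram \<Pi>0_def[symmetric] \<Pi>'[symmetric] ..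
    have T0: "inner (phi_matrix f g N) (w ** v) = (\<psi>1 c - \<psi>2 c) * inner v v"
    proof -
      have "inner (w ** v) (phi_matrix f g N) = inner w (phi_matrix f g N ** w)"
        unfolding inner_mult_right by (simp add: v_def)
      then show ?thesis
        unfolding phiN mmult.diff_left hw by (simp add: inner_commute inner_diff_right vw left_diff_distrib)
    qed
    define q where "q A Z = inner v (A ** Z)" for A Z :: "complex ^ 'n ^ 'n"
    have q_diff: "q A (Z1 - Z2) = q A Z1 - q A Z2" and q_add: "q A (Z1 + Z2) = q A Z1 + q A Z2"
      and q_scale: "q A (t *\<^sub>R Z1) = t * q A Z1" for A Z1 Z2 t
      by (simp_all add: q_def mmult.diff_right mmult.add_right mmult.scaleR_right inner_diff_right inner_add_right)
    have q_flip: "inner (A ** Z) v = q A Z" for A Z unfolding q_def by (rule inner_commute)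
    have hv: "hermitian_fun \<psi> \<Pi>0 ** v = \<psi> c *\<^sub>R v + hermitian_fun (ddiff \<psi> d c) \<Pi>0 ** (\<Pi>0 ** v - c *\<^sub>R v)" for \<psi> d
    proof -
      have "hermitian_fun \<psi> \<Pi>0 = hermitian_fun (\<lambda>x. \<psi> c + ddiff \<psi> d c x * (x - c)) \<Pi>0"
        by (rule hermitian_fun_cong[OF s\<Pi>]) (simp add: ddiff_mult[symmetric])
      also have "\<dots> = mat (complex_of_real (\<psi> c)) + hermitian_fun (ddiff \<psi> d c) \<Pi>0 ** (\<Pi>0 - mat (complex_of_real c))"
        unfolding hermitian_fun_add[OF s\<Pi>] hermitian_fun_mult[OF s\<Pi>, symmetric] hermitian_fun_diff[OF s\<Pi>]
          hermitian_fun_const[OF s\<Pi>] hermitian_fun_id[OF s\<Pi>] ..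
      finally show ?thesis
        by (simp only: mmult.add_left mmult.diff_left matrix_mul_assoc[symmetric] mat_of_real)
    qed
    have T1: "inner (phi_matrix f g N) (v ** w) =
        \<psi>1 c * inner v v + (q A1 (\<Pi>0 ** v) - c * q A1 v) - (\<psi>2 c * inner v v + (q A2 (\<Pi>0 ** v) - c * q A2 v))"
    proof -
      have "inner (v ** w) (phi_matrix f g N) = inner v (phi_matrix f g N ** v)"
        unfolding inner_mult_right by (simp add: v_def)
      also have "phi_matrix f g N ** v = (\<psi>1 c *\<^sub>R v + A1 ** (\<Pi>0 ** v - c *\<^sub>R v)) - (\<psi>2 c *\<^sub>R v + A2 ** (\<Pi>0 ** v - c *\<^sub>R v))"
        unfolding phiN mmult.diff_left A1_def A2_def by (simp only: hv[of \<psi>1 "\<psi>1' c"] hv[of \<psi>2 "\<psi>2' c"])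
      also have "inner v \<dots> = \<psi>1 c * inner v v + q A1 (\<Pi>0 ** v - c *\<^sub>R v) - (\<psi>2 c * inner v v + q A2 (\<Pi>0 ** v - c *\<^sub>R v))"
        by (simp add: q_def inner_diff_right inner_add_right)
      finally show ?thesis unfolding q_diff q_scale by (simp add: inner_commute)
    qed
    have \<beta>v: "\<beta>0 = mat (cnj \<mu>) ** v - cadjoint N ** v" by (simp add: \<beta>0_def vN)
    have \<beta>F: "\<beta>0 ** F0 = \<beta>0" unfolding \<beta>v mmult.diff_left by (simp only: matrix_mul_assoc[symmetric] vF)
    have "\<beta>0 ** (N ** F0) = mat \<mu> ** (\<beta>0 ** F0)"
      unfolding eig by (simp only: matrix_mul_assoc mat_commute[of \<beta>0 \<mu>])
    also have "\<dots> = mat \<mu> ** (mat (cnj \<mu>) ** v) - mat \<mu> ** (cadjoint N ** v)"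
      unfolding \<beta>F unfolding \<beta>v mmult.diff_right ..
    also have "mat \<mu> ** (mat (cnj \<mu>) ** v) = c *\<^sub>R v"
    proof -
      have "mat \<mu> ** (mat (cnj \<mu>) ** v) = mat (\<mu> * cnj \<mu>) ** v"
        by (simp only: matrix_mul_assoc mat_mult_mat)
      also have "mat (\<mu> * cnj \<mu>) = (mat (complex_of_real c) :: complex ^ 'n ^ 'n)"
        using \<mu>c' by (rule arg_cong)
      finally show ?thesis unfolding mat_of_real .
    qed
    finally have g1: "\<beta>0 ** (N ** F0) = c *\<^sub>R v - mat \<mu> ** (cadjoint N ** v)" .
    have g2: "N ** \<beta>0 = mat (cnj \<mu>) ** (N ** v) - \<Pi>0 ** v"
      unfolding \<beta>v mmult.diff_right \<Pi>' by (simp add: matrix_mul_assoc mat_commute[of N])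
    define S T T' C where "S A = q A (\<Pi>0 ** v)" and "T A = q A (mat \<mu> ** (cadjoint N ** v))"
      and "T' A = q A (mat (cnj \<mu>) ** (N ** v))" and "C A = q A v" for A
    have l_eq: "l = (\<psi>1 c - \<psi>2 c) * inner v v
        - (\<psi>1 c * inner v v + (S A1 - c * C A1) - (\<psi>2 c * inner v v + (S A2 - c * C A2)))
        - 2 * ((c * C A1 - T A1) - (T' A2 - S A2))"
      unfolding l_def inner_diff_right T0 T1 g1 g2 q_flip q_diff q_scale S_def T_def T'_def C_def ..
    have form: "T A = T' A \<and> inner y (A ** y) = S A - T A - T' A + c * C A"
      if A: "cadjoint A = A" "A ** N = N ** A" "A ** cadjoint N = cadjoint N ** A" for A
    proof
      have "T A = inner (A ** v) (mat \<mu> ** (cadjoint N ** v))"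
        unfolding T_def q_def by (rule inner_hermitian_mult_self[OF A(1), symmetric])
      also have "\<dots> = inner (N ** (mat (cnj \<mu>) ** (A ** v))) v"
      proof -
        have "inner (N ** (mat (cnj \<mu>) ** (A ** v))) v = inner (mat (cnj \<mu>) ** (A ** v)) (cadjoint N ** v)"
          by (rule inner_mult_left)
        also have "\<dots> = inner (A ** v) (cadjoint (mat (cnj \<mu>)) ** (cadjoint N ** v))"
          by (rule inner_mult_left)
        finally show ?thesis by (simp only: cadjoint_mat complex_cnj_cnj)
      qed
      also have "N ** (mat (cnj \<mu>) ** (A ** v)) = mat (cnj \<mu>) ** (N ** A) ** v"
        by (simp only: matrix_mul_assoc mat_commute[of N])
      also have "\<dots> = A ** (mat (cnj \<mu>) ** (N ** v))"
        unfolding A(2)[symmetric] by (simp only: matrix_mul_assoc mat_commute[of A])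
      finally show "T A = T' A" by (simp add: T'_def q_def inner_commute)
      have "inner y (A ** y) = inner v (cadjoint (N - mat \<mu>) ** (A ** y))"
        unfolding y_def by (rule inner_mult_left)
      also have "cadjoint (N - mat \<mu>) ** (A ** y) = A ** (cadjoint (N - mat \<mu>) ** y)"
        unfolding cadjoint_diff cadjoint_mat mmult.diff_left mmult.diff_right
        by (simp only: matrix_mul_assoc A(3) mat_commute[of A])
      also have "cadjoint (N - mat \<mu>) ** y = \<Pi>0 ** v - mat \<mu> ** (cadjoint N ** v) - mat (cnj \<mu>) ** (N ** v) + c *\<^sub>R v"
        unfolding y_def cadjoint_diff cadjoint_mat mmult.diff_left mmult.diff_right \<Pi>0_def
        by (simp add: matrix_mul_assoc mat_commute[of "cadjoint N"] mat_mult_mat \<mu>c \<mu>c' mat_of_real algebra_simps)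
      finally show "inner y (A ** y) = S A - T A - T' A + c * C A"
        unfolding q_def[symmetric] q_add q_diff q_scale S_def T_def T'_def C_def .
    qed
    have comms: "\<Pi>0 ** N = N ** \<Pi>0" "\<Pi>0 ** cadjoint N = cadjoint N ** \<Pi>0"
    proof -
      show "\<Pi>0 ** N = N ** \<Pi>0" by (subst \<Pi>') (simp add: \<Pi>0_def matrix_mul_assoc)
      show "\<Pi>0 ** cadjoint N = cadjoint N ** \<Pi>0" by (subst (2) \<Pi>') (simp add: \<Pi>0_def matrix_mul_assoc)
    qed
    have fA: "T A = T' A \<and> inner y (A ** y) = S A - T A - T' A + c * C A"
      if "A = hermitian_fun a \<Pi>0" for A a
      unfolding that by (rule form[OF cadjoint_hermitian_fun[OF s\<Pi>] hermitian_fun_intertwine[OF s\<Pi> s\<Pi> comms(1)]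
        hermitian_fun_intertwine[OF s\<Pi> s\<Pi> comms(2)]])
    have l_form: "l = - (inner y (A1 ** y) + inner y (A2 ** y))"
      unfolding l_eq using fA[OF A1_def] fA[OF A2_def] by (simp add: algebra_simps)
    obtain c0 where c0: "0 < c0"
      "\<And>x. x \<in> {0..b\<^sup>2} \<Longrightarrow> c0 \<le> ddiff \<psi>1 (\<psi>1' c) c x + ddiff \<psi>2 (\<psi>2' c) c x"
      by (rule ddiff_sum_lower_bound[OF c]) blast
    have "c0 * (norm y)\<^sup>2 \<le> inner (hermitian_fun (\<lambda>x. ddiff \<psi>1 (\<psi>1' c) c x + ddiff \<psi>2 (\<psi>2' c) c x) \<Pi>0 ** y) y"
      by (rule hermitian_fun_lower[OF s\<Pi>]) (rule c0(2))
    also have "\<dots> = inner y (A1 ** y) + inner y (A2 ** y)"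
      unfolding hermitian_fun_add[OF s\<Pi>] A1_def[symmetric] A2_def[symmetric] mmult.add_left inner_add_left
      by (simp only: inner_commute[of "A1 ** y" y] inner_commute[of "A2 ** y" y])
    finally have "c0 * (norm y)\<^sup>2 \<le> inner y (A1 ** y) + inner y (A2 ** y)" .
    moreover have "0 < c0 * (norm y)\<^sup>2" using c0(1) nz by (simp add: y_def v_def)
    ultimately show ?thesis unfolding l_form by linarith
  qed
  from that[OF this] lim show thesis by (simp add: phi_def)
qed

end

section \<open>Convergence of the flow\<close>

lemma norm_mat_mult: "norm (mat \<mu> ** A) = cmod \<mu> * norm A"
  for A :: "complex ^ 'n ^ 'n"
proof -
  have "(norm (mat \<mu> ** A))\<^sup>2 = (cmod \<mu> * norm A)\<^sup>2"
    unfolding power_mult_distrib norm_matrix_sq mat_mult_component norm_mult sum_distrib_left ..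
  then show ?thesis by (rule power2_eq_imp_eq) simp_all
qed

lemma inner_commutator_self:
  fixes H E :: "complex ^ 'n ^ 'n"
  assumes H: "cadjoint H = H"
  shows "inner E (commutator H E) = inner H (E ** cadjoint E - cadjoint E ** E)"
    and "inner (mat 1) (commutator H E) = 0"
proof -
  have 1: "inner E (H ** E) = inner H (E ** cadjoint E)"
    using inner_mult_right[of H E E] by (simp add: inner_commute)
  have 2: "inner E (E ** H) = inner H (cadjoint E ** E)"
    using inner_mult_left[of E H E] by (simp add: inner_commute)
  show "inner E (commutator H E) = inner H (E ** cadjoint E - cadjoint E ** E)"
    unfolding commutator_def inner_diff_right 1 2 ..
  have 3: "inner (mat 1) (H ** E) = inner H E"
    using inner_hermitian_mult_self[OF H, of "mat 1" E] by simp
  have "inner (E ** H) (mat 1) = inner E H"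
    unfolding inner_mult_right H by simp
  then have 4: "inner (mat 1) (E ** H) = inner H E" by (simp add: inner_commute)
  show "inner (mat 1) (commutator H E) = 0"
    unfolding commutator_def inner_diff_right 3 4 by simp
qed

locale smooth_flow = smooth_pair f g f' g' L b + flow_trajectory f g L b X
  for f g f' g' :: "real \<Rightarrow> real" and L b and X :: "real \<Rightarrow> complex ^ 'n ^ 'n"
begin

text \<open>Replacing $X$ by the matrix $Z = X - FX(1-F)$, which commutes with $F$, costs only $O(\|W\|)$; hence a
  Riesz projection moves with speed $O(\|W\|)$.\<close>

lemma commutator_phi_idempotent_le:
  fixes E F W Y :: "complex ^ 'n ^ 'n"
  assumes obl: "oblique_idempotent E F W" and comm: "Y ** E = E ** Y"
    and YR: "norm Y \<le> R" and M: "norm (phi_matrix f g Y) \<le> M"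
  shows "norm (commutator (phi_matrix f g Y) E) \<le> (8 * sqrt 2 * L * R * norm (mat 1 :: complex ^ 'n ^ 'n) + 2 * M) * norm W"
proof -
  note F = oblique_idempotent.F[OF obl] and E_eq = oblique_idempotent.E_eq[OF obl]
  have L0: "0 \<le> L" using lip(1) by (simp add: lipschitz_nonneg_def)
  have R0: "0 \<le> R" using YR norm_ge_zero[of Y] by linarith
  have FYF: "F ** (Y ** F) = Y ** F"
    by (rule oblique_idempotent.block_triangular(1)[OF obl comm refl])
  define Z where "Z = Y - (F ** Y - Y ** F)"
  have ZF: "Z ** F = F ** Z"
    unfolding Z_def mmult.diff_left mmult.diff_right
    using FYF by (simp add: matrix_mul_assoc F(2)) (simp add: matrix_mul_assoc[symmetric] F(2))
  have ZsF: "cadjoint Z ** F = F ** cadjoint Z"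
    using arg_cong[OF ZF, of cadjoint] by (simp add: cadjoint_mult F(1))
  have P: "cadjoint Z ** Z ** F = F ** (cadjoint Z ** Z)"
    by (simp only: matrix_mul_assoc[symmetric] ZF) (simp only: matrix_mul_assoc ZsF)
  have Q: "Z ** cadjoint Z ** F = F ** (Z ** cadjoint Z)"
    by (simp only: matrix_mul_assoc[symmetric] ZsF) (simp only: matrix_mul_assoc ZF)
  have phiZ: "phi_matrix f g Z ** F = F ** phi_matrix f g Z"
    unfolding phi_matrix_gram mmult.diff_left mmult.diff_right
    using hermitian_fun_intertwine[OF spec_in_gram_nonneg(1) spec_in_gram_nonneg(1) P]
      hermitian_fun_intertwine[OF spec_in_gram_nonneg(2) spec_in_gram_nonneg(2) Q] by simp
  have "Y ** F + Y ** W = F ** Y + W ** Y"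
    using comm unfolding E_eq mmult.add_left mmult.add_right .
  then have "Y - Z = commutator Y W" by (simp add: Z_def commutator_def algebra_simps)
  then have "norm (Y - Z) \<le> 2 * norm Y * norm W" using norm_commutator_le[of Y W] by simp
  also have "\<dots> \<le> 2 * R * norm W" using YR by (intro mult_right_mono) auto
  finally have YZ: "norm (Y - Z) \<le> 2 * R * norm W" .
  have Fn: "norm F \<le> norm (mat 1 :: complex ^ 'n ^ 'n)"
  proof -
    have "inner F F = inner (mat 1) F"
      using inner_hermitian_mult_self[OF F(1), of "mat 1" F] by (simp add: F(2))
    also have "\<dots> \<le> norm (mat 1 :: complex ^ 'n ^ 'n) * norm F" by (rule norm_cauchy_schwarz)
    finally have "norm F * norm F \<le> norm (mat 1 :: complex ^ 'n ^ 'n) * norm F"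
      by (simp add: power2_norm_eq_inner[symmetric] power2_eq_square)
    then show ?thesis by (cases "F = 0") auto
  qed
  have "norm (phi_matrix f g Y - phi_matrix f g Z) \<le> 2 * sqrt 2 * L * norm (Y - Z)"
    by (rule phi_matrix_lipschitz[OF lip])
  also have "\<dots> \<le> 2 * sqrt 2 * L * (2 * R * norm W)" using YZ L0 by (intro mult_left_mono) auto
  finally have dphi: "norm (phi_matrix f g Y - phi_matrix f g Z) \<le> 2 * sqrt 2 * L * (2 * R * norm W)" .
  have "commutator (phi_matrix f g Y) E =
      commutator (phi_matrix f g Y - phi_matrix f g Z) F + commutator (phi_matrix f g Y) W"
    unfolding commutator_def E_eq mmult.add_left mmult.add_right mmult.diff_left mmult.diff_right phiZ by simp
  then have "norm (commutator (phi_matrix f g Y) E) \<le>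
      norm (commutator (phi_matrix f g Y - phi_matrix f g Z) F) + norm (commutator (phi_matrix f g Y) W)"
    using norm_triangle_ineq[of "commutator (phi_matrix f g Y - phi_matrix f g Z) F" "commutator (phi_matrix f g Y) W"] by simp
  also have "\<dots> \<le> 2 * norm (phi_matrix f g Y - phi_matrix f g Z) * norm F + 2 * norm (phi_matrix f g Y) * norm W"
    by (intro add_mono norm_commutator_le)
  also have "\<dots> \<le> 2 * (2 * sqrt 2 * L * (2 * R * norm W)) * norm (mat 1 :: complex ^ 'n ^ 'n) + 2 * M * norm W"
    using dphi Fn M L0 R0 order_trans[OF norm_ge_zero M] by (intro add_mono mult_mono) auto
  also have "\<dots> = (8 * sqrt 2 * L * R * norm (mat 1 :: complex ^ 'n ^ 'n) + 2 * M) * norm W"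
    by (simp add: algebra_simps)
  finally show ?thesis .
qed

lemma subsequence_limit:
  assumes s: "\<And>m. real m \<le> s m" and w: "\<And>m. norm (w m :: complex ^ 'n ^ 'n) \<le> 1"
  obtains r N w0 where "strict_mono r" "(\<lambda>m. X (s (r m))) \<longlonglongrightarrow> N" "(\<lambda>m. w (r m)) \<longlonglongrightarrow> w0"
    "normal_matrix N" "op_bounded b N" "filterlim (\<lambda>m. s (r m)) at_top sequentially"
proof -
  have s0: "0 \<le> s m" for m using s[of m] by linarith
  have "compact (cball (0 :: complex ^ 'n ^ 'n) R \<times> cball (0 :: complex ^ 'n ^ 'n) 1)"
    by (rule compact_Times[OF compact_cball compact_cball])
  then have "seq_compact (cball (0 :: complex ^ 'n ^ 'n) R \<times> cball (0 :: complex ^ 'n ^ 'n) 1)"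
    by (rule compact_eq_seq_compact_metric[THEN iffD1])
  moreover have "\<forall>m. (X (s m), w m) \<in> cball 0 R \<times> cball 0 1" using norm_X[OF s0] w by simp
  ultimately obtain l r where lr: "strict_mono (r :: nat \<Rightarrow> nat)" "((\<lambda>m. (X (s m), w m)) \<circ> r) \<longlonglongrightarrow> l"
    by (rule seq_compactE)
  have N: "(\<lambda>m. X (s (r m))) \<longlonglongrightarrow> fst l" and w0: "(\<lambda>m. w (r m)) \<longlonglongrightarrow> snd l"
    using tendsto_fst[OF lr(2)] tendsto_snd[OF lr(2)] by (simp_all add: o_def)
  have top: "filterlim (\<lambda>m. s (r m)) at_top sequentially"
  proof (rule filterlim_at_top_mono[OF filterlim_real_sequentially])
    have "real m \<le> s (r m)" for m
      by (rule order_trans[OF of_nat_mono[OF seq_suble[OF lr(1)]] s])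
    then show "\<forall>\<^sub>F m in sequentially. real m \<le> s (r m)" by simp
  qed
  show thesis by (rule that[OF lr(1) N w0 limit_point_normal[OF top N] top])
qed

text \<open>If no rate $c > 0$ with $(\|W\|^2)' \le -2c\|W\|^2$ held eventually, there would be times tending to infinity along
  which $X$ and $W/\|W\|$ converge and the normalised derivative has a limit $\ge 0$, contrary to
  \<open>obliqueness_rate_limit\<close>. The exponential decay of $\|W\|$ bounds the speed of $E$ by an
  integrable function.\<close>

lemma riesz_projection_cauchy:
  assumes q: "q \<noteq> 0" "poly_matrix q (X 0) = 0" and root: "poly q \<mu> = 0" and \<mu>: "\<mu> \<noteq> 0"
    and p: "q dvd p * p - p" "[:- \<mu>, 1:] ^ order \<mu> q dvd 1 - p" "q dvd [:- \<mu>, 1:] ^ order \<mu> q * p"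
    and "0 < \<epsilon>"
  obtains t1 where "0 \<le> t1"
    "\<And>s t. t1 \<le> s \<Longrightarrow> s \<le> t \<Longrightarrow> norm (poly_matrix p (X t) - poly_matrix p (X s)) \<le> \<epsilon>"
proof -
  define E where "E t = poly_matrix p (X t)" for t
  define H where "H t = phi_matrix f g (X t)" for t
  have Hh: "cadjoint (H t) = H t" for t by (simp add: H_def)
  have "order \<mu> q \<noteq> 0" using order_root[of q \<mu>] root q(1) by blast
  then have ord: "0 < order \<mu> q" by (rule neq0_conv[THEN iffD1])
  have p1: "poly p \<mu> = 1"
  proof -
    have "[:- \<mu>, 1:] dvd [:- \<mu>, 1:] ^ order \<mu> q" by (rule dvd_power[OF disjI1[OF ord]])
    then have "[:- \<mu>, 1:] dvd 1 - p" using p(2) by (rule dvd_trans)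
    then have "poly (1 - p) \<mu> = 0" by (rule poly_eq_0_iff_dvd[THEN iffD2])
    then show ?thesis by simp
  qed
  have idem_of: "poly_matrix p A ** poly_matrix p A = poly_matrix p A" if "poly_matrix q A = 0" for A :: "complex ^ 'n ^ 'n"
    using poly_matrix_dvd[OF p(1) that] unfolding poly_matrix_diff poly_matrix_mult right_minus_eq .
  have idem: "E t ** E t = E t" if "0 \<le> t" for t
    unfolding E_def by (rule idem_of[OF annihilated[OF q(2) that]])
  have comm: "X t ** E t = E t ** X t" for t
    unfolding E_def by (rule poly_matrix_commute) (rule refl)
  have "\<exists>F. 0 \<le> t \<longrightarrow> oblique_idempotent (E t) F (E t - F)" for t
  proof (cases "0 \<le> t")
    case True
    obtain F where "cadjoint F = F" "F ** F = F" "F ** E t = E t" "E t ** F = F"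
      by (rule range_projection_exists[OF idem[OF True]]) blast
    then have "oblique_idempotent (E t) F (E t - F)" by unfold_locales (assumption | rule refl)+
    then show ?thesis by (intro exI impI)
  qed simp
  then have "\<forall>t. \<exists>F. 0 \<le> t \<longrightarrow> oblique_idempotent (E t) F (E t - F)" by blast
  from choice[OF this] obtain F where F: "\<And>t. 0 \<le> t \<Longrightarrow> oblique_idempotent (E t) (F t) (E t - F t)" by blast
  define W where "W t = E t - F t" for t
  have obl: "oblique_idempotent (E t) (F t) (W t)" if "0 \<le> t" for t
    using F[OF that] by (simp add: W_def)
  define K where "K t = E t ** cadjoint (E t) - cadjoint (E t) ** E t" for t
  have rate: "\<exists>c>0. \<exists>t0\<ge>0. \<forall>t\<ge>t0. inner (H t) (K t) \<le> - c * (norm (W t))\<^sup>2"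
  proof (rule ccontr)
    assume neg: "\<not> ?thesis"
    have "\<exists>t. real m \<le> t \<and> - (1 / (real m + 1)) * (norm (W t))\<^sup>2 < inner (H t) (K t)" for m
    proof (rule ccontr)
      assume "\<not> ?thesis"
      then have le: "inner (H t) (K t) \<le> - (1 / (real m + 1)) * (norm (W t))\<^sup>2" if "real m \<le> t" for t
        using that by (meson not_less)
      have "0 < 1 / (real m + 1)" "0 \<le> real m" by simp_all
      with le have "\<exists>c>0. \<exists>t0\<ge>0. \<forall>t\<ge>t0. inner (H t) (K t) \<le> - c * (norm (W t))\<^sup>2"
        by (intro exI[of _ "1 / (real m + 1)"] exI[of _ "real m"] conjI allI impI)
      then show False using neg by (rule notE[rotated])
    qed
    then have "\<forall>m. \<exists>t. real m \<le> t \<and> - (1 / (real m + 1)) * (norm (W t))\<^sup>2 < inner (H t) (K t)" by blast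
    from choice[OF this] obtain s where s: "\<And>m. real m \<le> s m"
      "\<And>m. - (1 / (real m + 1)) * (norm (W (s m)))\<^sup>2 < inner (H (s m)) (K (s m))" by blast
    have s0: "0 \<le> s m" for m using s(1)[of m] by linarith
    have Wnz: "W (s m) \<noteq> 0" for m
    proof
      assume W: "W (s m) = 0"
      have "K (s m) = 0"
        unfolding K_def oblique_idempotent.commutator_adjoint[OF obl[OF s0]] W by (simp add: mmult.zero_left)
      then show False using s(2)[of m] W by simp
    qed
    define w where "w m = (1 / norm (W (s m))) *\<^sub>R W (s m)" for m
    have w1: "norm (w m) = 1" for m using Wnz by (simp add: w_def)
    obtain r N w0 where r: "strict_mono r" "(\<lambda>m. X (s (r m))) \<longlonglongrightarrow> N" "(\<lambda>m. w (r m)) \<longlonglongrightarrow> w0"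
      "normal_matrix N" "op_bounded b N" "filterlim (\<lambda>m. s (r m)) at_top sequentially"
      by (rule subsequence_limit[OF s(1), of w]) (use w1 in auto)
    have nw0: "norm w0 = 1"
      by (rule LIMSEQ_unique[OF tendsto_norm[OF r(3)]]) (simp add: w1)
    have ann: "poly_matrix q N = 0"
      by (rule LIMSEQ_unique[OF tendsto_poly_matrix[OF r(2)]]) (simp add: annihilated[OF q(2) s0])
    define E0 where "E0 = poly_matrix p N"
    have EE0: "(\<lambda>m. E (s (r m))) \<longlonglongrightarrow> E0" unfolding E_def E0_def by (rule tendsto_poly_matrix[OF r(2)])
    have E0h: "cadjoint E0 = E0"
      unfolding E0_def by (rule normal_idempotent_hermitian[OF normal_poly_matrix[OF r(4)] idem_of[OF ann]])
    have WW: "(\<lambda>m. W (s (r m))) \<longlonglongrightarrow> 0"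
    proof -
      have "(\<lambda>m. norm (E (s (r m)) - cadjoint (E (s (r m)))) / sqrt 2) \<longlonglongrightarrow> norm (E0 - cadjoint E0) / sqrt 2"
        by (intro tendsto_intros EE0) simp
      then have "(\<lambda>m. norm (W (s (r m)))) \<longlonglongrightarrow> 0"
        by (simp add: oblique_idempotent.norm_W_adjoint[OF obl[OF s0]] E0h)
      then show ?thesis by (rule tendsto_norm_zero_cancel)
    qed
    have FF: "(\<lambda>m. F (s (r m))) \<longlonglongrightarrow> E0"
      using tendsto_diff[OF EE0 WW] by (simp add: W_def)
    have eig: "N ** E0 = mat \<mu> ** E0"
    proof (rule normal_power_kernel[OF r(4) _ ord])
      show "poly_matrix ([:- \<mu>, 1:] ^ order \<mu> q) N ** E0 = 0"
        using poly_matrix_dvd[OF p(3) ann] unfolding poly_matrix_mult E0_def .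
    qed
    have E0w: "E0 ** w0 = w0"
    proof (rule LIMSEQ_unique[OF tendsto_matrix_mult[OF FF r(3)]])
      have "F (s k) ** w k = w k" for k
        using oblique_idempotent.FW[OF obl[OF s0], of k] by (simp add: w_def mmult.scaleR_right)
      then show "(\<lambda>m. F (s (r m)) ** w (r m)) \<longlonglongrightarrow> w0" using r(3) by simp
    qed
    have E0ws: "E0 ** cadjoint w0 = 0"
    proof (rule LIMSEQ_unique[OF tendsto_matrix_mult[OF FF tendsto_cadjoint[OF r(3)]]])
      have "F (s k) ** cadjoint (w k) = 0" for k
        using oblique_idempotent.FWs[OF obl[OF s0], of k] by (simp add: w_def cadjoint_scaleR mmult.scaleR_right)
      then show "(\<lambda>m. F (s (r m)) ** cadjoint (w (r m))) \<longlonglongrightarrow> 0" by simp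
    qed
    have \<mu>b: "cmod \<mu> \<le> b"
    proof -
      have "N ** (E0 ** w0) = mat \<mu> ** (E0 ** w0)" by (simp only: matrix_mul_assoc eig)
      then have "N ** w0 = mat \<mu> ** w0" by (simp only: E0w)
      then have "norm (N ** w0) = cmod \<mu>" by (simp add: norm_mat_mult nw0)
      moreover have "norm (N ** w0) \<le> b * norm w0" using r(5) unfolding op_bounded_def by blast
      ultimately show ?thesis by (simp add: nw0)
    qed
    (* W* maps into the complement of the range of E, on which N has no eigenvalue \<mu>. *)
    have nz: "(N - mat \<mu>) ** cadjoint w0 \<noteq> 0"
    proof
      assume "(N - mat \<mu>) ** cadjoint w0 = 0"
      then have "N ** cadjoint w0 = mat \<mu> ** cadjoint w0" by (simp add: mmult.diff_left)
      then have "E0 ** cadjoint w0 = mat (poly p \<mu>) ** cadjoint w0"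
        unfolding E0_def by (rule poly_matrix_eigen)
      then have "cadjoint w0 = 0" by (simp add: p1 E0ws)
      then have "norm (cadjoint w0) = 0" by simp
      then show False by (simp add: nw0)
    qed
    obtain l where l: "l < 0"
      "(\<lambda>m. inner (phi_matrix f g (X (s (r m)))) (E (s (r m)) ** cadjoint (E (s (r m))) - cadjoint (E (s (r m))) ** E (s (r m))) / (norm (W (s (r m))))\<^sup>2) \<longlonglongrightarrow> l"
    proof (rule obliqueness_rate_limit[where X = "\<lambda>m. X (s (r m))" and E = "\<lambda>m. E (s (r m))"
          and F = "\<lambda>m. F (s (r m))" and W = "\<lambda>m. W (s (r m))" and N = N and ?F0.0 = E0 and \<mu> = \<mu> and w = w0])
      show "(\<lambda>m. (1 / norm (W (s (r m)))) *\<^sub>R W (s (r m))) \<longlonglongrightarrow> w0"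
        using r(3) by (simp add: w_def)
      show "op_bounded b (X (s (r m)))" "oblique_idempotent (E (s (r m))) (F (s (r m))) (W (s (r m)))"
        "X (s (r m)) ** E (s (r m)) = E (s (r m)) ** X (s (r m))" "W (s (r m)) \<noteq> 0" for m
        by (rule bounded[OF s0] obl[OF s0] comm Wnz)+
    qed (rule r(2) r(4) WW FF eig \<mu> \<mu>b nz that; assumption?)+
    have "(\<lambda>m. - (1 / (real (r m) + 1))) \<longlonglongrightarrow> 0"
    proof -
      have "(\<lambda>m. - inverse (real (Suc m))) \<longlonglongrightarrow> - 0" by (intro tendsto_minus LIMSEQ_inverse_real_of_nat)
      then have "(\<lambda>m. - (1 / (real m + 1))) \<longlonglongrightarrow> 0" by (simp add: inverse_eq_divide add.commute)
      from LIMSEQ_subseq_LIMSEQ[OF this r(1)] show ?thesis by (simp add: o_def)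
    qed
    from this l(2) have "0 \<le> l"
    proof (rule LIMSEQ_le)
      have "- (1 / (real k + 1)) \<le> inner (phi_matrix f g (X (s k))) (E (s k) ** cadjoint (E (s k)) - cadjoint (E (s k)) ** E (s k)) / (norm (W (s k)))\<^sup>2" for k
        using s(2)[of k] Wnz[of k] unfolding H_def K_def by (simp add: pos_le_divide_eq)
      then show "\<exists>M. \<forall>m\<ge>M. - (1 / (real (r m) + 1)) \<le> inner (phi_matrix f g (X (s (r m)))) (E (s (r m)) ** cadjoint (E (s (r m))) - cadjoint (E (s (r m))) ** E (s (r m))) / (norm (W (s (r m))))\<^sup>2"
        by blast
    qed
    then show False using l(1) by simp
  qed
  then obtain c t0 where c: "0 < c" and t0: "0 \<le> t0"
    and le: "\<And>t. t0 \<le> t \<Longrightarrow> inner (H t) (K t) \<le> - c * (norm (W t))\<^sup>2" by blast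
  have dE: "(E has_vector_derivative commutator (H t) (E t)) (at t within {0..})" if "0 \<le> t" for t
    unfolding E_def H_def by (rule poly_matrix_has_derivative[OF deriv[OF that]])
  define G where "G t = inner (E t) (E t) - inner (mat 1) (E t)" for t
  have GW: "G t = (norm (W t))\<^sup>2" if "0 \<le> t" for t
    unfolding G_def oblique_idempotent.norm_W_sq[OF obl[OF that]] ..
  have dG: "(G has_real_derivative 2 * inner (H t) (K t)) (at t within {0..})" if t: "0 \<le> t" for t
  proof -
    have "((\<lambda>t. inner (mat 1) (E t)) has_vector_derivative inner (mat 1) (commutator (H t) (E t))) (at t within {0..})"
      by (rule bounded_linear.has_vector_derivative[OF bounded_linear_inner_right dE[OF t]])
    then have "((\<lambda>t. inner (mat 1) (E t)) has_real_derivative 0) (at t within {0..})"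
      by (simp add: has_real_derivative_iff_has_vector_derivative inner_commutator_self(2)[OF Hh])
    from DERIV_diff[OF has_real_derivative_inner_self[OF dE[OF t]] this] show ?thesis
      unfolding G_def K_def by (simp add: inner_commutator_self(1)[OF Hh])
  qed
  define C where "C = exp (2 * c * t0) * G t0"
  have C: "0 \<le> C" using GW[OF t0] by (simp add: C_def)
  have Gexp: "exp (2 * c * t) * G t \<le> C" if t: "t0 \<le> t" for t
    unfolding C_def
  proof (rule nonincreasing_on_halfline[where g = "\<lambda>t. exp (2 * c * t) * G t"
        and g' = "\<lambda>t. exp (2 * c * t) * (2 * inner (H t) (K t) + 2 * c * G t)"])
    fix u :: real assume u: "0 \<le> u"
    show "((\<lambda>t. exp (2 * c * t) * G t) has_real_derivative exp (2 * c * u) * (2 * inner (H u) (K u) + 2 * c * G u)) (at u within {0..})"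
      by (rule derivative_eq_intros dG[OF u] refl)+ (simp add: algebra_simps)
  next
    fix u assume u: "t0 < u" "u < t"
    then have "2 * inner (H u) (K u) + 2 * c * G u \<le> 0" using le[of u] GW[of u] t0 by simp
    then show "exp (2 * c * u) * (2 * inner (H u) (K u) + 2 * c * G u) \<le> 0" by (simp add: mult_le_0_iff)
  qed (use t t0 in auto)
  have Wexp: "norm (W t) \<le> sqrt C * exp (- (c * t))" if t: "t0 \<le> t" for t
  proof (rule power2_le_imp_le)
    have "exp (2 * c * t) * (norm (W t))\<^sup>2 \<le> C" using Gexp[OF t] GW[of t] t t0 by simp
    then have "(norm (W t))\<^sup>2 \<le> C * exp (- (2 * c * t))"
      by (simp add: exp_minus field_simps)
    also have "exp (- (2 * c * t)) = (exp (- (c * t)))\<^sup>2" by (simp add: exp_double[symmetric])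
    finally show "(norm (W t))\<^sup>2 \<le> (sqrt C * exp (- (c * t)))\<^sup>2" using C by (simp add: power_mult_distrib)
  qed (simp add: C)
  obtain M where M: "0 < M" "\<And>t. 0 \<le> t \<Longrightarrow> norm (phi_matrix f g (X t)) \<le> M" by (rule phi_bounded) blast
  define B where "B = 8 * sqrt 2 * L * R * norm (mat 1 :: complex ^ 'n ^ 'n) + 2 * M"
  have B: "0 \<le> B"
  proof -
    have "0 \<le> R" using norm_X[of 0] norm_ge_zero[of "X 0"] by linarith
    then show ?thesis using lip(1) M(1) by (simp add: B_def lipschitz_nonneg_def)
  qed
  define D where "D = B * sqrt C / c"
  have D: "0 \<le> D" using B C c by (simp add: D_def)
  have Ediff: "norm (E t - E s) \<le> D * exp (- (c * s))" if st: "t0 \<le> s" "s \<le> t" for s t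
  proof -
    have "norm (E t - E s) \<le> - D * exp (- (c * t)) - (- D * exp (- (c * s)))"
    proof (rule displacement_bound[where x = E and h = "\<lambda>t. - D * exp (- (c * t))" and h' = "\<lambda>t. B * (sqrt C * exp (- (c * t)))", OF dE])
      fix u :: real
      have "c * D = B * sqrt C" using c by (simp add: D_def)
      then show "((\<lambda>t. - D * exp (- (c * t))) has_real_derivative B * (sqrt C * exp (- (c * u)))) (at u within {0..})"
        by (auto intro!: derivative_eq_intros simp: mult.assoc[symmetric])
    next
      fix u assume u: "s < u" "u < t"
      then have u0: "0 \<le> u" "t0 \<le> u" using st t0 by linarith+
      have "norm (commutator (H u) (E u)) \<le> B * norm (W u)"
        unfolding H_def B_def
        by (rule commutator_phi_idempotent_le[OF obl[OF u0(1)] comm norm_X[OF u0(1)] M(2)[OF u0(1)]])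
      also have "\<dots> \<le> B * (sqrt C * exp (- (c * u)))" by (intro mult_left_mono Wexp u0 B)
      finally show "norm (commutator (H u) (E u)) \<le> B * (sqrt C * exp (- (c * u)))" .
    qed (use st t0 in auto)
    also have "\<dots> \<le> D * exp (- (c * s))" using D by simp
    finally show ?thesis .
  qed
  have "filterlim (\<lambda>t. c * t) at_top at_top"
    by (rule filterlim_tendsto_pos_mult_at_top[OF tendsto_const c filterlim_ident])
  then have "filterlim (\<lambda>t. - (c * t)) at_bot at_top" by (simp add: filterlim_uminus_at_bot)
  then have "((\<lambda>t. exp (- (c * t))) \<longlongrightarrow> 0) at_top" by (rule filterlim_compose[OF exp_at_bot])
  then have lim: "((\<lambda>t. D * exp (- (c * t))) \<longlongrightarrow> D * 0) at_top" by (rule tendsto_mult_left)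
  have "\<forall>\<^sub>F t in at_top. D * exp (- (c * t)) < \<epsilon>"
    by (rule order_tendstoD(2)[OF lim]) (use \<open>0 < \<epsilon>\<close> in simp)
  then obtain t2 where t2: "\<And>t. t2 \<le> t \<Longrightarrow> D * exp (- (c * t)) < \<epsilon>"
    unfolding eventually_at_top_linorder by blast
  show thesis
  proof (rule that[of "max t0 t2"])
    show "0 \<le> max t0 t2" using t0 by simp
    fix s t assume "max t0 t2 \<le> s" "s \<le> t"
    then show "norm (poly_matrix p (X t) - poly_matrix p (X s)) \<le> \<epsilon>"
      using Ediff[of s t] t2[of s] unfolding E_def by simp
  qed
qed

end

context smooth_flow
begin

text \<open>All limit points share the Riesz projections $F_\mu$ for the nonzero eigenvalues. A normal limit point
  acts as $\mu$ on the range of $F_\mu$ and vanishes on the range of $\prod_{\mu \ne 0}(1 - F_\mu)$.\<close>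

lemma limit_point_unique:
  fixes N1 N2 :: "complex ^ 'n ^ 'n"
  assumes s1: "filterlim s1 at_top sequentially" "(\<lambda>m. X (s1 m)) \<longlonglongrightarrow> N1"
    and s2: "filterlim s2 at_top sequentially" "(\<lambda>m. X (s2 m)) \<longlonglongrightarrow> N2"
  shows "N1 = N2"
proof -
  obtain q where q: "q \<noteq> 0" "poly_matrix q (X 0) = 0" by (rule annihilating_polynomial_exists[of "X 0"])
  define S where "S = {\<mu>. poly q \<mu> = 0 \<and> \<mu> \<noteq> 0}"
  have fin: "finite S" unfolding S_def by (rule finite_subset[OF _ poly_roots_finite[OF q(1)]]) auto
  have "\<exists>p. q dvd p * p - p \<and> [:- \<mu>, 1:] ^ order \<mu> q dvd 1 - p \<and> q dvd [:- \<mu>, 1:] ^ order \<mu> q * p" for \<mu>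
    by (rule riesz_polynomial[OF q(1), of \<mu>]) blast
  then have "\<forall>\<mu>. \<exists>p. q dvd p * p - p \<and> [:- \<mu>, 1:] ^ order \<mu> q dvd 1 - p \<and> q dvd [:- \<mu>, 1:] ^ order \<mu> q * p" by blast
  from choice[OF this] obtain p where p: "\<And>\<mu>. q dvd p \<mu> * p \<mu> - p \<mu>"
    "\<And>\<mu>. [:- \<mu>, 1:] ^ order \<mu> q dvd 1 - p \<mu>" "\<And>\<mu>. q dvd [:- \<mu>, 1:] ^ order \<mu> q * p \<mu>" by blast
  have ann: "poly_matrix q N = 0"
    if s: "filterlim s at_top sequentially" "(\<lambda>m. X (s m)) \<longlonglongrightarrow> N" for s N
  proof (rule LIMSEQ_unique[OF tendsto_poly_matrix[OF s(2)]])
    have "\<forall>\<^sub>F m in sequentially. 0 \<le> s m" using s(1) by (simp add: filterlim_at_top)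
    then have "\<forall>\<^sub>F m in sequentially. poly_matrix q (X (s m)) = 0"
      by eventually_elim (rule annihilated[OF q(2)])
    then show "(\<lambda>m. poly_matrix q (X (s m))) \<longlonglongrightarrow> 0" by (rule tendsto_eventually)
  qed
  note a1 = ann[OF s1] and a2 = ann[OF s2]
  note n1 = limit_point_normal(1)[OF s1] and n2 = limit_point_normal(1)[OF s2]
  have same: "poly_matrix (p \<mu>) N1 = poly_matrix (p \<mu>) N2" if "\<mu> \<in> S" for \<mu>
  proof -
    have d: "(\<lambda>m. norm (poly_matrix (p \<mu>) (X (s1 m)) - poly_matrix (p \<mu>) (X (s2 m)))) \<longlonglongrightarrow>
        norm (poly_matrix (p \<mu>) N1 - poly_matrix (p \<mu>) N2)"
      by (intro tendsto_intros tendsto_poly_matrix s1 s2)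
    have "norm (poly_matrix (p \<mu>) N1 - poly_matrix (p \<mu>) N2) \<le> \<epsilon>" if "0 < \<epsilon>" for \<epsilon>
    proof -
      obtain t1 where t1: "0 \<le> t1"
        "\<And>s t. t1 \<le> s \<Longrightarrow> s \<le> t \<Longrightarrow> norm (poly_matrix (p \<mu>) (X t) - poly_matrix (p \<mu>) (X s)) \<le> \<epsilon>"
        by (rule riesz_projection_cauchy[OF q _ _ p(1) p(2) p(3) \<open>0 < \<epsilon>\<close>, of \<mu>])
          (use \<open>\<mu> \<in> S\<close> in \<open>auto simp: S_def\<close>)
      have "\<forall>\<^sub>F m in sequentially. t1 \<le> s1 m" "\<forall>\<^sub>F m in sequentially. t1 \<le> s2 m"
        using s1(1) s2(1) by (simp_all add: filterlim_at_top)
      then have "\<forall>\<^sub>F m in sequentially. norm (poly_matrix (p \<mu>) (X (s1 m)) - poly_matrix (p \<mu>) (X (s2 m))) \<le> \<epsilon>"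
      proof eventually_elim
        case (elim m)
        show ?case
        proof (cases "s1 m \<le> s2 m")
          case True
          then show ?thesis using t1(2)[OF elim(1) True] by (simp add: norm_minus_commute)
        next
          case False
          then show ?thesis using t1(2)[OF elim(2), of "s1 m"] by simp
        qed
      qed
      from tendsto_upperbound[OF d this] show ?thesis by simp
    qed
    then have "norm (poly_matrix (p \<mu>) N1 - poly_matrix (p \<mu>) N2) \<le> 0"
      by (rule field_le_epsilon[where y = 0, simplified])
    then show ?thesis by simp
  qed
  have eig: "N ** poly_matrix (p \<mu>) N = mat \<mu> ** poly_matrix (p \<mu>) N"
    if "\<mu> \<in> S" "normal_matrix N" "poly_matrix q N = 0" for \<mu> N
  proof (rule normal_power_kernel[OF that(2)])
    show "0 < order \<mu> q" using that(1) q(1) order_root[of q \<mu>] unfolding S_def by blast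
    show "poly_matrix ([:- \<mu>, 1:] ^ order \<mu> q) N ** poly_matrix (p \<mu>) N = 0"
      using poly_matrix_dvd[OF p(3) that(3)] unfolding poly_matrix_mult .
  qed
  define D where "D = N1 - N2"
  have DF: "D ** poly_matrix (p \<mu>) N1 = 0" if "\<mu> \<in> S" for \<mu>
  proof -
    have "D ** poly_matrix (p \<mu>) N1 = N1 ** poly_matrix (p \<mu>) N1 - N2 ** poly_matrix (p \<mu>) N2"
      unfolding D_def mmult.diff_left by (simp only: same[OF that])
    also have "\<dots> = 0" unfolding eig[OF that n1 a1] eig[OF that n2 a2] unfolding same[OF that] by simp
    finally show ?thesis .
  qed
  have complement: "poly_matrix (\<Prod>\<mu>\<in>S'. 1 - p \<mu>) N1 = poly_matrix (\<Prod>\<mu>\<in>S'. 1 - p \<mu>) N2 \<and>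
      D ** poly_matrix (\<Prod>\<mu>\<in>S'. 1 - p \<mu>) N1 = D" if "S' \<subseteq> S" for S'
  proof -
    have "finite S'" using that fin by (rule finite_subset)
    then show ?thesis using that
    proof (induction S' rule: finite_induct)
      case (insert \<mu> S')
      let ?J = "\<Prod>\<mu>\<in>S'. 1 - p \<mu>"
      have step: "poly_matrix (\<Prod>\<mu>\<in>insert \<mu> S'. 1 - p \<mu>) N = (mat 1 - poly_matrix (p \<mu>) N) ** poly_matrix ?J N" for N :: "complex ^ 'n ^ 'n"
        using insert(1,2) by (simp add: poly_matrix_mult poly_matrix_diff)
      have J: "poly_matrix ?J N1 = poly_matrix ?J N2" "D ** poly_matrix ?J N1 = D" using insert by blast+
      have mem: "\<mu> \<in> S" using insert by simp
      have "D ** ((mat 1 - poly_matrix (p \<mu>) N1) ** poly_matrix ?J N1) = D ** poly_matrix ?J N1 - D ** poly_matrix (p \<mu>) N1 ** poly_matrix ?J N1"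
        by (simp add: mmult.diff_left mmult.diff_right matrix_mul_assoc)
      also have "\<dots> = D" unfolding DF[OF mem] J(2) by (simp add: mmult.zero_left)
      finally show ?case unfolding step using same[OF mem] J(1) by simp
    qed simp
  qed
  define J where "J = (\<Prod>\<mu>\<in>S. 1 - p \<mu>)"
  have NJ: "N ** poly_matrix J N = 0" if "normal_matrix N" "poly_matrix q N = 0" for N
  proof -
    (* The exponent is one more than the multiplicity of 0 in q, to be positive when q has no root 0. *)
    let ?x = "[:- 0, 1:] ^ Suc (order 0 q) :: complex poly"
    have fact: "smult (lead_coeff q) (\<Prod>z | poly q z = 0. [:- z, 1:] ^ order z q) = q"
      by (rule complex_poly_decompose)
    have zS: "0 \<notin> S" by (simp add: S_def)
    have "(\<Prod>z | poly q z = 0. [:- z, 1:] ^ order z q) dvd (\<Prod>z\<in>insert 0 S. [:- z, 1:] ^ order z q)"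
      by (rule prod_dvd_prod_subset) (use fin in \<open>auto simp: S_def\<close>)
    also have "(\<Prod>z\<in>insert 0 S. [:- z, 1:] ^ order z q) dvd (\<Prod>z\<in>insert 0 S. if z = 0 then ?x else 1 - p z)"
    proof (rule prod_dvd_prod)
      fix z assume "z \<in> insert 0 S"
      show "[:- z, 1:] ^ order z q dvd (if z = 0 then ?x else 1 - p z)"
        using p(2)[of z] le_imp_power_dvd[of "order 0 q" "Suc (order 0 q)" "[:- 0, 1:] :: complex poly"] by simp
    qed
    also have "(\<Prod>z\<in>insert 0 S. if z = 0 then ?x else 1 - p z) = ?x * J"
    proof -
      have "(\<Prod>z\<in>S. if z = 0 then ?x else 1 - p z) = J"
        unfolding J_def by (rule prod.cong[OF refl]) (use zS in auto)
      then show ?thesis using fin zS by simp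
    qed
    finally have "smult (lead_coeff q) (\<Prod>z | poly q z = 0. [:- z, 1:] ^ order z q) dvd ?x * J"
      using q(1) by (simp add: smult_dvd_iff)
    then have "q dvd ?x * J" unfolding fact .
    from poly_matrix_dvd[OF this that(2)] have "poly_matrix ?x N ** poly_matrix J N = 0"
      unfolding poly_matrix_mult .
    from normal_power_kernel[OF that(1) this] show ?thesis by (simp add: mmult.zero_left)
  qed
  have JJ: "poly_matrix J N1 = poly_matrix J N2" "D ** poly_matrix J N1 = D"
    using complement[OF order_refl] unfolding J_def by blast+
  have "D = D ** poly_matrix J N1" by (rule JJ(2)[symmetric])
  also have "\<dots> = N1 ** poly_matrix J N1 - N2 ** poly_matrix J N1"
    unfolding D_def by (rule mmult.diff_left)
  also have "\<dots> = N1 ** poly_matrix J N1 - N2 ** poly_matrix J N2" by (simp only: JJ(1))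
  also have "\<dots> = 0" unfolding NJ[OF n1 a1] NJ[OF n2 a2] by simp
  finally show ?thesis by (simp add: D_def)
qed

text \<open>A trajectory in a compact set with a single limit point converges.\<close>

theorem converges_to_normal: "\<exists>N. normal_matrix N \<and> (X \<longlongrightarrow> N) at_top"
proof -
  obtain r N w0 where r: "(\<lambda>m. X (real (r m))) \<longlonglongrightarrow> N" "normal_matrix N"
    "filterlim (\<lambda>m. real (r m)) at_top sequentially"
    by (rule subsequence_limit[of real "\<lambda>_. 0"]) auto
  have "(X \<longlongrightarrow> N) at_top"
  proof (rule tendstoI)
    fix e :: real assume e: "0 < e"
    show "\<forall>\<^sub>F t in at_top. dist (X t) N < e"
    proof (rule ccontr)
      assume neg: "\<not> ?thesis"
      have "\<exists>t. real m \<le> t \<and> e \<le> dist (X t) N" for m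
      proof (rule ccontr)
        assume "\<not> ?thesis"
        then have "\<forall>t\<ge>real m. dist (X t) N < e" by (meson not_le)
        then have "\<forall>\<^sub>F t in at_top. dist (X t) N < e"
          unfolding eventually_at_top_linorder by (rule exI[of _ "real m"])
        then show False using neg by (rule notE[rotated])
      qed
      then have "\<forall>m. \<exists>t. real m \<le> t \<and> e \<le> dist (X t) N" by (rule allI)
      from choice[OF this] obtain s where s: "\<And>m. real m \<le> s m" "\<And>m. e \<le> dist (X (s m)) N" by blast
      obtain k N' w' where k: "(\<lambda>m. X (s (k m))) \<longlonglongrightarrow> N'" "filterlim (\<lambda>m. s (k m)) at_top sequentially"
        by (rule subsequence_limit[OF s(1), of "\<lambda>_. 0"]) auto
      have "N' = N" by (rule limit_point_unique[OF k(2,1) r(3,1)])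
      have "(\<lambda>m. dist (X (s (k m))) N) \<longlonglongrightarrow> dist N' N" by (intro tendsto_intros k)
      then have "e \<le> dist N' N" by (rule LIMSEQ_le_const) (use s(2) in blast)
      then show False using \<open>N' = N\<close> e by simp
    qed
  qed
  then show ?thesis using r(2) by blast
qed

end

section \<open>The flow of a pair of $C^1$ functions\<close>

text \<open>Constant extension beyond $[0,b]$ keeps a function monotone and Lipschitz. Existence of the flow needs functions
  on the half-line, because the bound $b$ on the singular values is known only after a solution is found.\<close>

definition clamp_fun :: "real \<Rightarrow> (real \<Rightarrow> real) \<Rightarrow> real \<Rightarrow> real" where
  "clamp_fun b h x = h (max 0 (min b x))"

lemma clamp_fun_eq: "x \<in> {0..b} \<Longrightarrow> clamp_fun b h x = h x"
  by (simp add: clamp_fun_def)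

lemma clamp_fun_mono:
  assumes "mono_on {0..b} h" "0 \<le> b"
  shows "mono_on {0..} (clamp_fun b h)"
  unfolding clamp_fun_def using assms(2) by (intro mono_onI mono_onD[OF assms(1)]) auto

lemma clamp_fun_lipschitz:
  assumes "0 < b" and der: "\<And>x. x \<in> {0..b} \<Longrightarrow> (h has_real_derivative h' x) (at x within {0..b})"
    and cont: "continuous_on {0..b} h'"
  obtains L where "lipschitz_nonneg L (clamp_fun b h)"
proof -
  have "bounded (h' ` {0..b})" by (rule compact_imp_bounded[OF compact_continuous_image[OF cont compact_Icc]])
  then obtain L where L: "0 < L" "\<And>x. x \<in> {0..b} \<Longrightarrow> \<bar>h' x\<bar> \<le> L" unfolding bounded_pos by auto
  have "\<bar>clamp_fun b h x - clamp_fun b h y\<bar> \<le> L * \<bar>x - y\<bar>" for x y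
  proof -
    let ?c = "\<lambda>x. max 0 (min b x)"
    have "norm (h (?c x) - h (?c y)) \<le> L * norm (?c x - ?c y)"
      by (rule field_differentiable_bound[OF _ der]) (use L \<open>0 < b\<close> in auto)
    also have "\<dots> \<le> L * norm (x - y)" using L(1) by (intro mult_left_mono) auto
    finally show ?thesis by (simp add: clamp_fun_def)
  qed
  then show thesis using L(1) by (intro that[of L]) (simp add: lipschitz_nonneg_def)
qed

lemma lipschitz_nonneg_mono: "lipschitz_nonneg L h \<Longrightarrow> L \<le> L' \<Longrightarrow> lipschitz_nonneg L' h"
  unfolding lipschitz_nonneg_def by (meson abs_ge_zero mult_right_mono order_trans)

text \<open>The flow is defined by a definite description, which the existence and the uniqueness of the solution justify.\<close>

theorem flow_converges:
  fixes T :: "complex ^ 'n ^ 'n"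
  assumes b: "0 < b"
    and der1: "\<And>x. x \<in> {0..b} \<Longrightarrow> (\<phi>1 has_real_derivative \<phi>1' x) (at x within {0..b})"
    and der2: "\<And>x. x \<in> {0..b} \<Longrightarrow> (\<phi>2 has_real_derivative \<phi>2' x) (at x within {0..b})"
    and cont: "continuous_on {0..b} \<phi>1'" "continuous_on {0..b} \<phi>2'"
    and mono: "mono_on {0..b} \<phi>1" "mono_on {0..b} \<phi>2"
    and strict: "strict_mono_on {0..b} (\<lambda>x. \<phi>1 x + \<phi>2 x)"
    and pos: "\<And>x. x \<in> {0<..b} \<Longrightarrow> \<phi>1' x + \<phi>2' x > 0"
    and T: "T \<in> matrices_upto b"
  shows "\<exists>N. normal_matrix N \<and> ((\<lambda>t. phi_flow \<phi>1 \<phi>2 b t T) \<longlongrightarrow> N) at_top"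
proof -
  define f g where "f = clamp_fun b \<phi>1" and "g = clamp_fun b \<phi>2"
  have b0: "0 \<le> b" using b by simp
  have fg: "f x = \<phi>1 x" "g x = \<phi>2 x" if "x \<in> {0..b}" for x
    using that by (simp_all add: f_def g_def clamp_fun_eq)
  obtain L1 where L1: "lipschitz_nonneg L1 f" unfolding f_def by (rule clamp_fun_lipschitz[OF b der1 cont(1)])
  obtain L2 where L2: "lipschitz_nonneg L2 g" unfolding g_def by (rule clamp_fun_lipschitz[OF b der2 cont(2)])
  define L where "L = max L1 L2"
  have lip: "lipschitz_nonneg L f" "lipschitz_nonneg L g"
    using lipschitz_nonneg_mono[OF L1, of L] lipschitz_nonneg_mono[OF L2, of L] by (simp_all add: L_def)
  have mono0: "mono_on {0..} f" "mono_on {0..} g"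
    unfolding f_def g_def by (rule clamp_fun_mono[OF _ b0]; rule mono)+
  have phi: "phi_matrix \<phi>1 \<phi>2 A = phi_matrix f g A" if "op_bounded b A" for A :: "complex ^ 'n ^ 'n"
    by (rule phi_matrix_cong[OF that b0]) (simp add: fg)
  have "op_bounded b T" using T matrices_upto_iff[OF b0] by blast
  then obtain X where X: "X 0 = T" "\<And>t. 0 \<le> t \<Longrightarrow> op_bounded b (X t)"
    "\<And>t. 0 \<le> t \<Longrightarrow> (X has_vector_derivative commutator (phi_matrix f g (X t)) (X t)) (at t within {0..})"
    by (rule flow_exists[OF mono0 lip b0]) blast
  have der: "(f has_real_derivative \<phi>1' x) (at x within {0..b})" "(g has_real_derivative \<phi>2' x) (at x within {0..b})"
    if "x \<in> {0..b}" for x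
    by (rule has_field_derivative_transform_within[OF der1[OF that] zero_less_one that]
          has_field_derivative_transform_within[OF der2[OF that] zero_less_one that]; simp add: fg)+
  interpret smooth_flow f g \<phi>1' \<phi>2' L b X
  proof unfold_locales
    show "mono_on {0..b} f" "mono_on {0..b} g"
      using mono0 by (auto intro: mono_on_subset)
    show "strict_mono_on {0..b} (\<lambda>x. f x + g x)"
      using strict by (simp add: strict_mono_on_def fg)
  qed (use b lip X der cont pos in auto)
  have flow: "phi_flow \<phi>1 \<phi>2 b t T = X t" if t: "0 \<le> t" for t
    unfolding phi_flow_def
  proof (rule the_equality)
    have "flow_solution \<phi>1 \<phi>2 b T X"
      unfolding flow_solution_def matrices_upto_iff[OF b0] using X phi by simp
    then show "\<exists>Y. flow_solution \<phi>1 \<phi>2 b T Y \<and> X t = Y t" by blast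
    fix Z assume "\<exists>Y. flow_solution \<phi>1 \<phi>2 b T Y \<and> Z = Y t"
    then obtain Y where Y: "flow_solution \<phi>1 \<phi>2 b T Y" "Z = Y t" by blast
    have Y': "Y 0 = T" "\<And>t. 0 \<le> t \<Longrightarrow> op_bounded b (Y t)"
      "\<And>t. 0 \<le> t \<Longrightarrow> (Y has_vector_derivative commutator (phi_matrix f g (Y t)) (Y t)) (at t within {0..})"
      using Y(1) phi unfolding flow_solution_def matrices_upto_iff[OF b0] by auto
    show "Z = X t"
      unfolding Y(2)
      by (rule flow_unique[OF lip b0 Y'(2) Y'(3) X(2) X(3) _ t])
        (assumption | rule trans[OF Y'(1) X(1)[symmetric]])+
  qed
  obtain N where N: "normal_matrix N" "(X \<longlongrightarrow> N) at_top" using converges_to_normal by blast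
  have "\<forall>\<^sub>F t in at_top. X t = phi_flow \<phi>1 \<phi>2 b t T"
    unfolding eventually_at_top_linorder by (rule exI[of _ 0]) (simp add: flow)
  then have "((\<lambda>t. phi_flow \<phi>1 \<phi>2 b t T) \<longlongrightarrow> N) at_top" by (rule Lim_transform_eventually[OF N(2)])
  with N(1) show ?thesis by blast
qed

theorem theorem3p11:
  fixes b \<epsilon> :: real
    and \<phi>1 \<phi>2 \<phi>1' \<phi>2' :: "real \<Rightarrow> real"
    and \<psi>1 \<psi>2 :: "complex \<Rightarrow> complex"
    and T :: "complex ^ 'n ^ 'n"
  assumes "b > 0"
    and deriv1: "\<And>x. x \<in> {0..b} \<Longrightarrow> (\<phi>1 has_real_derivative \<phi>1' x) (at x within {0..b})"
    and deriv2: "\<And>x. x \<in> {0..b} \<Longrightarrow> (\<phi>2 has_real_derivative \<phi>2' x) (at x within {0..b})"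
    and "continuous_on {0..b} \<phi>1'" and "continuous_on {0..b} \<phi>2'"
    and "mono_on {0..b} \<phi>1" and "mono_on {0..b} \<phi>2"
    and "strict_mono_on {0..b} (\<lambda>x. \<phi>1 x + \<phi>2 x)"
    and deriv_pos: "\<And>x. x \<in> {0<..b} \<Longrightarrow> \<phi>1' x + \<phi>2' x > 0"
    and "\<phi>1 0 = 0" and "\<phi>2 0 = 0"
    and "\<epsilon> > 0"
    and ext1: "\<And>x. x \<in> {0..b\<^sup>2} \<Longrightarrow> \<psi>1 (complex_of_real x) = complex_of_real (\<phi>1 (sqrt x))"
    and ext2: "\<And>x. x \<in> {0..b\<^sup>2} \<Longrightarrow> \<psi>2 (complex_of_real x) = complex_of_real (\<phi>2 (sqrt x))"
    and "continuous_on (rectangle (b\<^sup>2) \<epsilon>) \<psi>1" and "continuous_on (rectangle (b\<^sup>2) \<epsilon>) \<psi>2"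
    and "\<psi>1 holomorphic_on interior (rectangle (b\<^sup>2) \<epsilon>)"
    and "\<psi>2 holomorphic_on interior (rectangle (b\<^sup>2) \<epsilon>)"
    and conditions:
      "((\<integral>\<^sup>+ t\<in>{-\<epsilon>..\<epsilon>}. ennreal (cmod (\<psi>1 (\<i> * complex_of_real t)) / t\<^sup>2) \<partial>lborel) < \<infinity> \<and>
        (\<integral>\<^sup>+ t\<in>{-\<epsilon>..\<epsilon>}. ennreal (cmod (\<psi>2 (\<i> * complex_of_real t)) / t\<^sup>2) \<partial>lborel) < \<infinity>) \<or>
       ((\<forall>x\<in>{0..b}. \<phi>2 x = 0) \<and>
        bounded ((\<lambda>x. \<phi>1' x / x) ` {0<..b}) \<and>
        (\<integral>\<^sup>+ t\<in>{-\<epsilon>..\<epsilon>}. ennreal (cmod (\<psi>1 (\<i> * complex_of_real t)) / \<bar>t\<bar>) \<partial>lborel) < \<infinity>)"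
    and "T \<in> matrices_upto b"
  shows "\<exists>N. normal_matrix N \<and> ((\<lambda>t. phi_flow \<phi>1 \<phi>2 b t T) \<longlongrightarrow> N) at_top"
  by (rule flow_converges[where \<phi>1' = \<phi>1' and \<phi>2' = \<phi>2'])
    (erule deriv1 deriv2 deriv_pos | fact)+

end
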